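(* Let $g\ge 6$ be an integer. If $g\ne 7$ then $\tau_g\ge \frac{g+2}{g^2}$, and $\tau_7\ge \frac{1}{7-\frac32}=\frac{2}{11}$.
   Context: Digraphs are finite, with no loops and no parallel arcs. The digirth of a digraph is the length of a shortest directed cycle. An oriented graph is a digraph of digirth at least $3$ (no pair of opposite arcs). $\mathrm{fv}(D)$ is the minimum size of a feedback vertex set of $D$, i.e. of a set $S\subseteq V(D)$ such that $D-S$ contains no directed cycle. For an integer $g\ge 3$, $$\tau_g=\sup\left\{\frac{\mathrm{fv}(D)}{n}\;:\; D\text{ is a planar oriented graph of digirth } g \text{ on } n \text{ vertices}\right\}.$$ *)

theory Defs
  imports "HOL-Analysis.Analysis" "HOL-Library.Extended_Nat" "Graph_Theory.Graph_Theory"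
begin

text \<open>
  The locale \<^locale>\<open>digraph\<close> describes finite digraphs without loops and without parallel arcs;
  \<^const>\<open>pre_digraph.cycle\<close> describes directed cycles, given as arc lists (a pair of opposite arcs
  is a cycle of length two).
\<close>

definition digirth :: "('a, 'b) pre_digraph \<Rightarrow> enat" where
  "digirth G = (INF p \<in> {p. pre_digraph.cycle G p}. enat (length p))"
  \<comment> \<open>infinite for acyclic digraphs\<close>

definition oriented_graph :: "('a, 'b) pre_digraph \<Rightarrow> bool" where
  "oriented_graph G \<longleftrightarrow> digraph G \<and> digirth G \<ge> 3"

definition feedback_vertex_set :: "('a, 'b) pre_digraph \<Rightarrow> 'a set \<Rightarrow> bool" where
  "feedback_vertex_set G S \<longleftrightarrow>
     S \<subseteq> verts G \<and> \<not> (\<exists>p. pre_digraph.cycle (G \<restriction> (verts G - S)) p)"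

definition fv :: "('a, 'b) pre_digraph \<Rightarrow> nat" where
  "fv G = (LEAST k. \<exists>S. feedback_vertex_set G S \<and> card S = k)"

definition plane_drawing ::
    "('a, 'b) pre_digraph \<Rightarrow> ('a \<Rightarrow> complex) \<Rightarrow> ('b \<Rightarrow> real \<Rightarrow> complex) \<Rightarrow> bool" where
  "plane_drawing G \<phi> \<gamma> \<longleftrightarrow>
     inj_on \<phi> (verts G) \<and>
     (\<forall>e \<in> arcs G. arc (\<gamma> e) \<and>
        pathstart (\<gamma> e) = \<phi> (tail G e) \<and> pathfinish (\<gamma> e) = \<phi> (head G e) \<and>
        path_image (\<gamma> e) \<inter> \<phi> ` verts G = {\<phi> (tail G e), \<phi> (head G e)}) \<and>
     (\<forall>e \<in> arcs G. \<forall>f \<in> arcs G. e \<noteq> f \<longrightarrow>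
        path_image (\<gamma> e) \<inter> path_image (\<gamma> f) \<subseteq> \<phi> ` verts G)"

definition planar :: "('a, 'b) pre_digraph \<Rightarrow> bool" where
  "planar G \<longleftrightarrow> (\<exists>\<phi> \<gamma>. plane_drawing G \<phi> \<gamma>)"

text \<open>
  Up to isomorphism every finite digraph without parallel arcs has natural numbers as vertices and
  pairs of vertices as arcs. The supremum is one of real numbers, so it relies on the set being
  bounded above, which is shown below, and nonempty, which holds for \<open>g \<ge> 3\<close> because of the
  directed cycle of length \<open>g\<close>.
\<close>

definition fv_ratios :: "nat \<Rightarrow> real set" where
  "fv_ratios g = {real (fv D) / real (card (verts D)) | D :: nat pair_pre_digraph.
     oriented_graph D \<and> planar D \<and> digirth D = enat g}"

definition tau :: "nat \<Rightarrow> real" where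
  "tau g = Sup (fv_ratios g)"

lemma feedback_vertex_set_verts:
  "feedback_vertex_set G (verts G)"
proof -
  have "\<not> pre_digraph.cycle (G \<restriction> (verts G - verts G)) p" for p
    by (auto simp: pre_digraph.cycle_def pre_digraph.awalk_def)
  then show ?thesis
    by (auto simp: feedback_vertex_set_def)
qed

lemma fv_le_card: "fv G \<le> card (verts G)"
  unfolding fv_def by (rule Least_le) (use feedback_vertex_set_verts in blast)

lemma fv_ratios_le_1: "r \<in> fv_ratios g \<Longrightarrow> r \<le> 1"
proof -
  assume "r \<in> fv_ratios g"
  then obtain D :: "nat pair_pre_digraph" where "r = real (fv D) / real (card (verts D))"
    unfolding fv_ratios_def by blast
  with fv_le_card[of D] show "r \<le> 1"
    by (auto simp: divide_le_eq_1)
qed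

lemma bdd_above_fv_ratios: "bdd_above (fv_ratios g)"
  using fv_ratios_le_1 by (rule bdd_aboveI)

end

theory Submission
  imports Defs
begin

text \<open>
  A planar digraph of digirth \<open>g\<close> with \<open>k\<close> disjoint directed cycles has at least \<open>g * k\<close> vertices, so a
  ratio above \<open>1 / g\<close> needs cycles that overlap and nevertheless cannot be hit together by fewer
  vertices. Here \<open>k\<close> directed cycles of length \<open>g\<close> are arranged like touching coins: all run
  clockwise, and two of them may share a single vertex, their point of tangency. If a vertex
  set uses the point of tangency \<open>p\<close> of two coins, it would hit both of them. To prevent this, \<open>p\<close> is
  bypassed on both sides by an arc that leaves one coin just before \<open>p\<close> and enters the other just
  after \<open>p\<close>. Deleting \<open>p\<close> then only merges the two coins into one longer directed cycle, so it
  destroys one cycle and not two. Hence every coin raises the feedback vertex number by one,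
  although a coin tangent to one or two earlier ones brings only \<open>g - 1\<close> or \<open>g - 2\<close> new vertices.
  This is the content of \<open>one_tangency.transversal\<close> and \<open>two_tangencies.transversal\<close>.

  The coins are attached one after another on the outside of the digraph, which keeps it planar
  (\<open>axis_drawable_one_tangency\<close>, \<open>axis_drawable_two_tangencies\<close>). The faces between the coins are
  counterclockwise directed cycles, and the digirth limits how many tangencies there can be. Let \<open>L\<close> be the
  length of the outer face. A coin with one tangency makes \<open>L\<close> grow by \<open>g - 2\<close>; a coin with two
  tangencies cuts off a new inner face, which is chosen to have length \<open>g\<close>, and makes \<open>L\<close> shrink by
  \<open>4\<close>. In both cases the quantity \<open>(g + 2) * n - g\<^sup>2 * k - L\<close> does not change, where \<open>n\<close> is the number of
  vertices. So if the construction goes on forever with bounded \<open>L\<close>, then \<open>k / n\<close> tends to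
  \<open>(g + 2) / g\<^sup>2\<close>.

  For \<open>g \<ge> 8\<close> this works by growing a tube: whenever \<open>L < g + 4\<close>, a coin with one tangency and a coin
  with two are added (\<open>stage_bump_join\<close>), which changes \<open>L\<close> by \<open>g - 6\<close>; otherwise a coin with two
  tangencies is added (\<open>stage_join\<close>). Distances between the few relevant vertices of the outer face
  are controlled because long stretches of it are paths whose inner vertices have no other arcs, so
  that walks have no choice there. For \<open>g = 6\<close> the pair of coins alone keeps \<open>L\<close> constant and gives
  \<open>2 / (2 * g - 3) = 2 / 9\<close>, which is \<open>(g + 2) / g\<^sup>2\<close>; for \<open>g = 7\<close> a repetition of the same pair, with inner
  faces that are longer than necessary, gives \<open>2 / 11\<close>.
\<close>

section \<open>Walks, dicycles and threads\<close>

lemma in_set_tlD: "x \<in> set (tl xs) \<Longrightarrow> x \<in> set xs"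
  by (cases xs) auto

abbreviation walk :: "'a rel \<Rightarrow> 'a list \<Rightarrow> bool" where
  "walk E \<equiv> successively (\<lambda>x y. (x, y) \<in> E)"

text \<open>
  Directed cycles are handled as lists of vertices; the arc from the last vertex back to the first
  one is implicit, so the length of the list is the length of the cycle.
\<close>

definition circuit :: "'a rel \<Rightarrow> 'a list \<Rightarrow> bool" where
  "circuit E xs \<longleftrightarrow> xs \<noteq> [] \<and> walk E xs \<and> (last xs, hd xs) \<in> E"

definition dicycle :: "'a rel \<Rightarrow> 'a list \<Rightarrow> bool" where
  "dicycle E xs \<longleftrightarrow> circuit E xs \<and> distinct xs"

lemma circuit_rotate: "circuit E (xs @ ys) \<Longrightarrow> circuit E (ys @ xs)"
  by (cases "xs = []"; cases "ys = []")
    (auto simp: circuit_def successively_append_iff)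

lemma dicycle_rotate: "dicycle E (xs @ ys) \<Longrightarrow> dicycle E (ys @ xs)"
  by (auto simp: dicycle_def intro: circuit_rotate)

lemma circuit_contains_dicycle:
  "circuit E xs \<Longrightarrow> \<exists>ys. dicycle E ys \<and> set ys \<subseteq> set xs"
proof (induction xs rule: length_induct)
  case (1 xs)
  show ?case
  proof (cases "distinct xs")
    case True
    then show ?thesis using 1 by (auto simp: dicycle_def)
  next
    case False
    then obtain as x bs cs where xs: "xs = as @ [x] @ bs @ [x] @ cs"
      using not_distinct_decomp by blast
    have "circuit E (x # bs)"
      using 1(2) unfolding circuit_def xs
      by (auto simp: successively_append_iff successively_Cons)
    moreover have "length (x # bs) < length xs" by (simp add: xs)
    ultimately show ?thesis using 1(1) unfolding xs by fastforce
  qed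
qed

lemma dicycle_hd:
  assumes "dicycle E xs" "x \<in> set xs"
  obtains ys where "dicycle E (x # ys)" "set (x # ys) = set xs" "length (x # ys) = length xs"
proof -
  obtain as bs where xs: "xs = as @ x # bs" using assms(2) split_list by metis
  have "dicycle E (x # bs @ as)" using dicycle_rotate[of E as "x # bs"] assms(1) xs by simp
  then show ?thesis using that[of "bs @ as"] xs by auto
qed

lemma dicycle_succ:
  assumes "dicycle E xs" "x \<in> set xs"
  shows "\<exists>y \<in> set xs. (x, y) \<in> E"
proof -
  obtain ys where ys: "dicycle E (x # ys)" "set (x # ys) = set xs"
    using dicycle_hd[OF assms] by metis
  show ?thesis using ys by (cases ys) (auto simp: dicycle_def circuit_def)
qed

lemma dicycle_pred:
  assumes "dicycle E xs" "x \<in> set xs"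
  shows "\<exists>y \<in> set xs. (y, x) \<in> E"
proof -
  obtain ys where ys: "dicycle E (x # ys)" "set (x # ys) = set xs"
    using dicycle_hd[OF assms] by metis
  then have "(last (x # ys), x) \<in> E" by (auto simp: dicycle_def circuit_def)
  moreover have "last (x # ys) \<in> set xs" unfolding ys(2)[symmetric] by (rule last_in_set) simp
  ultimately show ?thesis by blast
qed

text \<open>
  A path each of whose arcs \<open>(x, y)\<close> is the only arc out of \<open>x\<close> and the only arc into \<open>y\<close>. A walk that
  is on such a path has no choice, which is what makes distances computable. The first vertex may
  have several arcs into it, and the last vertex several arcs out of it.
\<close>

definition thread :: "'a rel \<Rightarrow> 'a list \<Rightarrow> bool" where
  "thread E xs \<longleftrightarrow> distinct xs \<and>
     successively (\<lambda>x y. \<forall>z. ((x, z) \<in> E \<longleftrightarrow> z = y) \<and> ((z, y) \<in> E \<longleftrightarrow> z = x)) xs"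

lemma thread_distinct: "thread E xs \<Longrightarrow> distinct xs"
  by (simp add: thread_def)

lemma thread_walk: "thread E xs \<Longrightarrow> walk E xs"
  unfolding thread_def by (auto elim: successively_mono)

lemma thread_appendD: "thread E (xs @ ys) \<Longrightarrow> thread E xs \<and> thread E ys"
  by (auto simp: thread_def successively_append_iff)

lemma thread_converse: "thread (E\<inverse>) (rev xs) \<longleftrightarrow> thread E xs"
  unfolding thread_def by (auto elim!: successively_mono)

lemma walk_converse: "walk (E\<inverse>) (rev xs) \<longleftrightarrow> walk E xs"
  by simp

lemma thread_cong:
  assumes "thread E xs"
    and "\<And>x z. x \<in> set (butlast xs) \<Longrightarrow> (x, z) \<in> E' \<longleftrightarrow> (x, z) \<in> E"
    and "\<And>y z. y \<in> set (tl xs) \<Longrightarrow> (z, y) \<in> E' \<longleftrightarrow> (z, y) \<in> E"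
  shows "thread E' xs"
  using assms
proof (induction xs)
  case (Cons a xs)
  show ?case
  proof (cases xs)
    case (Cons b ys)
    have "thread E xs" using thread_appendD[of E "[a]" xs] Cons.prems(1) by simp
    moreover have "x \<in> set (tl xs) \<Longrightarrow> x \<in> set xs" for x using Cons by auto
    ultimately have "thread E' xs"
      using Cons.prems(2,3) Cons by (intro Cons.IH) auto
    then show ?thesis using Cons.prems Cons by (auto simp: thread_def)
  qed (simp add: thread_def)
qed (simp add: thread_def)

definition path_arcs :: "'a list \<Rightarrow> 'a rel" where
  "path_arcs xs = set (zip xs (tl xs))"

lemma path_arcs_simps [simp]:
  "path_arcs [] = {}" "path_arcs [x] = {}" "path_arcs (x # y # xs) = insert (x, y) (path_arcs (y # xs))"
  by (auto simp: path_arcs_def)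

lemma path_arcs_butlast_tl: "path_arcs xs \<subseteq> set (butlast xs) \<times> set (tl xs)"
proof (induction xs)
  case (Cons a xs) then show ?case by (cases xs) auto
qed simp

lemma path_arcs_subset: "path_arcs xs \<subseteq> set xs \<times> set xs"
  unfolding path_arcs_def using set_zip_rightD[of _ _ xs "tl xs"] set_zip_leftD[of _ _ xs "tl xs"]
  by (cases xs) (auto intro: set_zip_rightD dest: set_zip_leftD set_zip_rightD)

lemma path_arcs_nth: "(a, b) \<in> path_arcs L \<longleftrightarrow> (\<exists>i. Suc i < length L \<and> a = L ! i \<and> b = L ! Suc i)"
  unfolding path_arcs_def in_set_zip by (auto simp: nth_tl less_diff_conv)

lemma path_arcs_Cons: "xs \<noteq> [] \<Longrightarrow> path_arcs (x # xs) = insert (x, hd xs) (path_arcs xs)"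
  by (cases xs) auto

lemma path_arcs_snoc: "xs \<noteq> [] \<Longrightarrow> path_arcs (xs @ [y]) = insert (last xs, y) (path_arcs xs)"
  by (induction xs) (auto simp: path_arcs_Cons)

lemma path_arcs_rev: "path_arcs (rev xs) = (path_arcs xs)\<inverse>"
proof (induction xs)
  case (Cons x xs)
  then show ?case by (cases "xs = []") (auto simp: path_arcs_Cons path_arcs_snoc last_rev)
qed simp

lemma path_arcs_outer: "xs \<noteq> [] \<Longrightarrow> path_arcs (u # xs @ [w]) = path_arcs xs \<union> {(u, hd xs), (last xs, w)}"
  by (auto simp: path_arcs_Cons path_arcs_snoc)

lemma path_arcs_distinct: "distinct xs \<Longrightarrow> (a, b) \<in> path_arcs xs \<Longrightarrow> a \<noteq> b"
  unfolding path_arcs_nth by (auto simp: nth_eq_iff_index_eq)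

lemma thread_path_arcs: "distinct xs \<Longrightarrow> thread (path_arcs xs) xs"
proof (induction xs)
  case (Cons a xs)
  show ?case
  proof (cases xs)
    case (Cons b ys)
    have a: "(a, z) \<notin> path_arcs xs" "(z, a) \<notin> path_arcs xs" for z
      using Cons.prems path_arcs_subset[of xs] by auto
    have b: "(z, b) \<notin> path_arcs xs" for z
      using Cons.prems Cons path_arcs_butlast_tl[of xs] by auto
    have "thread (path_arcs (a # xs)) xs"
    proof (rule thread_cong)
      show "thread (path_arcs xs) xs" using Cons.IH Cons.prems by simp
    next
      fix x z assume "x \<in> set (butlast xs)"
      then have "x \<noteq> a" using Cons.prems by (auto dest: in_set_butlastD)
      then show "((x, z) \<in> path_arcs (a # xs)) = ((x, z) \<in> path_arcs xs)"
        using Cons by simp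
    next
      fix y z assume "y \<in> set (tl xs)"
      then show "((z, y) \<in> path_arcs (a # xs)) = ((z, y) \<in> path_arcs xs)"
        using Cons Cons.prems by auto
    qed
    then show ?thesis using a b Cons.prems Cons by (auto simp: thread_def)
  qed (simp add: thread_def)
qed (simp add: thread_def)

lemma walk_leaving_thread:
  assumes "thread E A" "A \<noteq> []" "walk E ys" "ys \<noteq> []" "hd ys = hd A"
    and "last ys \<notin> set (butlast A)"
  shows "\<exists>zs. ys = A @ zs"
  using assms
proof (induction A arbitrary: ys)
  case (Cons a A)
  obtain ys' where ys: "ys = a # ys'" using Cons.prems by (cases ys) auto
  show ?case
  proof (cases A)
    case Nil
    then show ?thesis using ys by simp
  next
    case (Cons b B)
    have ne: "ys' \<noteq> []" using Cons.prems(6) Cons ys by auto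
    then have "(a, hd ys') \<in> E" using Cons.prems(3) ys by (auto simp: successively_Cons)
    then have "hd ys' = hd A" using Cons.prems(1) Cons by (auto simp: thread_def)
    moreover have "thread E A" using thread_appendD[of E "[a]" A] Cons.prems(1) by simp
    moreover have "walk E ys'" using Cons.prems(3) ys by (auto simp: successively_Cons)
    moreover have "last ys' \<notin> set (butlast A)" using Cons.prems(6) ne ys Cons by auto
    ultimately show ?thesis using Cons.IH[of ys'] ne Cons ys by auto
  qed
qed simp

lemma walk_entering_thread:
  assumes "thread E B" "B \<noteq> []" "walk E ys" "ys \<noteq> []" "last ys = last B"
    and "hd ys \<notin> set (tl B)"
  shows "\<exists>zs. ys = zs @ B"
proof -
  have "\<exists>zs. rev ys = rev B @ zs"
  proof (rule walk_leaving_thread)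
    show "thread (E\<inverse>) (rev B)" using assms thread_converse by metis
    show "walk (E\<inverse>) (rev ys)" using assms walk_converse by simp
    show "hd (rev ys) = hd (rev B)" using assms by (simp add: hd_rev)
    have "butlast (rev B) = rev (tl B)" by (cases B) auto
    then show "last (rev ys) \<notin> set (butlast (rev B))" using assms by (simp add: last_rev)
  qed (use assms in auto)
  then obtain zs where "rev ys = rev B @ zs" ..
  then have "ys = rev zs @ B" by (metis rev_append rev_rev_ident)
  then show ?thesis ..
qed

lemma walk_between_threads:
  assumes "thread E A" "A \<noteq> []" "thread E B" "B \<noteq> []" "set A \<inter> set B = {}"
    and "walk E ys" "ys \<noteq> []" "hd ys = hd A" "last ys = last B"
  obtains zs where "ys = A @ zs @ B"
proof -
  have "last B \<in> set B" "hd A \<in> set A" using assms by auto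
  then have "last ys \<notin> set A" "hd ys \<notin> set B" using assms(5,8,9) by (metis disjoint_iff)+
  then have "last ys \<notin> set (butlast A)" "hd ys \<notin> set (tl B)"
    using assms(4) by (auto dest: in_set_butlastD list.set_sel(2))
  then obtain zs zs' where "ys = A @ zs" "ys = zs' @ B"
    using walk_leaving_thread[of E A ys] walk_entering_thread[of E B ys] assms by metis
  then obtain us where "(A = zs' @ us \<and> us @ zs = B) \<or> (A @ us = zs' \<and> zs = us @ B)"
    using append_eq_append_conv2[of A zs zs' B] by auto
  then show ?thesis
  proof
    assume *: "A = zs' @ us \<and> us @ zs = B"
    then have "us = []" using assms(5) by (cases us) auto
    then show ?thesis using that[of "[]"] * \<open>ys = A @ zs\<close> by auto
  next
    assume "A @ us = zs' \<and> zs = us @ B"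
    then show ?thesis using that[of us] \<open>ys = A @ zs\<close> by auto
  qed
qed

lemma thread_subset_dicycle:
  assumes "thread E R" "dicycle E xs" "set R \<inter> set xs \<noteq> {}"
  shows "set R \<subseteq> set xs"
  using assms(1,3)
proof (induction R)
  case (Cons a R)
  show ?case
  proof (cases R)
    case Nil then show ?thesis using Cons.prems by auto
  next
    case (Cons b S)
    have t: "thread E R" using thread_appendD[of E "[a]" R] Cons.prems(1) by simp
    have ab: "(a, z) \<in> E \<longleftrightarrow> z = b" "(z, b) \<in> E \<longleftrightarrow> z = a" for z
      using Cons.prems(1) Cons by (auto simp: thread_def)
    have "a \<in> set xs \<longleftrightarrow> b \<in> set xs"
      using dicycle_succ[OF assms(2), of a] dicycle_pred[OF assms(2), of b] ab by auto
    moreover have "set R \<inter> set xs \<noteq> {} \<Longrightarrow> set R \<subseteq> set xs" using Cons.IH t by simp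
    ultimately show ?thesis using Cons.prems(2) Cons by auto
  qed
qed simp

lemma dicycle_through_thread:
  assumes "thread E R" "R \<noteq> []" "dicycle E xs" "set R \<inter> set xs \<noteq> {}"
  obtains ys where "dicycle E (R @ ys)" "set (R @ ys) = set xs" "length (R @ ys) = length xs"
proof -
  have "set R \<subseteq> set xs" using thread_subset_dicycle assms by metis
  then have "hd R \<in> set xs" using assms(2) by auto
  then obtain zs where zs: "dicycle E (hd R # zs)" "set (hd R # zs) = set xs"
    "length (hd R # zs) = length xs" using dicycle_hd assms(3) by metis
  have "last (hd R # zs) \<notin> set (butlast R)"
  proof
    assume "last (hd R # zs) \<in> set (butlast R)"
    then obtain as bs where b: "butlast R = as @ last (hd R # zs) # bs" using split_list by metis
    have "R = butlast R @ [last R]" using assms(2) by simp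
    then obtain y cs where R: "R = as @ last (hd R # zs) # y # cs"
      using b by (cases bs) auto
    have "(last (hd R # zs), hd R) \<in> E" using zs(1) by (auto simp: dicycle_def circuit_def)
    moreover have "thread E (as @ last (hd R # zs) # y # cs)" using R assms(1) by argo
    then have "thread E (last (hd R # zs) # y # cs)" using thread_appendD by blast
    ultimately have "hd R = y" by (auto simp: thread_def)
    moreover have "distinct R" using assms(1) by (simp add: thread_def)
    ultimately show False using R by (metis append_self_conv2 distinct.simps(2) hd_append list.sel(1)
        distinct_append disjoint_iff list.set_intros(1) list.set_intros(2) hd_in_set)
  qed
  then obtain ys where "hd R # zs = R @ ys"
    using walk_leaving_thread[OF assms(1,2), of "hd R # zs"] zs(1)
    by (auto simp: dicycle_def circuit_def)
  then show ?thesis using that[of ys] zs by auto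
qed

section \<open>Transversals, girth and gaps\<close>

definition girth_ge :: "'a rel \<Rightarrow> nat \<Rightarrow> bool" where
  "girth_ge E g \<longleftrightarrow> (\<forall>xs. dicycle E xs \<longrightarrow> g \<le> length xs)"

definition hits :: "'a rel \<Rightarrow> 'a set \<Rightarrow> bool" where
  "hits E S \<longleftrightarrow> (\<forall>xs. dicycle E xs \<longrightarrow> set xs \<inter> S \<noteq> {})"

definition transversal_ge :: "'a rel \<Rightarrow> nat \<Rightarrow> bool" where
  "transversal_ge E k \<longleftrightarrow> (\<forall>S. finite S \<and> hits E S \<longrightarrow> k \<le> card S)"

text \<open>
  A lower bound on the distance from \<open>a\<close> to \<open>b\<close>, counted in inner vertices. Restricting it to simple
  walks is enough, because it is only applied to pieces of dicycles, and it spares arguments about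
  walks that pass the same path twice.
\<close>

definition gap :: "'a rel \<Rightarrow> 'a \<Rightarrow> 'a \<Rightarrow> nat \<Rightarrow> bool" where
  "gap E a b d \<longleftrightarrow> (\<forall>zs. walk E (a # zs @ [b]) \<and> distinct (a # zs @ [b]) \<longrightarrow> d \<le> length zs)"

lemma hits_circuit: "hits E S \<Longrightarrow> circuit E xs \<Longrightarrow> set xs \<inter> S \<noteq> {}"
  using circuit_contains_dicycle[of E xs] unfolding hits_def by blast

lemma walk_restrict:
  assumes "walk E' xs" "set xs \<subseteq> W" "E' \<inter> W \<times> W \<subseteq> E"
  shows "walk E xs"
  using assms(1) by (rule successively_mono) (use assms in auto)

lemma walk_mono: "walk E xs \<Longrightarrow> E \<subseteq> E' \<Longrightarrow> walk E' xs"
  by (erule successively_mono) auto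

lemma circuit_mono: "circuit E xs \<Longrightarrow> E \<subseteq> E' \<Longrightarrow> circuit E' xs"
  by (auto simp: circuit_def intro: walk_mono)

lemma dicycle_mono: "dicycle E xs \<Longrightarrow> E \<subseteq> E' \<Longrightarrow> dicycle E' xs"
  by (auto simp: dicycle_def intro: circuit_mono)

lemma dicycle_restrict:
  assumes "dicycle E' xs" "set xs \<subseteq> W" "E' \<inter> W \<times> W \<subseteq> E"
  shows "dicycle E xs"
proof -
  have "last xs \<in> W" "hd xs \<in> W"
    using assms(1,2) by (auto simp: dicycle_def circuit_def subset_iff)
  then show ?thesis
    using assms walk_restrict[of E' xs W E] by (auto simp: dicycle_def circuit_def)
qed

lemma dicycle_subset: "dicycle E xs \<Longrightarrow> E \<subseteq> V \<times> V \<Longrightarrow> set xs \<subseteq> V"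
  using dicycle_succ by fast

text \<open>
  The form in which each attachment raises the feedback vertex number: from a set that hits the new
  digraph a vertex can be dropped such that the rest still hits the old one.
\<close>

lemma transversal_ge_Suc:
  assumes "transversal_ge E k"
    and "\<And>S. finite S \<Longrightarrow> hits E' S \<Longrightarrow> \<exists>T \<subset> S. hits E T"
  shows "transversal_ge E' (Suc k)"
  unfolding transversal_ge_def
proof (intro allI impI, elim conjE)
  fix S assume S: "finite S" "hits E' S"
  then obtain T where "T \<subset> S" "hits E T" using assms(2) by blast
  then have "k \<le> card T" "card T < card S"
    using assms(1) S(1) by (auto simp: transversal_ge_def psubset_card_mono intro: finite_subset)
  then show "Suc k \<le> card S" by simp
qed

lemma hits_minus_new:
  assumes "hits E' S" "E \<subseteq> E'" "E \<subseteq> V \<times> V" "R \<inter> V = {}"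
  shows "hits E (S - R)"
  unfolding hits_def
proof (intro allI impI)
  fix xs assume xs: "dicycle E xs"
  then have "set xs \<inter> S \<noteq> {}" using assms(1,2) dicycle_mono unfolding hits_def by blast
  then show "set xs \<inter> (S - R) \<noteq> {}" using dicycle_subset[OF xs assms(3)] assms(4) by blast
qed

section \<open>Attaching a cycle with one tangency\<close>

text \<open>
  The arcs around a point of tangency \<open>p\<close>, where an old cycle runs \<open>u, p, w\<close> and the new cycle runs
  along \<open>Y\<close>, through \<open>p\<close> and on along \<open>X\<close>. Two arcs make \<open>p\<close> a vertex of the new cycle; the other two
  are the bypasses, from the new cycle to the old one and back.
\<close>

definition tangency_arcs :: "'a \<Rightarrow> 'a \<Rightarrow> 'a \<Rightarrow> 'a list \<Rightarrow> 'a list \<Rightarrow> 'a rel" where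
  "tangency_arcs u p w Y X = {(last Y, p), (p, hd X), (last Y, w), (u, hd X)}"

locale new_paths =
  fixes V :: "'a set" and E :: "'a rel"
  assumes E_sub: "E \<subseteq> V \<times> V"
begin

lemma arc_in_V: "(x, y) \<in> E \<Longrightarrow> x \<in> V \<and> y \<in> V"
  using E_sub by blast

lemma thread3:
  assumes "thread E [u, p, w]"
  shows "(u, z) \<in> E \<longleftrightarrow> z = p" "(z, p) \<in> E \<longleftrightarrow> z = u" "(p, z) \<in> E \<longleftrightarrow> z = w"
    "(z, w) \<in> E \<longleftrightarrow> z = p" "u \<in> V" "p \<in> V" "w \<in> V" "u \<noteq> p" "p \<noteq> w" "u \<noteq> w"
  using assms arc_in_V by (auto simp: thread_def)

text \<open>
  If putting \<open>p\<close> back spoils a hitting set, then some dicycle through \<open>p\<close> is otherwise missed; without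
  \<open>p\<close> it is a walk from \<open>w\<close> to \<open>u\<close>, ready to be closed up through a new cycle by the bypasses at \<open>p\<close>.
\<close>

lemma missed_dicycle_through:
  assumes "thread E [u, p, w]" "hits E' S" "E \<subseteq> E'" "\<not> hits E (S - {p})"
  obtains ys where "walk E ys" "ys \<noteq> []" "hd ys = w" "last ys = u"
    "set ys \<inter> (S - {p}) = {}" "p \<notin> set ys"
proof -
  obtain xs where xs: "dicycle E xs" "set xs \<inter> (S - {p}) = {}"
    using assms(4) by (auto simp: hits_def)
  then have "set xs \<inter> S \<noteq> {}" using assms(2,3) dicycle_mono unfolding hits_def by blast
  then have "p \<in> set xs" using xs by blast
  then obtain ys where ys: "dicycle E (p # ys)" "set (p # ys) = set xs"
    using dicycle_hd xs(1) by metis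
  have ne: "ys \<noteq> []" using ys(1) thread3[OF assms(1)] by (auto simp: dicycle_def circuit_def)
  then show ?thesis
    using that[of ys] ys xs(2) thread3[OF assms(1)]
    by (auto simp: dicycle_def circuit_def successively_Cons)
qed

end

text \<open>The new cycle is \<open>N\<close> closed up by \<open>p\<close>.\<close>

locale one_tangency = new_paths +
  fixes u p w :: 'a and N :: "'a list"
  assumes upw: "thread E [u, p, w]"
    and N: "N \<noteq> []" "distinct N" "set N \<inter> V = {}"
begin

definition E' :: "'a rel" where
  "E' = E \<union> path_arcs N \<union> tangency_arcs u p w N N"

lemmas upw_simps = thread3[OF upw]

lemma N_ends: "hd N \<in> set N" "last N \<in> set N" "hd N \<notin> V" "last N \<notin> V"
  using N by (auto simp: disjoint_iff)

lemma E_E': "E \<subseteq> E'" by (auto simp: E'_def)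

lemma E'_sub: "E' \<subseteq> (V \<union> set N) \<times> (V \<union> set N)"
  using E_sub path_arcs_subset[of N] N_ends upw_simps by (auto simp: E'_def tangency_arcs_def)

lemma E'_old: "E' \<inter> V \<times> V \<subseteq> E"
  using path_arcs_subset[of N] N_ends N by (auto simp: E'_def tangency_arcs_def)

lemma arc_simps:
  "(last N, z) \<in> E' \<longleftrightarrow> z = p \<or> z = w"
  "(u, z) \<in> E' \<longleftrightarrow> z = p \<or> z = hd N"
  "(p, z) \<in> E' \<longleftrightarrow> z = w \<or> z = hd N"
  "(z, hd N) \<in> E' \<longleftrightarrow> z = p \<or> z = u"
  "(z, p) \<in> E' \<longleftrightarrow> z = u \<or> z = last N"
  "(z, w) \<in> E' \<longleftrightarrow> z = p \<or> z = last N"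
proof -
  have 1: "(last N, z) \<notin> path_arcs N" for z
  proof
    assume "(last N, z) \<in> path_arcs N"
    then have "last N \<in> set (butlast N)" using path_arcs_butlast_tl[of N] by auto
    then show False using N by (cases N rule: rev_cases) auto
  qed
  have 2: "(z, hd N) \<notin> path_arcs N" for z
  proof
    assume "(z, hd N) \<in> path_arcs N"
    then have "hd N \<in> set (tl N)" using path_arcs_butlast_tl[of N] by auto
    then show False using N by (cases N) auto
  qed
  have 3: "(x, y) \<in> path_arcs N \<Longrightarrow> x \<notin> V \<and> y \<notin> V" for x y
    using path_arcs_subset[of N] N by auto
  have 4: "(u, z) \<notin> path_arcs N" "(p, z) \<notin> path_arcs N" "(z, p) \<notin> path_arcs N" "(z, w) \<notin> path_arcs N" for z
    using 3 upw_simps by blast+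
  show "(last N, z) \<in> E' \<longleftrightarrow> z = p \<or> z = w" "(u, z) \<in> E' \<longleftrightarrow> z = p \<or> z = hd N"
    "(p, z) \<in> E' \<longleftrightarrow> z = w \<or> z = hd N" "(z, hd N) \<in> E' \<longleftrightarrow> z = p \<or> z = u"
    "(z, p) \<in> E' \<longleftrightarrow> z = u \<or> z = last N" "(z, w) \<in> E' \<longleftrightarrow> z = p \<or> z = last N"
    using 1 2 4 upw_simps N_ends arc_in_V by (auto simp: E'_def tangency_arcs_def)
qed

lemma thread_N: "thread E' N"
proof (rule thread_cong[OF thread_path_arcs[OF N(2)]])
  fix x z assume x: "x \<in> set (butlast N)"
  then have "x \<notin> V" "x \<in> set N" using N by (auto dest: in_set_butlastD)
  moreover have "x \<noteq> last N" using x N by (cases N rule: rev_cases) auto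
  ultimately show "(x, z) \<in> E' \<longleftrightarrow> (x, z) \<in> path_arcs N"
    using arc_in_V upw_simps by (auto simp: E'_def tangency_arcs_def)
next
  fix x z assume x: "x \<in> set (tl N)"
  then have "x \<notin> V" "x \<in> set N" using N by (auto dest: in_set_tlD)
  moreover have "x \<noteq> hd N" using x N by (cases N) auto
  ultimately show "(z, x) \<in> E' \<longleftrightarrow> (z, x) \<in> path_arcs N"
    using arc_in_V upw_simps by (auto simp: E'_def tangency_arcs_def)
qed

lemma old_thread:
  assumes "thread E xs" "set xs \<subseteq> V" "{u, p} \<inter> set (butlast xs) = {}" "{p, w} \<inter> set (tl xs) = {}"
  shows "thread E' xs"
proof (rule thread_cong[OF assms(1)])
  fix x z assume x: "x \<in> set (butlast xs)"
  then have "x \<in> V" "x \<notin> set N" using assms(2) N by (auto dest: in_set_butlastD)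
  then show "(x, z) \<in> E' \<longleftrightarrow> (x, z) \<in> E"
    using x assms(3) path_arcs_subset[of N] N_ends by (auto simp: E'_def tangency_arcs_def)
next
  fix x z assume x: "x \<in> set (tl xs)"
  then have "x \<in> V" "x \<notin> set N" using assms(2) N by (auto dest: in_set_tlD)
  then show "(z, x) \<in> E' \<longleftrightarrow> (z, x) \<in> E"
    using x assms(4) path_arcs_subset[of N] N_ends by (auto simp: E'_def tangency_arcs_def)
qed

lemma girth:
  assumes "girth_ge E g" "g \<le> Suc (length N)"
  shows "girth_ge E' g"
  unfolding girth_ge_def
proof (intro allI impI)
  fix xs assume xs: "dicycle E' xs"
  show "g \<le> length xs"
  proof (cases "set N \<inter> set xs = {}")
    case True
    then have "set xs \<subseteq> V" using dicycle_subset[OF xs E'_sub] by auto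
    then have "dicycle E xs" using dicycle_restrict[OF xs _ E'_old] by simp
    then show ?thesis using assms by (simp add: girth_ge_def)
  next
    case False
    then have sub: "set N \<subseteq> set xs" using thread_subset_dicycle[OF thread_N xs] by simp
    then obtain z where z: "z \<in> set xs" "(last N, z) \<in> E'" using dicycle_succ[OF xs] N_ends by blast
    then have "z \<in> V" using arc_simps upw_simps by auto
    then have "insert z (set N) \<subseteq> set xs" "z \<notin> set N" using sub z N by auto
    then have "card (insert z (set N)) \<le> card (set xs)" by (intro card_mono) auto
    moreover have "card (insert z (set N)) = Suc (length N)"
      using N(2) \<open>z \<notin> set N\<close> by (simp add: distinct_card)
    ultimately have "Suc (length N) \<le> card (set xs)" by simp
    then show ?thesis using assms(2) card_length[of xs] by linarith
  qed
qed

lemma transversal: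
  assumes "transversal_ge E k"
  shows "transversal_ge E' (Suc k)"
proof (rule transversal_ge_Suc[OF assms])
  fix S assume S: "finite S" "hits E' S"
  show "\<exists>T \<subset> S. hits E T"
  proof (cases "S \<inter> set N = {}")
    case False
    then show ?thesis using hits_minus_new[OF S(2) E_E' E_sub N(3)] by blast
  next
    case True
    \<comment> \<open>The new cycle itself can only be hit in \<open>p\<close>; the dicycles through \<open>p\<close> are still hit when \<open>p\<close> is
      dropped, because each of them has a detour along \<open>N\<close>.\<close>
    have "circuit E' (N @ [p])"
      using N thread_walk[OF thread_N] arc_simps by (auto simp: circuit_def successively_append_iff)
    then have "p \<in> S" using hits_circuit[OF S(2)] True by fastforce
    moreover have "hits E (S - {p})"
    proof (rule ccontr)
      assume "\<not> hits E (S - {p})"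
      then obtain ys where ys: "walk E ys" "ys \<noteq> []" "hd ys = w" "last ys = u"
        "set ys \<inter> (S - {p}) = {}" "p \<notin> set ys"
        using missed_dicycle_through[OF upw S(2) E_E'] by metis
      then have "circuit E' (N @ ys)"
        using N thread_walk[OF thread_N] arc_simps walk_mono[OF _ E_E', of ys]
        by (auto simp: circuit_def successively_append_iff)
      then show False using hits_circuit[OF S(2)] ys True by fastforce
    qed
    ultimately show ?thesis by blast
  qed
qed

text \<open>
  From the end of the new path only \<open>p\<close> and \<open>w\<close> can be reached, and from \<open>p\<close> a simple walk also has to
  go on to \<open>w\<close>, since it cannot enter the new path again. So the distance to \<open>b\<close> is that along the old
  thread starting at \<open>w\<close>.
\<close>

lemma gap_from_new:
  assumes "thread E P2" "P2 \<noteq> []" "hd P2 = w" "b \<in> V" "b \<notin> set P2" "gap E (last P2) b d"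
    "p \<noteq> b"
  shows "gap E' (last N) b (length P2 + d)"
  unfolding gap_def
proof (intro allI impI, elim conjE)
  fix zs assume zs: "walk E' (last N # zs @ [b])" "distinct (last N # zs @ [b])"
  have new: "set zs \<inter> set N = {}"
  proof (rule ccontr)
    assume "set zs \<inter> set N \<noteq> {}"
    then obtain x where x: "x \<in> set zs" "x \<in> set N" by blast
    then obtain as bs where sp: "zs = as @ x # bs" using split_list by metis
    obtain cs ds where N': "N = cs @ x # ds" using x(2) split_list by metis
    have t: "thread E' (x # ds)" using thread_N N' thread_appendD by metis
    have w: "walk E' (x # bs @ [b])"
      using zs(1) sp by (auto simp: successively_append_iff successively_Cons)
    have "last (x # bs @ [b]) \<notin> set (butlast (x # ds))"
      using assms(4) N N' by (auto dest!: in_set_butlastD)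
    then obtain us where "x # bs @ [b] = (x # ds) @ us"
      using walk_leaving_thread[OF t _ w] by auto
    then have "last N \<in> set (x # bs @ [b])" using N' by (metis Un_iff last_appendR last_in_set list.distinct(1) set_append)
    then show False using zs(2) sp by auto
  qed
  have "set zs \<subseteq> V"
  proof
    fix x assume x: "x \<in> set zs"
    then obtain as bs where "zs = as @ x # bs" using split_list by metis
    then have "(x, hd (bs @ [b])) \<in> E'" using zs(1)
      by (cases bs) (auto simp: successively_append_iff successively_Cons)
    then show "x \<in> V" using E'_sub new x by auto
  qed
  then have w: "walk E (zs @ [b])"
    using walk_restrict[OF _ _ E'_old, of "zs @ [b]"] zs(1) assms(4) by (auto simp: successively_Cons)
  have "(last N, hd (zs @ [b])) \<in> E'" using zs(1) by (auto simp: successively_Cons)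
  then have "hd (zs @ [b]) = p \<or> hd (zs @ [b]) = w" using arc_simps by simp
  then obtain ws where ws: "walk E (ws @ [b])" "hd (ws @ [b]) = w" "length ws \<le> length zs"
      "set ws \<subseteq> set zs" "distinct (ws @ [b])"
  proof
    assume p: "hd (zs @ [b]) = p"
    then obtain ws where zs': "zs = p # ws" using assms(7) by (cases zs) auto
    then have "hd (ws @ [b]) = w" using w upw_simps by (auto simp: successively_Cons)
    then show ?thesis using that[of ws] zs' w zs(2) by (auto simp: successively_Cons)
  next
    assume "hd (zs @ [b]) = w"
    then show ?thesis using that[of zs] w zs(2) by auto
  qed
  have "\<exists>us. ws @ [b] = P2 @ us"
    using walk_leaving_thread[OF assms(1,2) ws(1)] ws(2) assms(3,5) by (auto dest: in_set_butlastD)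
  then obtain us where us: "ws @ [b] = P2 @ us" ..
  then have "us \<noteq> []" using assms(2,5) by (metis append_Nil2 in_set_conv_decomp)
  then obtain vs where vs: "us = vs @ [b]" "ws = P2 @ vs"
    using us by (cases us rule: rev_cases) auto
  then have "walk E (last P2 # vs @ [b])"
    using ws(1) assms(2) by (auto simp: successively_append_iff successively_Cons)
  moreover have "distinct (last P2 # vs @ [b])" using ws(5) vs last_in_set[OF assms(2)] assms(5) by auto
  ultimately have "d \<le> length vs" using assms(6) unfolding gap_def by blast
  then show "length P2 + d \<le> length zs" using vs ws(3) by simp
qed

end

section \<open>Attaching a cycle with two tangencies\<close>

text \<open>The new cycle is \<open>R1\<close>, \<open>p\<close>, \<open>R2\<close>, \<open>q\<close>. In the drawing, \<open>R2\<close> will be on the outer face and \<open>R1\<close> will not.\<close>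

locale two_tangencies = new_paths +
  fixes u p w u' q w' :: 'a and R1 R2 :: "'a list"
  assumes upw: "thread E [u, p, w]" and uqw: "thread E [u', q, w']"
    and apart: "{u, p, w} \<inter> {u', q, w'} = {}"
    and R: "R1 \<noteq> []" "R2 \<noteq> []" "distinct (R1 @ R2)" "(set R1 \<union> set R2) \<inter> V = {}"
begin

definition E' :: "'a rel" where
  "E' = E \<union> path_arcs R1 \<union> path_arcs R2 \<union> tangency_arcs u p w R1 R2 \<union> tangency_arcs u' q w' R2 R1"

lemmas upw_simps = thread3[OF upw] and uqw_simps = thread3[OF uqw]

lemma R_ends: "hd R1 \<in> set R1" "last R1 \<in> set R1" "hd R2 \<in> set R2" "last R2 \<in> set R2"
  "hd R1 \<notin> V" "last R1 \<notin> V" "hd R2 \<notin> V" "last R2 \<notin> V"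
  "hd R1 \<notin> set R2" "last R1 \<notin> set R2" "hd R2 \<notin> set R1" "last R2 \<notin> set R1"
  using R by (auto simp: disjoint_iff)

text \<open>Exchanging the two points of tangency halves the case distinctions below.\<close>

lemma flip: "two_tangencies V E u' q w' u p w R2 R1"
  using upw uqw apart R by unfold_locales auto

lemma flip_E': "two_tangencies.E' E u' q w' u p w R2 R1 = E'"
  using two_tangencies.E'_def[OF flip] E'_def by auto

lemma E_E': "E \<subseteq> E'" by (auto simp: E'_def)

lemma E'_sub: "E' \<subseteq> (V \<union> set R1 \<union> set R2) \<times> (V \<union> set R1 \<union> set R2)"
  using E_sub path_arcs_subset[of R1] path_arcs_subset[of R2] R_ends upw_simps uqw_simps
  by (auto simp: E'_def tangency_arcs_def)

lemma E'_old: "E' \<inter> V \<times> V \<subseteq> E"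
  using path_arcs_subset[of R1] path_arcs_subset[of R2] R_ends R by (auto simp: E'_def tangency_arcs_def)

lemma arc_simps:
  "(last R1, z) \<in> E' \<longleftrightarrow> z = p \<or> z = w"
  "(u, z) \<in> E' \<longleftrightarrow> z = p \<or> z = hd R2"
  "(p, z) \<in> E' \<longleftrightarrow> z = w \<or> z = hd R2"
  "(z, hd R1) \<in> E' \<longleftrightarrow> z = q \<or> z = u'"
  "(z, p) \<in> E' \<longleftrightarrow> z = u \<or> z = last R1"
  "(z, w) \<in> E' \<longleftrightarrow> z = p \<or> z = last R1"
proof -
  have 1: "(last R1, z) \<notin> path_arcs R1" "(last R1, z) \<notin> path_arcs R2" for z
  proof -
    show "(last R1, z) \<notin> path_arcs R2" using path_arcs_subset[of R2] R_ends by auto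
    show "(last R1, z) \<notin> path_arcs R1"
    proof
      assume "(last R1, z) \<in> path_arcs R1"
      then have "last R1 \<in> set (butlast R1)" using path_arcs_butlast_tl[of R1] by auto
      then show False using R by (cases R1 rule: rev_cases) auto
    qed
  qed
  have 2: "(z, hd R1) \<notin> path_arcs R1" "(z, hd R1) \<notin> path_arcs R2" for z
  proof -
    show "(z, hd R1) \<notin> path_arcs R2" using path_arcs_subset[of R2] R_ends by auto
    show "(z, hd R1) \<notin> path_arcs R1"
    proof
      assume "(z, hd R1) \<in> path_arcs R1"
      then have "hd R1 \<in> set (tl R1)" using path_arcs_butlast_tl[of R1] by auto
      then show False using R by (cases R1) auto
    qed
  qed
  have "(x, y) \<in> path_arcs R1 \<Longrightarrow> x \<notin> V \<and> y \<notin> V" "(x, y) \<in> path_arcs R2 \<Longrightarrow> x \<notin> V \<and> y \<notin> V" for x y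
    using path_arcs_subset[of R1] path_arcs_subset[of R2] R by auto
  then have 4: "(u, z) \<notin> path_arcs R1" "(p, z) \<notin> path_arcs R1" "(z, p) \<notin> path_arcs R1" "(z, w) \<notin> path_arcs R1"
    "(u, z) \<notin> path_arcs R2" "(p, z) \<notin> path_arcs R2" "(z, p) \<notin> path_arcs R2" "(z, w) \<notin> path_arcs R2" for z
    using upw_simps by blast+
  have 5: "last R1 \<noteq> last R2" "hd R1 \<noteq> hd R2" using R_ends by metis+
  have 6: "u \<noteq> u'" "u \<noteq> q" "u \<noteq> w'" "p \<noteq> u'" "p \<noteq> q" "p \<noteq> w'" "w \<noteq> u'" "w \<noteq> q" "w \<noteq> w'"
    using apart by auto
  have 7: "last R1 \<noteq> u'" "last R1 \<noteq> q" "last R1 \<noteq> u" "last R1 \<noteq> p" "hd R1 \<noteq> p" "hd R1 \<noteq> w"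
    "hd R1 \<noteq> q" "hd R1 \<noteq> w'" "last R2 \<noteq> u" "last R2 \<noteq> p" "hd R2 \<noteq> p" "hd R2 \<noteq> w"
    using R_ends upw_simps uqw_simps by metis+
  have 8: "(last R1, z) \<notin> E" "(z, hd R1) \<notin> E" for z using R_ends arc_in_V by blast+
  show "(last R1, z) \<in> E' \<longleftrightarrow> z = p \<or> z = w" "(u, z) \<in> E' \<longleftrightarrow> z = p \<or> z = hd R2"
    "(p, z) \<in> E' \<longleftrightarrow> z = w \<or> z = hd R2" "(z, hd R1) \<in> E' \<longleftrightarrow> z = q \<or> z = u'"
    "(z, p) \<in> E' \<longleftrightarrow> z = u \<or> z = last R1" "(z, w) \<in> E' \<longleftrightarrow> z = p \<or> z = last R1"
    using 1 2 4 5 6 7 8 upw_simps by (auto simp: E'_def tangency_arcs_def)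
qed

lemma arc_simps':
  "(last R2, z) \<in> E' \<longleftrightarrow> z = q \<or> z = w'"
  "(u', z) \<in> E' \<longleftrightarrow> z = q \<or> z = hd R1"
  "(q, z) \<in> E' \<longleftrightarrow> z = w' \<or> z = hd R1"
  "(z, hd R2) \<in> E' \<longleftrightarrow> z = p \<or> z = u"
  "(z, q) \<in> E' \<longleftrightarrow> z = u' \<or> z = last R2"
  "(z, w') \<in> E' \<longleftrightarrow> z = q \<or> z = last R2"
  using two_tangencies.arc_simps[OF flip] flip_E' by simp_all

lemma join_arcs:
  "(last R1, p) \<in> E'" "(p, hd R2) \<in> E'" "(last R1, w) \<in> E'" "(u, hd R2) \<in> E'"
  "(last R2, q) \<in> E'" "(q, hd R1) \<in> E'" "(last R2, w') \<in> E'" "(u', hd R1) \<in> E'"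
  by (simp_all add: E'_def tangency_arcs_def)

lemma thread_R1: "thread E' R1"
proof -
  have "distinct R1" using R by simp
  then show ?thesis
  proof (rule thread_cong[OF thread_path_arcs])
    fix x z assume x: "x \<in> set (butlast R1)"
    then have 1: "x \<notin> V" "x \<in> set R1" "x \<notin> set R2" using R by (auto dest: in_set_butlastD)
    then have "(x, z) \<notin> E" "(x, z) \<notin> path_arcs R2" "x \<notin> {u, p, u', q}"
      using arc_in_V path_arcs_subset[of R2] upw_simps uqw_simps by auto
    moreover have "x \<noteq> last R1" using x R by (cases R1 rule: rev_cases) auto
    moreover have "x \<noteq> last R2" using 1 R_ends by metis
    ultimately show "(x, z) \<in> E' \<longleftrightarrow> (x, z) \<in> path_arcs R1" by (auto simp: E'_def tangency_arcs_def)
  next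
    fix x z assume x: "x \<in> set (tl R1)"
    then have 1: "x \<notin> V" "x \<in> set R1" "x \<notin> set R2" using R by (auto dest: in_set_tlD)
    then have "(z, x) \<notin> E" "(z, x) \<notin> path_arcs R2" "x \<notin> {p, w, q, w'}"
      using arc_in_V path_arcs_subset[of R2] upw_simps uqw_simps by auto
    moreover have "x \<noteq> hd R1" using x R by (cases R1) auto
    moreover have "x \<noteq> hd R2" using 1 R_ends by metis
    ultimately show "(z, x) \<in> E' \<longleftrightarrow> (z, x) \<in> path_arcs R1" by (auto simp: E'_def tangency_arcs_def)
  qed
qed

lemma thread_R2: "thread E' R2"
  using two_tangencies.thread_R1[OF flip] flip_E' by simp

lemma old_thread:
  assumes "thread E xs" "set xs \<subseteq> V" "{u, p, u', q} \<inter> set (butlast xs) = {}"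
    "{p, w, q, w'} \<inter> set (tl xs) = {}"
  shows "thread E' xs"
proof (rule thread_cong[OF assms(1)])
  fix x z assume x: "x \<in> set (butlast xs)"
  then have "x \<in> V" using assms(2) by (auto dest: in_set_butlastD)
  then have "(x, z) \<notin> path_arcs R1" "(x, z) \<notin> path_arcs R2" "x \<noteq> last R1" "x \<noteq> last R2"
    using R R_ends path_arcs_subset[of R1] path_arcs_subset[of R2] by auto
  then show "(x, z) \<in> E' \<longleftrightarrow> (x, z) \<in> E"
    using x assms(3) by (auto simp: E'_def tangency_arcs_def)
next
  fix x z assume x: "x \<in> set (tl xs)"
  then have "x \<in> V" using assms(2) by (auto dest: in_set_tlD)
  then have "(z, x) \<notin> path_arcs R1" "(z, x) \<notin> path_arcs R2" "x \<noteq> hd R1" "x \<noteq> hd R2"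
    using R R_ends path_arcs_subset[of R1] path_arcs_subset[of R2] by auto
  then show "(z, x) \<in> E' \<longleftrightarrow> (z, x) \<in> E"
    using x assms(4) by (auto simp: E'_def tangency_arcs_def)
qed

lemma in_unchanged:
  assumes "v \<in> V" "v \<notin> {p, w, q, w'}"
  shows "(z, v) \<in> E' \<longleftrightarrow> (z, v) \<in> E"
proof -
  have "(z, v) \<notin> path_arcs R1" "(z, v) \<notin> path_arcs R2" "v \<noteq> hd R1" "v \<noteq> hd R2"
    using assms(1) R R_ends path_arcs_subset[of R1] path_arcs_subset[of R2] by auto
  then show ?thesis using assms(2) by (auto simp: E'_def tangency_arcs_def)
qed

text \<open>
  A dicycle that uses \<open>R1\<close> but not \<open>R2\<close> leaves \<open>R1\<close> to \<open>w\<close>, possibly via \<open>p\<close>, and comes back from \<open>u'\<close>,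
  possibly via \<open>q\<close>; in between it is a walk of the old digraph.
\<close>

lemma dicycle_one_side:
  assumes xs: "dicycle E' xs" "set R1 \<inter> set xs \<noteq> {}" "set R2 \<inter> set xs = {}"
    and far: "\<And>ys. walk E ys \<Longrightarrow> distinct ys \<Longrightarrow> ys \<noteq> [] \<Longrightarrow> hd ys = w \<Longrightarrow> last ys = u' \<Longrightarrow> k \<le> length ys"
  shows "length R1 + k \<le> length xs"
proof -
  obtain ys where ys: "dicycle E' (R1 @ ys)" "set (R1 @ ys) = set xs"
    "length (R1 @ ys) = length xs"
    using dicycle_through_thread[OF thread_R1 R(1) xs(1,2)] by metis
  have sub: "set ys \<subseteq> V"
  proof
    fix x assume x: "x \<in> set ys"
    then have "x \<notin> set R1" "x \<notin> set R2" using ys(1,2) xs(3) by (auto simp: dicycle_def)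
    then show "x \<in> V" using dicycle_subset[OF ys(1) E'_sub] x by auto
  qed
  have "hd R1 \<noteq> p \<and> hd R1 \<noteq> w" using R_ends upw_simps by metis
  then have ne: "ys \<noteq> []"
    using ys(1) R(1) arc_simps(1) by (auto simp: dicycle_def circuit_def)
  have E'w: "walk E' ys" "(last R1, hd ys) \<in> E'" "(last ys, hd R1) \<in> E'" "distinct ys"
    using ys(1) R(1) ne by (auto simp: dicycle_def circuit_def successively_append_iff)
  have w: "walk E ys" using walk_restrict[OF E'w(1) sub E'_old] .
  have h: "hd ys = p \<or> hd ys = w" and l: "last ys = q \<or> last ys = u'"
    using E'w arc_simps by auto
  have ne6: "p \<noteq> q" "p \<noteq> u'" "w \<noteq> q" using apart by auto
  obtain as where as: "walk E as" "distinct as" "as \<noteq> []" "hd as = w" "last as = last ys"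
    "length as \<le> length ys"
  proof (cases "hd ys = p")
    case True
    then obtain as where "ys = p # as" using ne by (cases ys) auto
    moreover then have "as \<noteq> []" using l ne6 by auto
    ultimately show ?thesis using that[of as] w E'w(4) upw_simps by (auto simp: successively_Cons)
  qed (use h that w E'w(4) ne in auto)
  obtain bs where bs: "walk E bs" "distinct bs" "bs \<noteq> []" "hd bs = w" "last bs = u'"
    "length bs \<le> length as"
  proof (cases "last as = q")
    case True
    then obtain bs where "as = bs @ [q]" using as(3) by (cases as rule: rev_cases) auto
    moreover then have "bs \<noteq> []" using as(4) ne6 by auto
    ultimately show ?thesis using that[of bs] as uqw_simps by (auto simp: successively_append_iff)
  qed (use l as that[of as] in auto)
  have "k \<le> length bs" using far bs by blast
  then show ?thesis using bs(6) as(6) ys(3) by simp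
qed

lemma girth:
  assumes "girth_ge E g" "g = length R1 + length R2 + 2"
    and far: "\<And>ys. walk E ys \<Longrightarrow> distinct ys \<Longrightarrow> ys \<noteq> [] \<Longrightarrow> hd ys = w \<Longrightarrow> last ys = u' \<Longrightarrow>
      length R2 + 2 \<le> length ys"
    and far': "\<And>ys. walk E ys \<Longrightarrow> distinct ys \<Longrightarrow> ys \<noteq> [] \<Longrightarrow> hd ys = w' \<Longrightarrow> last ys = u \<Longrightarrow>
      length R1 + 2 \<le> length ys"
  shows "girth_ge E' g"
  unfolding girth_ge_def
proof (intro allI impI)
  fix xs assume xs: "dicycle E' xs"
  \<comment> \<open>A dicycle that uses both new paths contains their \<open>g - 2\<close> vertices and, after each of them, one of
    the old vertices around the respective point of tangency.\<close>
  consider "set R1 \<inter> set xs = {}" "set R2 \<inter> set xs = {}"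
    | "set R1 \<inter> set xs \<noteq> {}" "set R2 \<inter> set xs = {}"
    | "set R1 \<inter> set xs = {}" "set R2 \<inter> set xs \<noteq> {}"
    | "set R1 \<inter> set xs \<noteq> {}" "set R2 \<inter> set xs \<noteq> {}" by blast
  then show "g \<le> length xs"
  proof cases
    case 1
    then have "set xs \<subseteq> V" using dicycle_subset[OF xs E'_sub] by auto
    then have "dicycle E xs" using dicycle_restrict[OF xs _ E'_old] by simp
    then show ?thesis using assms by (simp add: girth_ge_def)
  next
    case 2
    then have "length R1 + (length R2 + 2) \<le> length xs"
      by (intro dicycle_one_side[OF xs] far)
    then show ?thesis unfolding assms(2) by simp
  next
    case 3
    then have "length R2 + (length R1 + 2) \<le> length xs"
      by (intro two_tangencies.dicycle_one_side[OF flip, unfolded flip_E', OF xs] far')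
    then show ?thesis unfolding assms(2) by simp
  next
    case 4
    have sub: "set R1 \<union> set R2 \<subseteq> set xs"
      using thread_subset_dicycle[OF thread_R1 xs] thread_subset_dicycle[OF thread_R2 xs] 4 by simp
    obtain y where y: "y \<in> set xs" "(last R1, y) \<in> E'"
      using dicycle_succ[OF xs, of "last R1"] sub R_ends by blast
    obtain z where z: "z \<in> set xs" "(last R2, z) \<in> E'"
      using dicycle_succ[OF xs, of "last R2"] sub R_ends by blast
    have "y \<in> {p, w}" "z \<in> {q, w'}" using y z arc_simps arc_simps' by auto
    then have yz: "y \<in> V" "z \<in> V" "y \<noteq> z" using apart upw_simps uqw_simps by auto
    then have d: "distinct (y # z # R1 @ R2)" using R by auto
    have "set (y # z # R1 @ R2) \<subseteq> set xs" using sub y z by simp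
    then have "card (set (y # z # R1 @ R2)) \<le> card (set xs)" by (intro card_mono) auto
    then have "length (y # z # R1 @ R2) \<le> card (set xs)" using distinct_card[OF d] by simp
    then show ?thesis using card_length[of xs] assms(2) by simp
  qed
qed

lemma transversal:
  assumes "transversal_ge E k"
  shows "transversal_ge E' (Suc k)"
proof (rule transversal_ge_Suc[OF assms])
  fix S assume S: "finite S" "hits E' S"
  note W = thread_walk[OF thread_R1] thread_walk[OF thread_R2]
  show "\<exists>T \<subset> S. hits E T"
  proof (cases "S \<inter> (set R1 \<union> set R2) = {}")
    case False
    then have "S - (set R1 \<union> set R2) \<subset> S" by auto
    then show ?thesis using hits_minus_new[OF S(2) E_E' E_sub R(4)] by metis
  next
    case new: True
    \<comment> \<open>The new cycle can only be hit in \<open>p\<close> or \<open>q\<close>. If neither of them could be dropped, the walks left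
      over from the missed dicycles would close up through \<open>R1\<close> and \<open>R2\<close> to a circuit that is missed.\<close>
    have "circuit E' (R1 @ p # R2 @ [q])"
      using R(1,2) W join_arcs by (simp add: circuit_def successively_append_iff successively_Cons)
    then have pq: "p \<in> S \<or> q \<in> S" using hits_circuit[OF S(2)] new by fastforce
    show ?thesis
    proof (cases "(p \<in> S \<and> hits E (S - {p})) \<or> (q \<in> S \<and> hits E (S - {q}))")
      case True
      then have "hits E (S - {p}) \<and> S - {p} \<subset> S \<or> hits E (S - {q}) \<and> S - {q} \<subset> S" by auto
      then show ?thesis by metis
    next
      case False
      have p: "\<exists>ys. walk E' ys \<and> ys \<noteq> [] \<and> hd ys = w \<and> last ys = u \<and> set ys \<inter> S = {}"
        if "p \<in> S"
      proof -
        have "\<not> hits E (S - {p})" using that False by simp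
        then obtain ys where ys: "walk E ys" "ys \<noteq> []" "hd ys = w" "last ys = u"
          "set ys \<inter> (S - {p}) = {}" "p \<notin> set ys"
          by (rule missed_dicycle_through[OF upw S(2) E_E'])
        then have "walk E' ys" "set ys \<inter> S = {}" using walk_mono[OF _ E_E'] by auto
        then show ?thesis using ys by metis
      qed
      have q: "\<exists>ys. walk E' ys \<and> ys \<noteq> [] \<and> hd ys = w' \<and> last ys = u' \<and> set ys \<inter> S = {}"
        if "q \<in> S"
      proof -
        have "\<not> hits E (S - {q})" using that False by simp
        then obtain ys where ys: "walk E ys" "ys \<noteq> []" "hd ys = w'" "last ys = u'"
          "set ys \<inter> (S - {q}) = {}" "q \<notin> set ys"
          by (rule missed_dicycle_through[OF uqw S(2) E_E'])
        then have "walk E' ys" "set ys \<inter> S = {}" using walk_mono[OF _ E_E'] by auto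
        then show ?thesis using ys by metis
      qed
      consider "p \<in> S" "q \<notin> S" | "p \<notin> S" "q \<in> S" | "p \<in> S" "q \<in> S" using pq by blast
      then have "\<exists>xs. circuit E' xs \<and> set xs \<inter> S = {}"
      proof cases
        case 1
        then obtain ys where "walk E' ys" "ys \<noteq> []" "hd ys = w" "last ys = u" "set ys \<inter> S = {}"
          using p by blast
        then have "circuit E' (ys @ R2 @ q # R1) \<and> set (ys @ R2 @ q # R1) \<inter> S = {}"
          using R(1,2) W join_arcs new 1
          by (simp add: circuit_def successively_append_iff successively_Cons Int_Un_distrib Int_Un_distrib2 Int_commute)
        then show ?thesis ..
      next
        case 2
        then obtain ys where "walk E' ys" "ys \<noteq> []" "hd ys = w'" "last ys = u'" "set ys \<inter> S = {}"
          using q by blast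
        then have "circuit E' (ys @ R1 @ p # R2) \<and> set (ys @ R1 @ p # R2) \<inter> S = {}"
          using R(1,2) W join_arcs new 2
          by (simp add: circuit_def successively_append_iff successively_Cons Int_Un_distrib Int_Un_distrib2 Int_commute)
        then show ?thesis ..
      next
        case 3
        obtain ys where "walk E' ys" "ys \<noteq> []" "hd ys = w" "last ys = u" "set ys \<inter> S = {}"
          using p 3 by blast
        moreover obtain zs where "walk E' zs" "zs \<noteq> []" "hd zs = w'" "last zs = u'" "set zs \<inter> S = {}"
          using q 3 by blast
        ultimately have "circuit E' (ys @ R2 @ zs @ R1) \<and> set (ys @ R2 @ zs @ R1) \<inter> S = {}"
          using R(1,2) W join_arcs new
          by (simp add: circuit_def successively_append_iff Int_Un_distrib Int_Un_distrib2 Int_commute)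
        then show ?thesis ..
      qed
      then show ?thesis using hits_circuit[OF S(2)] by blast
    qed
  qed
qed

text \<open>
  A walk from \<open>u\<close> to \<open>w'\<close> either uses \<open>R2\<close>, or it follows the old route and then passes the four
  vertices \<open>p\<close>, \<open>w\<close>, \<open>u'\<close> and \<open>q\<close>.
\<close>

lemma gap_across:
  assumes "d \<le> length R2" "d \<le> 4"
  shows "gap E' u w' d"
  unfolding gap_def
proof (intro allI impI, elim conjE)
  fix zs assume zs: "walk E' (u # zs @ [w'])" "distinct (u # zs @ [w'])"
  show "d \<le> length zs"
  proof (cases "set zs \<inter> set R2 = {}")
    case False
    then obtain x where x: "x \<in> set zs" "x \<in> set R2" by blast
    obtain as bs where sp: "zs = as @ x # bs" using x(1) split_list by metis
    obtain cs ds where R2: "R2 = cs @ x # ds" using x(2) split_list by metis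
    have u: "u \<notin> set R2" "w' \<notin> set R2" using R(4) upw_simps uqw_simps by auto
    have w: "walk E' (u # as @ [x])" "walk E' (x # bs @ [w'])"
      using zs(1) sp by (auto simp: successively_append_iff successively_Cons hd_append)
    have t: "thread E' (cs @ [x])" "thread E' (x # ds)"
      using thread_R2 R2 thread_appendD[of E' "cs @ [x]" ds] thread_appendD[of E' cs "x # ds"] by auto
    have "\<exists>us. u # as @ [x] = us @ cs @ [x]"
      using walk_entering_thread[OF t(1) _ w(1)] u R2 in_set_tlD[of u "cs @ [x]"] by auto
    moreover have "w' \<notin> set (butlast (x # ds))"
      using u R2 in_set_butlastD[of w' "x # ds"] by auto
    then have "\<exists>vs. x # bs @ [w'] = (x # ds) @ vs"
      using walk_leaving_thread[OF t(2) _ w(2)] by simp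
    ultimately obtain us vs where "u # as = us @ cs" "bs @ [w'] = ds @ vs" by auto
    moreover have "us \<noteq> []" using \<open>u # as = us @ cs\<close> u R2 by (cases cs) auto
    moreover have "vs \<noteq> []"
    proof
      assume "vs = []"
      then have "w' \<in> set ds" using \<open>bs @ [w'] = ds @ vs\<close> by (metis append_Nil2 in_set_conv_decomp)
      then show False using u R2 by simp
    qed
    ultimately have "length cs \<le> length as" "length ds \<le> length bs"
      by (cases us; cases vs; auto dest!: arg_cong[of _ _ length])+
    then show ?thesis using assms R2 sp by simp
  next
    case True
    have v: "hd R2 \<notin> set (zs @ [w'])" "last R2 \<notin> set (u # zs)"
      using True R_ends upw_simps uqw_simps by auto
    have "(u, hd (zs @ [w'])) \<in> E'" using zs(1) by (auto simp: successively_Cons)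
    moreover have "hd (zs @ [w']) \<in> set (zs @ [w'])" by (intro hd_in_set) simp
    ultimately have "hd (zs @ [w']) = p" using arc_simps v by auto
    moreover have "p \<noteq> w'" using apart by auto
    ultimately obtain as where as: "zs = p # as" by (cases zs) auto
    have "(last zs, w') \<in> E'" using zs(1) as by (auto simp: successively_append_iff successively_Cons)
    moreover have "last zs \<in> set (u # zs)" using as by auto
    ultimately have "last zs = q" using arc_simps' v by auto
    moreover have "p \<noteq> q" using apart by auto
    ultimately obtain bs where bs: "zs = p # bs @ [q]" using as by (cases as rule: rev_cases) auto
    have "hd (bs @ [q]) \<in> set zs" unfolding bs using hd_in_set[of "bs @ [q]"] by auto
    moreover have "(p, hd (bs @ [q])) \<in> E'"
      using zs(1) bs by (auto simp: successively_Cons hd_append split: if_splits)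
    ultimately have "hd (bs @ [q]) = w" using arc_simps v by auto
    then have w: "w \<in> set bs" using apart by (cases bs) auto
    have "last (p # bs) \<in> set (u # zs)" unfolding bs using last_in_set[of "p # bs"] by auto
    moreover have "(last (p # bs), q) \<in> E'"
      using zs(1) bs by (auto simp: successively_append_iff successively_Cons)
    ultimately have "last (p # bs) = u'" using arc_simps' v by auto
    then have u': "u' \<in> set bs" using apart by (cases bs rule: rev_cases) auto
    have "card {w, u'} \<le> card (set bs)" using w u' by (intro card_mono) auto
    moreover have "w \<noteq> u'" using apart by auto
    ultimately have "2 \<le> length bs" using card_length[of bs] by simp
    then show ?thesis using bs assms by simp
  qed
qed

end

text \<open>
  The situation after a coin with one tangency, at \<open>p\<close>, and a coin with two have been added: \<open>b\<close> starts
  the bump made by the first coin, \<open>P\<close> ends where this bump starts, \<open>y\<close> is the end of the bump, and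
  \<open>a\<close> is the end of the outer path of the second coin. A walk from \<open>a\<close> to \<open>b\<close> has to traverse \<open>P\<close> after
  its first step, unless it comes back through \<open>y\<close> and \<open>p\<close>; that also takes three inner vertices,
  which is enough for \<open>length P \<le> 2\<close>.
\<close>

lemma gap_to_thread_successor:
  assumes out: "\<And>z. (a, z) \<in> E \<longleftrightarrow> z = q \<or> z = w"
    and into_b: "\<And>z. (z, b) \<in> E \<longleftrightarrow> z = p \<or> z = last P"
    and into_p: "\<And>z. (z, p) \<in> E \<longleftrightarrow> z = last P \<or> z = y"
    and P: "thread E P" "P \<noteq> []" "length P \<le> 2"
    and ne: "{q, w} \<inter> (set P \<union> {p, y, b}) = {}" "a \<notin> set P"
  shows "gap E a b (Suc (length P))"
  unfolding gap_def
proof (intro allI impI, elim conjE)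
  fix zs assume zs: "walk E (a # zs @ [b])" "distinct (a # zs @ [b])"
  have h: "hd (zs @ [b]) = q \<or> hd (zs @ [b]) = w" using zs(1) out by (auto simp: successively_Cons)
  then have "zs \<noteq> []" using ne by auto
  then have wz: "walk E zs" "(last zs, b) \<in> E" and hz: "hd zs = q \<or> hd zs = w"
    using zs(1) h by (auto simp: successively_append_iff successively_Cons)
  have reach: "Suc (length P) \<le> length xs"
    if xs: "walk E xs" "xs \<noteq> []" "last xs = last P" "hd xs = q \<or> hd xs = w" for xs
  proof -
    have h: "hd xs \<notin> set P" using xs(4) ne by auto
    then obtain us where us: "xs = us @ P"
      using walk_entering_thread[OF P(1,2) xs(1,2,3)] by (auto dest: in_set_tlD)
    then have "us \<noteq> []" using h P(2) by auto
    then show ?thesis using us by (cases us) auto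
  qed
  show "Suc (length P) \<le> length zs"
  proof (cases "last zs = last P")
    case True
    then show ?thesis using reach[of zs] wz \<open>zs \<noteq> []\<close> hz by blast
  next
    case False
    then have "last zs = p" using wz into_b by auto
    then obtain xs where xs: "zs = xs @ [p]" using \<open>zs \<noteq> []\<close> by (cases zs rule: rev_cases) auto
    have "xs \<noteq> []" using hz xs ne by auto
    then have wx: "walk E xs" "(last xs, p) \<in> E" and hx: "hd xs = q \<or> hd xs = w"
      using wz xs hz by (auto simp: successively_append_iff)
    show ?thesis
    proof (cases "last xs = last P")
      case True
      then show ?thesis using reach[of xs] wx \<open>xs \<noteq> []\<close> hx xs by auto
    next
      case False
      then have "last xs = y" using wx into_p by auto
      then have "length xs \<noteq> 1" using hx ne by (cases xs) auto
      then have "2 \<le> length xs" using \<open>xs \<noteq> []\<close> by (cases xs) (auto simp: Suc_le_eq)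
      then show ?thesis using xs P(3) by simp
    qed
  qed
qed

section \<open>Drawings in a half plane\<close>

abbreviation dgraph :: "nat set \<Rightarrow> nat rel \<Rightarrow> (nat, nat \<times> nat) pre_digraph" where
  "dgraph V E \<equiv> with_proj \<lparr>pverts = V, parcs = E\<rparr>"

text \<open>
  The list \<open>bs\<close> contains, from left to right, the vertices of the outer face to which something may
  still be attached. They lie on the real axis and the drawing is on or below it, so that the upper half
  plane is free for new vertices and arcs.
\<close>

definition lower_drawing ::
  "nat set \<Rightarrow> nat rel \<Rightarrow> nat list \<Rightarrow> (nat \<Rightarrow> complex) \<Rightarrow> (nat \<times> nat \<Rightarrow> real \<Rightarrow> complex) \<Rightarrow> bool" where
  "lower_drawing V E bs \<phi> \<gamma> \<longleftrightarrow> plane_drawing (dgraph V E) \<phi> \<gamma> \<and>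
     \<phi> ` V \<union> (\<Union>e\<in>E. path_image (\<gamma> e)) \<subseteq> {z. Im z \<le> 0} \<and>
     set bs \<subseteq> V \<and> (\<forall>b\<in>set bs. Im (\<phi> b) = 0) \<and> sorted_wrt (\<lambda>a b. Re (\<phi> a) < Re (\<phi> b)) bs"

definition axis_drawable :: "nat set \<Rightarrow> nat rel \<Rightarrow> nat list \<Rightarrow> bool" where
  "axis_drawable V E bs \<longleftrightarrow> (\<exists>\<phi> \<gamma>. lower_drawing V E bs \<phi> \<gamma>)"

lemma plane_drawing_image:
  assumes d: "plane_drawing (dgraph V E) \<phi> \<gamma>"
    and S: "\<phi> ` V \<union> (\<Union>e\<in>E. path_image (\<gamma> e)) \<subseteq> S"
    and h: "continuous_on S h" "inj_on h S"
  shows "plane_drawing (dgraph V E) (h \<circ> \<phi>) (\<lambda>e. h \<circ> \<gamma> e)"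
proof -
  have \<phi>: "inj_on \<phi> V" and \<gamma>: "\<And>e. e \<in> E \<Longrightarrow> arc (\<gamma> e) \<and> pathstart (\<gamma> e) = \<phi> (fst e) \<and>
      pathfinish (\<gamma> e) = \<phi> (snd e) \<and> path_image (\<gamma> e) \<inter> \<phi> ` V = {\<phi> (fst e), \<phi> (snd e)}"
    and \<gamma>\<gamma>: "\<And>e f. e \<in> E \<Longrightarrow> f \<in> E \<Longrightarrow> e \<noteq> f \<Longrightarrow> path_image (\<gamma> e) \<inter> path_image (\<gamma> f) \<subseteq> \<phi> ` V"
    using d by (auto simp: plane_drawing_def)
  have pS: "path_image (\<gamma> e) \<subseteq> S" if "e \<in> E" for e using S that by auto
  have VS: "\<phi> ` V \<subseteq> S" using S by auto
  have "arc (h \<circ> \<gamma> e)" if "e \<in> E" for e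
    using \<gamma>[OF that] pS[OF that] h unfolding arc_def path_def path_image_def
    by (metis continuous_on_compose continuous_on_subset comp_inj_on inj_on_subset)
  moreover have "path_image (h \<circ> \<gamma> e) \<inter> (h \<circ> \<phi>) ` V = {(h \<circ> \<phi>) (fst e), (h \<circ> \<phi>) (snd e)}"
    if "e \<in> E" for e
  proof -
    have "path_image (h \<circ> \<gamma> e) \<inter> (h \<circ> \<phi>) ` V = h ` (path_image (\<gamma> e) \<inter> \<phi> ` V)"
      unfolding path_image_compose image_comp[symmetric]
      using inj_on_image_Int[OF h(2) pS[OF that] VS] by simp
    then show ?thesis using \<gamma>[OF that] by simp
  qed
  moreover have "path_image (h \<circ> \<gamma> e) \<inter> path_image (h \<circ> \<gamma> f) \<subseteq> (h \<circ> \<phi>) ` V"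
    if "e \<in> E" "f \<in> E" "e \<noteq> f" for e f
  proof -
    have "path_image (h \<circ> \<gamma> e) \<inter> path_image (h \<circ> \<gamma> f) = h ` (path_image (\<gamma> e) \<inter> path_image (\<gamma> f))"
      unfolding path_image_compose using inj_on_image_Int[OF h(2) pS pS] that by simp
    then show ?thesis using \<gamma>\<gamma>[OF that] by (auto simp: image_comp[symmetric])
  qed
  moreover have "inj_on (h \<circ> \<phi>) V" using \<phi> VS h(2) by (metis comp_inj_on inj_on_subset)
  moreover have "pathstart (h \<circ> \<gamma> e) = (h \<circ> \<phi>) (fst e)" "pathfinish (h \<circ> \<gamma> e) = (h \<circ> \<phi>) (snd e)"
    if "e \<in> E" for e using \<gamma>[OF that] by (simp_all add: pathstart_compose pathfinish_compose)
  ultimately show ?thesis by (auto simp: plane_drawing_def)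
qed

lemma drawing_extent_image:
  "(h \<circ> \<phi>) ` V \<union> (\<Union>e\<in>E. path_image (h \<circ> \<gamma> e)) = h ` (\<phi> ` V \<union> (\<Union>e\<in>E. path_image (\<gamma> e)))"
  by (simp add: path_image_compose image_comp image_Un image_UN)

text \<open>
  With this, the vertices on the axis can be moved to prescribed places by a homeomorphism of the
  plane.
\<close>

lemma monotone_interpolation:
  fixes xs ys :: "real list"
  assumes "sorted_wrt (<) xs" "sorted_wrt (<) ys" "length xs = length ys"
  obtains h :: "real \<Rightarrow> real" where "continuous_on UNIV h" "strict_mono h" "map h xs = ys"
proof -
  have "\<exists>h :: real \<Rightarrow> real. continuous_on UNIV h \<and> strict_mono h \<and> map h xs = ys"
    using assms(3,1,2)
  proof (induction xs ys rule: list_induct2)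
    case Nil
    then show ?case by (intro exI[of _ "\<lambda>x. x"]) (auto simp: strict_mono_def)
  next
    case (Cons x xs y ys)
    obtain h :: "real \<Rightarrow> real" where h: "continuous_on UNIV h" "strict_mono h" "map h xs = ys"
      using Cons by auto
    show ?case
    proof (cases xs)
      case Nil
      then show ?thesis using Cons(1)
        by (intro exI[of _ "\<lambda>t. t + (y - x)"]) (auto simp: strict_mono_def intro!: continuous_intros)
    next
      case xs: (Cons x' xs')
      then obtain y' ys' where ys: "ys = y' # ys'" using Cons(1) by (cases ys) auto
      have lt: "x < x'" "y < y'" using Cons.prems xs ys by auto
      define l where "l = (y' - y) / (x' - x)"
      have l: "l > 0" using lt by (simp add: l_def)
      \<comment> \<open>This is \<open>h\<close> to the right of \<open>x'\<close>, continued to the left as a line of slope \<open>l\<close>.\<close>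
      define k where "k t = h (max t x') + l * (min t x' - x')" for t
      have "continuous_on UNIV k" unfolding k_def
        by (intro continuous_intros continuous_on_compose2[OF h(1)]) auto
      moreover have "strict_mono k" unfolding strict_mono_def
      proof (intro allI impI)
        fix s t :: real assume st: "s < t"
        show "k s < k t"
        proof (cases "s < x'")
          case True
          then have "l * (min s x' - x') < l * (min t x' - x')" using st l by simp
          moreover have "h (max s x') \<le> h (max t x')"
            using st h(2) by (simp add: strict_mono_less_eq)
          ultimately show ?thesis by (simp add: k_def)
        next
          case False
          then show ?thesis using st h(2) by (simp add: k_def strict_mono_def)
        qed
      qed
      moreover have "map k xs = ys"
      proof -
        have "k t = h t" if "t \<in> set xs" for t
        proof -
          have "x' \<le> t" using that xs Cons.prems by auto
          then show ?thesis by (simp add: k_def max_def min_def)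
        qed
        then show ?thesis using h(3) by (metis map_cong)
      qed
      moreover have "k x = y"
      proof -
        have "h x' = y'" using h(3) xs ys by simp
        moreover have "l * (x - x') = y - y'" using lt by (simp add: l_def field_simps)
        ultimately show ?thesis using lt by (simp add: k_def max_def min_def)
      qed
      ultimately show ?thesis by (intro exI[of _ k]) auto
    qed
  qed
  then show ?thesis using that by blast
qed

lemma axis_drawable_positions:
  assumes "axis_drawable V E bs" "sorted_wrt (<) ys" "length ys = length bs"
  obtains \<phi> \<gamma> where "lower_drawing V E bs \<phi> \<gamma>" "map (Re \<circ> \<phi>) bs = ys"
proof -
  obtain \<phi> \<gamma> where d: "lower_drawing V E bs \<phi> \<gamma>" using assms by (auto simp: axis_drawable_def)
  obtain h :: "real \<Rightarrow> real" where h: "continuous_on UNIV h" "strict_mono h"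
      "map h (map (Re \<circ> \<phi>) bs) = ys"
    using monotone_interpolation[of "map (Re \<circ> \<phi>) bs" ys] d assms
    by (auto simp: lower_drawing_def sorted_wrt_map)
  define H where "H z = Complex (h (Re z)) (Im z)" for z
  have "continuous_on UNIV H" unfolding H_def Complex_eq
    by (intro continuous_intros continuous_on_compose2[OF h(1)]) auto
  moreover have "inj_on H UNIV"
    using h(2) by (auto simp: H_def inj_on_def complex_eq_iff strict_mono_eq)
  ultimately have pd: "plane_drawing (dgraph V E) (H \<circ> \<phi>) (\<lambda>e. H \<circ> \<gamma> e)"
    using d by (intro plane_drawing_image[of V E \<phi> \<gamma> UNIV]) (auto simp: lower_drawing_def)
  have "lower_drawing V E bs (H \<circ> \<phi>) (\<lambda>e. H \<circ> \<gamma> e)"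
    unfolding lower_drawing_def drawing_extent_image
  proof (intro conjI)
    show "sorted_wrt (\<lambda>a b. Re ((H \<circ> \<phi>) a) < Re ((H \<circ> \<phi>) b)) bs"
      using d h(2) by (simp add: lower_drawing_def H_def strict_mono_less)
  qed (use pd d in \<open>auto simp: lower_drawing_def H_def\<close>)
  moreover have "map (Re \<circ> (H \<circ> \<phi>)) bs = ys" using h(3) by (simp add: H_def o_def)
  ultimately show ?thesis using that by blast
qed

lemma shear_continuous_inj:
  fixes f :: "real \<Rightarrow> real"
  assumes "continuous_on UNIV f"
  shows "continuous_on UNIV (\<lambda>z. Complex (Re z) (Im z + f (Re z)))"
    and "inj (\<lambda>z. Complex (Re z) (Im z + f (Re z)))"
proof -
  show "continuous_on UNIV (\<lambda>z. Complex (Re z) (Im z + f (Re z)))" unfolding Complex_eq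
    by (intro continuous_intros continuous_on_compose2[OF assms]) auto
  show "inj (\<lambda>z. Complex (Re z) (Im z + f (Re z)))" by (auto simp: inj_on_def complex_eq_iff)
qed

lemma axis_drawable_subset:
  assumes "axis_drawable V E (as @ bs @ cs)"
  shows "axis_drawable V E (as @ cs)"
proof -
  obtain \<phi> \<gamma> where "lower_drawing V E (as @ bs @ cs) \<phi> \<gamma>"
    using assms by (auto simp: axis_drawable_def)
  then have "lower_drawing V E (as @ cs) \<phi> \<gamma>" by (auto simp: lower_drawing_def sorted_wrt_append)
  then show ?thesis by (auto simp: axis_drawable_def)
qed

text \<open>
  The outer face has no distinguished first vertex: after the plane has been pushed down
  around a point of the axis between \<open>as\<close> and \<open>bs\<close>, that point is off the drawing and can be sent to
  infinity by the Moebius transformation \<open>z \<mapsto> - 1 / z\<close>, which preserves the lower half plane.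
\<close>

lemma axis_drawable_rotate:
  assumes "axis_drawable V E (as @ bs)"
  shows "axis_drawable V E (bs @ as)"
proof -
  define ps where "ps = map (\<lambda>i. real i - real (length as)) [0..<length as] @
    map (\<lambda>i. real i + 1) [0..<length bs]"
  have "sorted_wrt (<) ps" by (auto simp: ps_def sorted_wrt_append sorted_wrt_map)
  moreover have "length ps = length (as @ bs)" by (simp add: ps_def)
  ultimately obtain \<phi> \<gamma> where d: "lower_drawing V E (as @ bs) \<phi> \<gamma>"
    and m: "map (Re \<circ> \<phi>) (as @ bs) = ps"
    using axis_drawable_positions[OF assms] by metis
  have mas: "map (Re \<circ> \<phi>) as = map (\<lambda>i. real i - real (length as)) [0..<length as]"
    and mbs: "map (Re \<circ> \<phi>) bs = map (\<lambda>i. real i + 1) [0..<length bs]"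
    using m by (simp_all add: ps_def)
  have as: "Re (\<phi> a) \<le> -1" if "a \<in> set as" for a
  proof -
    have "Re (\<phi> a) \<in> set (map (Re \<circ> \<phi>) as)" using that by auto
    then show ?thesis unfolding mas by auto
  qed
  have bs: "Re (\<phi> b) \<ge> 1" if "b \<in> set bs" for b
  proof -
    have "Re (\<phi> b) \<in> set (map (Re \<circ> \<phi>) bs)" using that by auto
    then show ?thesis unfolding mbs by auto
  qed
  define f :: "real \<Rightarrow> real" where "f x = - max 0 (1 - \<bar>x\<bar>)" for x
  define s where "s z = Complex (Re z) (Im z + f (Re z))" for z
  have f: "continuous_on UNIV f" unfolding f_def by (intro continuous_intros)
  have s: "continuous_on UNIV s" "inj s"
    unfolding s_def using shear_continuous_inj[OF f] by simp_all
  have sim: "s z \<noteq> 0 \<and> Im (s z) \<le> 0" if "Im z \<le> 0" for z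
    using that by (auto simp: s_def f_def complex_eq_iff)
  have flat: "s (\<phi> a) = complex_of_real (Re (\<phi> a))" if "a \<in> set (as @ bs)" for a
  proof -
    have "\<bar>Re (\<phi> a)\<bar> \<ge> 1" using that as bs by fastforce
    moreover have "Im (\<phi> a) = 0" using d that by (auto simp: lower_drawing_def)
    ultimately show ?thesis by (simp add: s_def f_def complex_eq_iff)
  qed
  define h where "h z = - inverse (s z)" for z
  let ?S = "{z. Im z \<le> 0}"
  have "continuous_on ?S h" unfolding h_def
    using sim by (intro continuous_intros continuous_on_subset[OF s(1)]) auto
  moreover have "inj_on h ?S" using s(2) by (auto simp: h_def inj_on_def)
  ultimately have pd: "plane_drawing (dgraph V E) (h \<circ> \<phi>) (\<lambda>e. h \<circ> \<gamma> e)"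
    using d by (intro plane_drawing_image[of V E \<phi> \<gamma> ?S]) (auto simp: lower_drawing_def)
  have him: "Im (h z) \<le> 0" if "Im z \<le> 0" for z
    using sim[OF that] by (auto simp: h_def divide_nonpos_nonneg)
  have hflat: "h (\<phi> a) = complex_of_real (- 1 / Re (\<phi> a))" if "a \<in> set (as @ bs)" for a
    using flat[OF that] by (simp add: h_def divide_inverse of_real_inverse)
  have neg_inverse_less: "- 1 / x < - 1 / y" if "x < y" "x \<le> -1 \<and> y \<le> -1 \<or> 1 \<le> x \<and> 1 \<le> y" for x y :: real
    using that by (auto simp: field_simps)
  have "lower_drawing V E (bs @ as) (h \<circ> \<phi>) (\<lambda>e. h \<circ> \<gamma> e)"
    unfolding lower_drawing_def drawing_extent_image
  proof (intro conjI ballI)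
    show "h ` (\<phi> ` V \<union> (\<Union>e\<in>E. path_image (\<gamma> e))) \<subseteq> {z. Im z \<le> 0}"
      using d him by (force simp: lower_drawing_def)
    show "Im ((h \<circ> \<phi>) b) = 0" if "b \<in> set (bs @ as)" for b
      using hflat[of b] that by auto
    have "sorted_wrt (\<lambda>a b. Re (h (\<phi> a)) < Re (h (\<phi> b))) as"
    proof (rule sorted_wrt_mono_rel)
      show "sorted_wrt (\<lambda>a b. Re (\<phi> a) < Re (\<phi> b)) as"
        using d by (auto simp: lower_drawing_def sorted_wrt_append)
      fix a b assume ab: "a \<in> set as" "b \<in> set as" "Re (\<phi> a) < Re (\<phi> b)"
      then show "Re (h (\<phi> a)) < Re (h (\<phi> b))"
        using hflat[of a] hflat[of b] neg_inverse_less[OF ab(3)] as[OF ab(1)] as[OF ab(2)] by simp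
    qed
    moreover have "sorted_wrt (\<lambda>a b. Re (h (\<phi> a)) < Re (h (\<phi> b))) bs"
    proof (rule sorted_wrt_mono_rel)
      show "sorted_wrt (\<lambda>a b. Re (\<phi> a) < Re (\<phi> b)) bs"
        using d by (auto simp: lower_drawing_def sorted_wrt_append)
      fix a b assume ab: "a \<in> set bs" "b \<in> set bs" "Re (\<phi> a) < Re (\<phi> b)"
      then show "Re (h (\<phi> a)) < Re (h (\<phi> b))"
        using hflat[of a] hflat[of b] neg_inverse_less[OF ab(3)] bs[OF ab(1)] bs[OF ab(2)] by simp
    qed
    moreover have "Re (h (\<phi> b)) < Re (h (\<phi> a))" if "b \<in> set bs" "a \<in> set as" for a b
    proof -
      have "- 1 / Re (\<phi> b) < 0" "0 < - 1 / Re (\<phi> a)"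
        using as[OF that(2)] bs[OF that(1)] by (simp_all add: field_simps)
      moreover have "Re (h (\<phi> a)) = - 1 / Re (\<phi> a)" "Re (h (\<phi> b)) = - 1 / Re (\<phi> b)"
        using hflat that by (simp_all del: of_real_divide of_real_minus)
      ultimately show ?thesis by linarith
    qed
    ultimately show "sorted_wrt (\<lambda>a b. Re ((h \<circ> \<phi>) a) < Re ((h \<circ> \<phi>) b)) (bs @ as)"
      by (auto simp: sorted_wrt_append)
  qed (use pd d in \<open>auto simp: lower_drawing_def\<close>)
  then show ?thesis by (auto simp: axis_drawable_def)
qed


text \<open>
  Adding new vertices and straight arcs to a drawing that is confined to a set \<open>K\<close>. Every new arc may
  meet \<open>K\<close> only in its ends, so crossings have to be excluded between new arcs only.
\<close>

lemma extend_drawing: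
  fixes c :: "nat \<Rightarrow> complex"
  assumes d: "plane_drawing (dgraph V E) \<phi> \<gamma>"
    and K: "\<phi> ` V \<union> (\<Union>e\<in>E. path_image (\<gamma> e)) \<subseteq> K"
    and E: "E \<subseteq> V \<times> V" and X: "X \<subseteq> (V \<union> R) \<times> (V \<union> R)" "\<And>e. e \<in> X \<Longrightarrow> fst e \<noteq> snd e"
    and new: "V \<inter> R = {}" "inj_on c R" "c ` R \<inter> K = {}"
    and \<phi>'_def: "\<phi>' = (\<lambda>v. if v \<in> R then c v else \<phi> v)"
    and S_def: "S = (\<lambda>e. closed_segment (\<phi>' (fst e)) (\<phi>' (snd e)))"
    and old: "\<And>e. e \<in> X \<Longrightarrow> S e \<inter> K \<subseteq> {\<phi>' (fst e), \<phi>' (snd e)}"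
    and verts: "\<And>e. e \<in> X \<Longrightarrow> S e \<inter> c ` R \<subseteq> {\<phi>' (fst e), \<phi>' (snd e)}"
    and arcs: "\<And>e f. e \<in> X \<Longrightarrow> f \<in> X \<Longrightarrow> e \<noteq> f \<Longrightarrow> S e \<inter> S f \<subseteq> \<phi>' ` (V \<union> R)"
  defines "\<gamma>' \<equiv> \<lambda>e. if e \<in> E then \<gamma> e else linepath (\<phi>' (fst e)) (\<phi>' (snd e))"
  shows "plane_drawing (dgraph (V \<union> R) (E \<union> X)) \<phi>' \<gamma>'"
    and "\<phi>' ` (V \<union> R) \<union> (\<Union>e\<in>E \<union> X. path_image (\<gamma>' e)) \<subseteq> K \<union> c ` R \<union> (\<Union>e\<in>X. S e)"
proof -
  have \<phi>: "inj_on \<phi> V" and \<gamma>: "\<And>e. e \<in> E \<Longrightarrow> arc (\<gamma> e) \<and> pathstart (\<gamma> e) = \<phi> (fst e) \<and>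
      pathfinish (\<gamma> e) = \<phi> (snd e) \<and> path_image (\<gamma> e) \<inter> \<phi> ` V = {\<phi> (fst e), \<phi> (snd e)}"
    and \<gamma>\<gamma>: "\<And>e f. e \<in> E \<Longrightarrow> f \<in> E \<Longrightarrow> e \<noteq> f \<Longrightarrow> path_image (\<gamma> e) \<inter> path_image (\<gamma> f) \<subseteq> \<phi> ` V"
    using d by (auto simp: plane_drawing_def)
  have oldv: "\<phi>' v = \<phi> v" if "v \<in> V" for v using that new by (auto simp: \<phi>'_def)
  have newv: "\<phi>' v = c v" if "v \<in> R" for v using that by (auto simp: \<phi>'_def)
  have imV: "\<phi>' ` V = \<phi> ` V" and imR: "\<phi>' ` R = c ` R" using oldv newv by auto
  have im: "\<phi>' ` (V \<union> R) = \<phi> ` V \<union> c ` R" using imV imR by (simp add: image_Un)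
  have KV: "\<phi> ` V \<subseteq> K" and KE: "\<And>e. e \<in> E \<Longrightarrow> path_image (\<gamma> e) \<subseteq> K" using K by auto
  have "inj_on \<phi>' V" "inj_on \<phi>' R" using \<phi> new(2) oldv newv by (auto simp: inj_on_def)
  moreover have "\<phi>' ` (V - R) \<inter> \<phi>' ` (R - V) = {}" using imV imR KV new(3) by blast
  ultimately have inj: "inj_on \<phi>' (V \<union> R)" by (simp add: inj_on_Un)
  have Evs: "fst e \<in> V" "snd e \<in> V" if "e \<in> E" for e using E that by auto
  have Xvs: "fst e \<in> V \<union> R" "snd e \<in> V \<union> R" if "e \<in> X" for e using X(1) that by auto
  have ne: "\<phi>' (fst e) \<noteq> \<phi>' (snd e)" if "e \<in> X" for e
    using inj X(2)[OF that] Xvs[OF that] by (simp add: inj_on_eq_iff)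
  have pE: "\<gamma>' e = \<gamma> e" if "e \<in> E" for e using that by (simp add: \<gamma>'_def)
  have pX: "path_image (\<gamma>' e) = S e" if "e \<in> X" "e \<notin> E" for e
    using that by (simp add: \<gamma>'_def S_def)
  have arcs1: "arc (\<gamma>' e) \<and> pathstart (\<gamma>' e) = \<phi>' (fst e) \<and> pathfinish (\<gamma>' e) = \<phi>' (snd e) \<and>
    path_image (\<gamma>' e) \<inter> \<phi>' ` (V \<union> R) = {\<phi>' (fst e), \<phi>' (snd e)}" if "e \<in> E \<union> X" for e
  proof (cases "e \<in> E")
    case True
    have "path_image (\<gamma> e) \<inter> c ` R = {}" using KE[OF True] new(3) by blast
    then show ?thesis using \<gamma>[OF True] pE[OF True] oldv Evs[OF True] im by auto
  next
    case False
    then have e: "e \<in> X" using that by simp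
    have "{\<phi>' (fst e), \<phi>' (snd e)} \<subseteq> S e" by (simp add: S_def)
    moreover have "{\<phi>' (fst e), \<phi>' (snd e)} \<subseteq> \<phi>' ` (V \<union> R)" using Xvs[OF e] by auto
    moreover have "S e \<inter> \<phi>' ` (V \<union> R) \<subseteq> {\<phi>' (fst e), \<phi>' (snd e)}"
      using old[OF e] verts[OF e] KV unfolding im by blast
    ultimately have "S e \<inter> \<phi>' ` (V \<union> R) = {\<phi>' (fst e), \<phi>' (snd e)}" by blast
    then show ?thesis using False ne[OF e] pX[OF e False] by (simp add: \<gamma>'_def arc_linepath)
  qed
  have EX: "path_image (\<gamma>' e) \<inter> path_image (\<gamma>' f) \<subseteq> \<phi>' ` (V \<union> R)"
    if "e \<in> E" "f \<in> X" "f \<notin> E" for e f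
    using pE[OF that(1)] pX[OF that(2,3)] KE[OF that(1)] old[OF that(2)] Xvs[OF that(2)] by auto
  have arcs2: "path_image (\<gamma>' e) \<inter> path_image (\<gamma>' f) \<subseteq> \<phi>' ` (V \<union> R)"
    if ef: "e \<in> E \<union> X" "f \<in> E \<union> X" "e \<noteq> f" for e f
  proof -
    consider "e \<in> E" "f \<in> E" | "e \<in> E" "f \<in> X" "f \<notin> E" | "f \<in> E" "e \<in> X" "e \<notin> E"
      | "e \<in> X" "e \<notin> E" "f \<in> X" "f \<notin> E" using ef by blast
    then show ?thesis
    proof cases
      case 1
      then show ?thesis using \<gamma>\<gamma>[OF 1 ef(3)] pE im by auto
    next
      case 3
      then show ?thesis using EX[of f e] by blast
    next
      case 4
      then show ?thesis using arcs[OF 4(1,3) ef(3)] pX by simp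
    qed (use EX in blast)
  qed
  show "plane_drawing (dgraph (V \<union> R) (E \<union> X)) \<phi>' \<gamma>'"
    using inj arcs1 arcs2 by (simp add: plane_drawing_def)
  have "path_image (\<gamma>' e) \<subseteq> K \<union> (\<Union>e\<in>X. S e)" if "e \<in> E \<union> X" for e
  proof (cases "e \<in> E")
    case True
    then show ?thesis using KE[OF True] pE[OF True] by auto
  next
    case False
    then show ?thesis using pX that by auto
  qed
  then show "\<phi>' ` (V \<union> R) \<union> (\<Union>e\<in>E \<union> X. path_image (\<gamma>' e)) \<subseteq> K \<union> c ` R \<union> (\<Union>e\<in>X. S e)"
    using im KV by auto
qed

section \<open>Drawing the attached cycles\<close>

text \<open>
  To make room for straight arcs, the part of the axis between \<open>-4\<close> and \<open>4\<close> is pushed down to the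
  parabola \<open>y = x\<^sup>2 - 16\<close>. The old drawing is then contained in the set \<open>valley\<close>, on or below the
  parabola, and the new vertices are put into the set \<open>bowl\<close> above it. As the parabola is strictly
  convex, a segment that joins a point on it to a point of the bowl otherwise stays in the bowl.
\<close>

definition valley :: "complex set" where
  "valley = {z. Im z \<le> 0 \<and> Im z \<le> (Re z)\<^sup>2 - 16}"

definition bowl :: "complex set" where
  "bowl = {z. Im z \<le> 0 \<and> (Re z)\<^sup>2 - 16 < Im z}"

lemma valley_bowl: "valley \<inter> bowl = {}"
  by (auto simp: valley_def bowl_def)

lemma valley_drawing:
  assumes "axis_drawable V E (as @ bs @ cs)" "length ys = length bs" "sorted_wrt (<) ys"
    "set ys \<subseteq> {-4..4}"
  obtains \<phi> \<gamma> where "plane_drawing (dgraph V E) \<phi> \<gamma>"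
    "\<phi> ` V \<union> (\<Union>e\<in>E. path_image (\<gamma> e)) \<subseteq> valley"
    "map \<phi> bs = map (\<lambda>y. Complex y (y\<^sup>2 - 16)) ys"
    "set (as @ bs @ cs) \<subseteq> V"
    "\<forall>a \<in> set as. Im (\<phi> a) = 0 \<and> Re (\<phi> a) < -4"
    "\<forall>a \<in> set cs. Im (\<phi> a) = 0 \<and> 4 < Re (\<phi> a)"
    "sorted_wrt (\<lambda>a b. Re (\<phi> a) < Re (\<phi> b)) as"
    "sorted_wrt (\<lambda>a b. Re (\<phi> a) < Re (\<phi> b)) cs"
proof -
  define ps where "ps = map (\<lambda>i. real i - real (length as) - 4) [0..<length as] @ ys @
    map (\<lambda>i. real i + 5) [0..<length cs]"
  have "sorted_wrt (<) ps"
    using assms(3,4) by (fastforce simp: ps_def sorted_wrt_append sorted_wrt_map)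
  moreover have "length ps = length (as @ bs @ cs)" using assms(2) by (simp add: ps_def)
  ultimately obtain \<phi> \<gamma> where d: "lower_drawing V E (as @ bs @ cs) \<phi> \<gamma>"
    and m: "map (Re \<circ> \<phi>) (as @ bs @ cs) = ps"
    using axis_drawable_positions[OF assms(1)] by metis
  have mas: "map (Re \<circ> \<phi>) as = map (\<lambda>i. real i - real (length as) - 4) [0..<length as]"
    and mbs: "map (Re \<circ> \<phi>) bs = ys"
    and mcs: "map (Re \<circ> \<phi>) cs = map (\<lambda>i. real i + 5) [0..<length cs]"
    using m assms(2) by (simp_all add: ps_def)
  have as: "Re (\<phi> a) < -4" if "a \<in> set as" for a
  proof -
    have "Re (\<phi> a) \<in> set (map (Re \<circ> \<phi>) as)" using that by auto
    then show ?thesis unfolding mas by auto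
  qed
  have cs: "4 < Re (\<phi> b)" if "b \<in> set cs" for b
  proof -
    have "Re (\<phi> b) \<in> set (map (Re \<circ> \<phi>) cs)" using that by auto
    then show ?thesis unfolding mcs by auto
  qed
  define f :: "real \<Rightarrow> real" where "f x = min 0 (x\<^sup>2 - 16)" for x
  have f: "continuous_on UNIV f" unfolding f_def by (intro continuous_intros)
  define s where "s z = Complex (Re z) (Im z + f (Re z))" for z
  have s: "continuous_on UNIV s" "inj s"
    unfolding s_def using shear_continuous_inj[OF f] by simp_all
  have f0: "f x = 0" if "x < -4 \<or> 4 < x" for x
  proof -
    have "4\<^sup>2 \<le> \<bar>x\<bar>\<^sup>2" using that by (intro power_mono) auto
    then show ?thesis by (simp add: f_def)
  qed
  have f1: "f x = x\<^sup>2 - 16" if "-4 \<le> x" "x \<le> 4" for x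
  proof -
    have "\<bar>x\<bar>\<^sup>2 \<le> 4\<^sup>2" using that by (intro power_mono) auto
    then show ?thesis by (simp add: f_def)
  qed
  have im0: "Im (\<phi> a) = 0" if "a \<in> set (as @ bs @ cs)" for a
    using d that by (auto simp: lower_drawing_def)
  show ?thesis
  proof (rule that)
    show "plane_drawing (dgraph V E) (s \<circ> \<phi>) (\<lambda>e. s \<circ> \<gamma> e)"
      using d s by (intro plane_drawing_image[of V E \<phi> \<gamma> UNIV]) (auto simp: lower_drawing_def)
    have "s ` {z. Im z \<le> 0} \<subseteq> valley" by (auto simp: s_def f_def valley_def)
    then show "(s \<circ> \<phi>) ` V \<union> (\<Union>e\<in>E. path_image (s \<circ> \<gamma> e)) \<subseteq> valley"
      unfolding drawing_extent_image using d unfolding lower_drawing_def by blast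
    have "map (s \<circ> \<phi>) bs = map (\<lambda>y. Complex y (y\<^sup>2 - 16)) (map (Re \<circ> \<phi>) bs)"
    proof -
      have "(s \<circ> \<phi>) b = Complex (Re (\<phi> b)) ((Re (\<phi> b))\<^sup>2 - 16)" if "b \<in> set bs" for b
      proof -
        have "Re (\<phi> b) \<in> set (map (Re \<circ> \<phi>) bs)" using that by auto
        then have "Re (\<phi> b) \<in> {-4..4}" using assms(4) unfolding mbs by blast
        then show ?thesis using im0[of b] that by (simp add: s_def f1)
      qed
      then show ?thesis by simp
    qed
    then show "map (s \<circ> \<phi>) bs = map (\<lambda>y. Complex y (y\<^sup>2 - 16)) ys" unfolding mbs .
    show "set (as @ bs @ cs) \<subseteq> V" using d by (auto simp: lower_drawing_def)
    show "\<forall>a \<in> set as. Im ((s \<circ> \<phi>) a) = 0 \<and> Re ((s \<circ> \<phi>) a) < -4"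
      using im0 as f0 by (auto simp: s_def)
    show "\<forall>a \<in> set cs. Im ((s \<circ> \<phi>) a) = 0 \<and> 4 < Re ((s \<circ> \<phi>) a)"
      using im0 cs f0 by (auto simp: s_def)
    show "sorted_wrt (\<lambda>a b. Re ((s \<circ> \<phi>) a) < Re ((s \<circ> \<phi>) b)) as"
      "sorted_wrt (\<lambda>a b. Re ((s \<circ> \<phi>) a) < Re ((s \<circ> \<phi>) b)) cs"
      using d by (auto simp: lower_drawing_def s_def sorted_wrt_append)
  qed
qed

lemma closed_segment_coords:
  assumes "z \<in> closed_segment a b"
  obtains t where "0 \<le> t" "t \<le> 1" "z = (1 - t) *\<^sub>R a + t *\<^sub>R b"
    "Re z = (1 - t) * Re a + t * Re b" "Im z = (1 - t) * Im a + t * Im b"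
  using assms by (auto simp: closed_segment_def)

lemma segment_in_bowl:
  assumes "z \<in> closed_segment a b" "b \<in> bowl" "Im a \<le> 0" "(Re a)\<^sup>2 - 16 \<le> Im a"
  shows "z = a \<or> z \<in> bowl"
proof -
  obtain t where t: "0 \<le> t" "t \<le> 1" "z = (1 - t) *\<^sub>R a + t *\<^sub>R b"
    "Re z = (1 - t) * Re a + t * Re b" "Im z = (1 - t) * Im a + t * Im b"
    using closed_segment_coords assms(1) by blast
  show ?thesis
  proof (cases "t = 0")
    case False
    have "(1 - t) * ((Re a)\<^sup>2 - 16) \<le> (1 - t) * Im a" using t assms by (intro mult_left_mono) auto
    moreover have "t * ((Re b)\<^sup>2 - 16) < t * Im b" using t False assms by (auto simp: bowl_def)
    moreover have "(1 - t) * (Re a)\<^sup>2 + t * (Re b)\<^sup>2 - (Re z)\<^sup>2 = t * (1 - t) * (Re a - Re b)\<^sup>2"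
      unfolding t(4) by (simp add: power2_eq_square algebra_simps)
    moreover have "0 \<le> t * (1 - t) * (Re a - Re b)\<^sup>2" using t by simp
    ultimately have "(Re z)\<^sup>2 - 16 < Im z" using t(5) by (simp add: algebra_simps)
    moreover have "(1 - t) * Im a \<le> 0" "t * Im b \<le> 0"
      using t assms by (auto simp: bowl_def mult_le_0_iff)
    ultimately show ?thesis using t(5) by (simp add: bowl_def)
  qed (use t in simp)
qed

lemma segment_levels:
  assumes "z \<in> closed_segment a b" "Im a < Im b"
  shows "Im a \<le> Im z" "Im z \<le> Im b" "Im z = Im a \<Longrightarrow> z = a" "Im z = Im b \<Longrightarrow> z = b"
proof -
  obtain t where t: "0 \<le> t" "t \<le> 1" "z = (1 - t) *\<^sub>R a + t *\<^sub>R b"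
    "Re z = (1 - t) * Re a + t * Re b" "Im z = (1 - t) * Im a + t * Im b"
    using closed_segment_coords assms(1) by blast
  have 1: "Im z - Im a = t * (Im b - Im a)" "Im b - Im z = (1 - t) * (Im b - Im a)"
    by (simp_all add: t(5) left_diff_distrib right_diff_distrib)
  have "0 \<le> t * (Im b - Im a)" "0 \<le> (1 - t) * (Im b - Im a)"
    using t(1,2) assms(2) by simp_all
  then show "Im a \<le> Im z" "Im z \<le> Im b"
    unfolding 1[symmetric] by simp_all
  show "z = a" if "Im z = Im a"
  proof -
    have "t = 0" using 1(1)[symmetric] that assms(2) by simp
    then show ?thesis using t(3) by simp
  qed
  show "z = b" if "Im z = Im b"
  proof -
    have "t = 1" using 1(2)[symmetric] that assms(2) by simp
    then show ?thesis using t(3) by simp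
  qed
qed

lemma segment_columns:
  assumes "z \<in> closed_segment a b" "Re a < Re b"
  shows "Re a \<le> Re z" "Re z \<le> Re b" "Re z = Re a \<Longrightarrow> z = a" "Re z = Re b \<Longrightarrow> z = b"
proof -
  obtain t where t: "0 \<le> t" "t \<le> 1" "z = (1 - t) *\<^sub>R a + t *\<^sub>R b"
    "Re z = (1 - t) * Re a + t * Re b" "Im z = (1 - t) * Im a + t * Im b"
    using closed_segment_coords assms(1) by blast
  have 1: "Re z - Re a = t * (Re b - Re a)" "Re b - Re z = (1 - t) * (Re b - Re a)"
    by (simp_all add: t(4) left_diff_distrib right_diff_distrib)
  have "0 \<le> t * (Re b - Re a)" "0 \<le> (1 - t) * (Re b - Re a)"
    using t(1,2) assms(2) by simp_all
  then show "Re a \<le> Re z" "Re z \<le> Re b"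
    unfolding 1[symmetric] by simp_all
  show "z = a" if "Re z = Re a"
  proof -
    have "t = 0" using 1(1)[symmetric] that assms(2) by simp
    then show ?thesis using t(3) by simp
  qed
  show "z = b" if "Re z = Re b"
  proof -
    have "t = 1" using 1(2)[symmetric] that assms(2) by simp
    then show ?thesis using t(3) by simp
  qed
qed

lemma segment_same_level:
  assumes "z \<in> closed_segment a b" "Im a = l" "Im b = l"
  shows "Im z = l"
proof -
  obtain t where "Im z = (1 - t) * Im a + t * Im b"
    using closed_segment_coords assms(1) by blast
  then show ?thesis using assms by (simp add: algebra_simps)
qed

lemma horizontal_path_arcs:
  fixes \<psi> :: "nat \<Rightarrow> complex"
  assumes L: "\<And>v. v \<in> set L \<Longrightarrow> Im (\<psi> v) = l" "sorted_wrt (\<lambda>a b. Re (\<psi> a) < Re (\<psi> b)) L"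
    and e: "(a, b) \<in> path_arcs L" "z \<in> closed_segment (\<psi> a) (\<psi> b)"
  shows "Im z = l"
    and "v \<in> set L \<Longrightarrow> z = \<psi> v \<Longrightarrow> z = \<psi> a \<or> z = \<psi> b"
    and "(c, d) \<in> path_arcs L \<Longrightarrow> (a, b) \<noteq> (c, d) \<Longrightarrow> z \<in> closed_segment (\<psi> c) (\<psi> d) \<Longrightarrow>
      z = \<psi> a \<or> z = \<psi> b"
proof -
  obtain i where i: "Suc i < length L" "a = L ! i" "b = L ! Suc i" using e(1) path_arcs_nth by metis
  have im: "Im (\<psi> (L ! k)) = l" if "k < length L" for k using that L(1) by simp
  have re: "Re (\<psi> (L ! j)) \<le> Re (\<psi> (L ! k))" if "j \<le> k" "k < length L" for j k
    using sorted_wrt_nth_less[OF L(2), of j k] that by (cases "j = k") auto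
  have lt: "Re (\<psi> a) < Re (\<psi> b)" using sorted_wrt_nth_less[OF L(2), of i "Suc i"] i by simp
  note z = segment_columns[OF e(2) lt]
  show zl: "Im z = l" using segment_same_level[OF e(2)] i im by simp
  show "z = \<psi> a \<or> z = \<psi> b" if v: "v \<in> set L" "z = \<psi> v"
  proof -
    obtain k where k: "k < length L" "v = L ! k" using v(1) by (metis in_set_conv_nth)
    show ?thesis
    proof (cases "k \<le> i")
      case True
      then show ?thesis using re[of k i] i k z v by fastforce
    next
      case False
      then show ?thesis using re[of "Suc i" k] i k z v by fastforce
    qed
  qed
  show "z = \<psi> a \<or> z = \<psi> b"
    if f: "(c, d) \<in> path_arcs L" "(a, b) \<noteq> (c, d)" "z \<in> closed_segment (\<psi> c) (\<psi> d)"
  proof -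
    obtain j where j: "Suc j < length L" "c = L ! j" "d = L ! Suc j" using f(1) path_arcs_nth by metis
    have "Re (\<psi> c) < Re (\<psi> d)" using sorted_wrt_nth_less[OF L(2), of j "Suc j"] j by simp
    note z' = segment_columns[OF f(3) this]
    have "i \<noteq> j" using f(2) i j by auto
    then consider "Suc i \<le> j" | "Suc j \<le> i" by linarith
    then show ?thesis
    proof cases
      case 1
      then show ?thesis using re[of "Suc i" j] i j z z' by fastforce
    next
      case 2
      then show ?thesis using re[of "Suc j" i] i j z z' by fastforce
    qed
  qed
qed

lemma spread_out:
  assumes "distinct (xs :: nat list)"
  obtains \<xi> :: "nat \<Rightarrow> real" where "\<forall>x \<in> set xs. -1 < \<xi> x \<and> \<xi> x < 1"
    "sorted_wrt (\<lambda>a b. \<xi> a < \<xi> b) xs"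
proof -
  define n where "n = length xs"
  define pos where "pos = map (\<lambda>i. -1 + 2 * (real i + 1) / (real n + 1)) [0..<n]"
  define \<xi> where "\<xi> x = the (map_of (zip xs pos) x)" for x
  have len: "length pos = length xs" by (simp add: pos_def n_def)
  have "map \<xi> xs = pos"
    using map_of_zip_nth[OF len[symmetric] assms] len by (intro nth_equalityI) (auto simp: \<xi>_def)
  moreover have "sorted_wrt (<) pos"
    unfolding pos_def sorted_wrt_map
    by (rule sorted_wrt_mono_rel[OF _ sorted_wrt_upt]) (auto intro!: divide_strict_right_mono)
  moreover have "\<forall>t \<in> set pos. -1 < t \<and> t < 1" by (auto simp: pos_def field_simps)
  ultimately have "sorted_wrt (<) (map \<xi> xs)" "\<forall>t \<in> set (map \<xi> xs). -1 < t \<and> t < 1" by simp_all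
  then show ?thesis using that[of \<xi>] by (simp add: sorted_wrt_map)
qed

lemma sorted_hd_last:
  assumes "sorted_wrt (\<lambda>a b. f a < (f b :: real)) xs" "xs \<noteq> []"
  shows "f (hd xs) \<le> f (last xs)" and "length xs \<ge> 2 \<Longrightarrow> f (hd xs) < f (last xs)"
proof -
  have "f (hd xs) < f (last xs)" if "length xs \<ge> 2"
    using sorted_wrt_nth_less[OF assms(1), of 0 "length xs - 1"] that assms(2)
    by (simp add: hd_conv_nth last_conv_nth)
  moreover have "hd xs = last xs" if "length xs < 2"
    using that assms(2) by (cases xs) auto
  ultimately show "f (hd xs) \<le> f (last xs)" "length xs \<ge> 2 \<Longrightarrow> f (hd xs) < f (last xs)"
    by (cases "length xs \<ge> 2"; simp)+
qed

lemma inj_on_sorted: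
  fixes f :: "'a \<Rightarrow> real"
  assumes "sorted_wrt (\<lambda>a b. f a < f b) xs"
  shows "inj_on f (set xs)"
proof (rule inj_onI)
  fix a b assume ab: "a \<in> set xs" "b \<in> set xs" "f a = f b"
  then obtain i j where "i < length xs" "a = xs ! i" "j < length xs" "b = xs ! j"
    by (metis in_set_conv_nth)
  then show "a = b"
    using sorted_wrt_nth_less[OF assms, of i j] sorted_wrt_nth_less[OF assms, of j i] ab(3)
    by (cases i j rule: linorder_cases) auto
qed

text \<open>
  After \<open>valley_drawing\<close> and \<open>extend_drawing\<close>, what remains to be checked for a concrete attachment is
  a statement about segments between explicitly given points. The positions \<open>ys\<close> are those of \<open>bs\<close>
  before they are pushed down.
\<close>

lemma fill_valley:
  fixes c :: "nat \<Rightarrow> complex"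
  assumes ax: "axis_drawable V E (as @ bs @ cs)" and E: "E \<subseteq> V \<times> V"
    and ys: "length ys = length bs" "sorted_wrt (<) ys" "set ys \<subseteq> {-4..4}"
    and VR: "V \<inter> R = {}" and c: "inj_on c R" "c ` R \<subseteq> bowl"
    and X: "X \<subseteq> (set bs \<union> R) \<times> (set bs \<union> R)"
      "\<And>e. e \<in> X \<Longrightarrow> fst e \<noteq> snd e" "\<And>e. e \<in> X \<Longrightarrow> fst e \<in> R \<or> snd e \<in> R"
    and bs': "set bs' \<subseteq> set bs \<union> R"
    and geo: "\<And>\<phi> S. map \<phi> bs = map (\<lambda>y. Complex y (y\<^sup>2 - 16)) ys \<Longrightarrow> (\<And>v. v \<in> R \<Longrightarrow> \<phi> v = c v) \<Longrightarrow>
        S = (\<lambda>e. closed_segment (\<phi> (fst e)) (\<phi> (snd e))) \<Longrightarrow>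
        (\<forall>e \<in> X. S e \<inter> \<phi> ` R \<subseteq> {\<phi> (fst e), \<phi> (snd e)}) \<and>
        (\<forall>e \<in> X. \<forall>f \<in> X. e \<noteq> f \<longrightarrow> S e \<inter> S f \<subseteq> \<phi> ` (set bs \<union> R)) \<and>
        (\<forall>b \<in> set bs'. Im (\<phi> b) = 0 \<and> -4 \<le> Re (\<phi> b) \<and> Re (\<phi> b) \<le> 4) \<and>
        sorted_wrt (\<lambda>a b. Re (\<phi> a) < Re (\<phi> b)) bs'"
  shows "axis_drawable (V \<union> R) (E \<union> X) (as @ bs' @ cs)"
proof -
  obtain \<phi> \<gamma> where d: "plane_drawing (dgraph V E) \<phi> \<gamma>"
    "\<phi> ` V \<union> (\<Union>e\<in>E. path_image (\<gamma> e)) \<subseteq> valley"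
    "map \<phi> bs = map (\<lambda>y. Complex y (y\<^sup>2 - 16)) ys"
    "set (as @ bs @ cs) \<subseteq> V"
    "\<forall>a \<in> set as. Im (\<phi> a) = 0 \<and> Re (\<phi> a) < -4"
    "\<forall>a \<in> set cs. Im (\<phi> a) = 0 \<and> 4 < Re (\<phi> a)"
    "sorted_wrt (\<lambda>a b. Re (\<phi> a) < Re (\<phi> b)) as"
    "sorted_wrt (\<lambda>a b. Re (\<phi> a) < Re (\<phi> b)) cs"
    by (rule valley_drawing[OF ax ys])
  define \<phi>' where "\<phi>' = (\<lambda>v. if v \<in> R then c v else \<phi> v)"
  define S where "S = (\<lambda>e. closed_segment (\<phi>' (fst e)) (\<phi>' (snd e)))"
  have old: "\<phi>' v = \<phi> v" if "v \<in> V" for v using that VR by (auto simp: \<phi>'_def)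
  have new: "\<phi>' v = c v" if "v \<in> R" for v using that by (simp add: \<phi>'_def)
  have cR: "c ` R = \<phi>' ` R" by (auto simp: \<phi>'_def)
  have "map \<phi>' bs = map \<phi> bs" using old d(4) by auto
  then have bs: "map \<phi>' bs = map (\<lambda>y. Complex y (y\<^sup>2 - 16)) ys" using d(3) by simp
  have G: "(\<forall>e \<in> X. S e \<inter> \<phi>' ` R \<subseteq> {\<phi>' (fst e), \<phi>' (snd e)}) \<and>
      (\<forall>e \<in> X. \<forall>f \<in> X. e \<noteq> f \<longrightarrow> S e \<inter> S f \<subseteq> \<phi>' ` (set bs \<union> R)) \<and>
      (\<forall>b \<in> set bs'. Im (\<phi>' b) = 0 \<and> -4 \<le> Re (\<phi>' b) \<and> Re (\<phi>' b) \<le> 4) \<and>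
      sorted_wrt (\<lambda>a b. Re (\<phi>' a) < Re (\<phi>' b)) bs'"
    by (rule geo[OF bs new S_def])
  have X1: "X \<subseteq> (V \<union> R) \<times> (V \<union> R)" using X(1) d(4) by auto
  have bowlR: "\<phi>' v \<in> bowl" if "v \<in> R" for v using c(2) that new by auto
  have rim: "Im (\<phi>' v) \<le> 0 \<and> (Re (\<phi>' v))\<^sup>2 - 16 \<le> Im (\<phi>' v)" if v: "v \<in> set bs \<union> R" for v
  proof (cases "v \<in> R")
    case True
    then show ?thesis using bowlR[OF True] by (simp add: bowl_def)
  next
    case False
    then have "\<phi>' v \<in> set (map \<phi>' bs)" using v by auto
    then obtain y where y: "y \<in> set ys" "\<phi>' v = Complex y (y\<^sup>2 - 16)" unfolding bs by auto
    then have "\<bar>y\<bar> \<le> 4" using ys(3) by fastforce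
    then have "\<bar>y\<bar>\<^sup>2 \<le> 4\<^sup>2" by (intro power_mono) auto
    then show ?thesis using y by simp
  qed
  have ends: "fst e \<in> set bs \<union> R" "snd e \<in> set bs \<union> R" if "e \<in> X" for e
    using X(1) that by auto
  have Sb: "z = \<phi>' (fst e) \<or> z = \<phi>' (snd e) \<or> z \<in> bowl" if e: "e \<in> X" and z: "z \<in> S e" for e z
  proof (cases "snd e \<in> R")
    case True
    then show ?thesis
      using segment_in_bowl[of z "\<phi>' (fst e)" "\<phi>' (snd e)"] bowlR rim[OF ends(1)[OF e]] z
      by (auto simp: S_def)
  next
    case False
    then have "fst e \<in> R" using X(3)[OF e] by blast
    then show ?thesis
      using segment_in_bowl[of z "\<phi>' (snd e)" "\<phi>' (fst e)"] bowlR rim[OF ends(2)[OF e]] z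
      by (auto simp: S_def closed_segment_commute)
  qed
  have C3: "c ` R \<inter> valley = {}" using c(2) valley_bowl by blast
  have C4: "S e \<inter> valley \<subseteq> {\<phi>' (fst e), \<phi>' (snd e)}" if "e \<in> X" for e
    using Sb[OF that] valley_bowl by blast
  have C5: "S e \<inter> c ` R \<subseteq> {\<phi>' (fst e), \<phi>' (snd e)}" if "e \<in> X" for e
    using G[THEN conjunct1] that unfolding cR by blast
  have "set bs \<union> R \<subseteq> V \<union> R" using d(4) by auto
  then have "\<phi>' ` (set bs \<union> R) \<subseteq> \<phi>' ` (V \<union> R)" by (rule image_mono)
  then have C6: "S e \<inter> S f \<subseteq> \<phi>' ` (V \<union> R)" if "e \<in> X" "f \<in> X" "e \<noteq> f" for e f
    using G[THEN conjunct2, THEN conjunct1, rule_format, OF that] by (rule subset_trans[rotated])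
  note D = extend_drawing[OF d(1,2) E X1 X(2) VR c(1) C3 \<phi>'_def S_def C4 C5 C6]
  let ?\<gamma> = "\<lambda>e. if e \<in> E then \<gamma> e else linepath (\<phi>' (fst e)) (\<phi>' (snd e))"
  have low: "valley \<union> c ` R \<union> (\<Union>e\<in>X. S e) \<subseteq> {z. Im z \<le> 0}"
  proof -
    have "Im z \<le> 0" if "e \<in> X" "z \<in> S e" for e z
      using Sb[OF that] rim[OF ends(1)[OF that(1)]] rim[OF ends(2)[OF that(1)]]
      by (auto simp: bowl_def)
    then show ?thesis using c(2) by (auto simp: valley_def bowl_def)
  qed
  have ac: "\<phi>' a = \<phi> a" if "a \<in> set as \<union> set cs" for a using that d(4) old by auto
  have "lower_drawing (V \<union> R) (E \<union> X) (as @ bs' @ cs) \<phi>' ?\<gamma>"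
    unfolding lower_drawing_def
  proof (intro conjI)
    show "plane_drawing (dgraph (V \<union> R) (E \<union> X)) \<phi>' ?\<gamma>" using D(1) .
    show "\<phi>' ` (V \<union> R) \<union> (\<Union>e\<in>E \<union> X. path_image (?\<gamma> e)) \<subseteq> {z. Im z \<le> 0}"
      using subset_trans[OF D(2) low] .
    show "set (as @ bs' @ cs) \<subseteq> V \<union> R" using d(4) bs' by auto
    show "\<forall>b\<in>set (as @ bs' @ cs). Im (\<phi>' b) = 0"
      using d(5,6) ac G[THEN conjunct2, THEN conjunct2] by auto
    have "sorted_wrt (\<lambda>a b. Re (\<phi>' a) < Re (\<phi>' b)) as"
      using d(7) ac by (auto intro: sorted_wrt_mono_rel[rotated])
    moreover have "sorted_wrt (\<lambda>a b. Re (\<phi>' a) < Re (\<phi>' b)) cs"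
      using d(8) ac by (auto intro: sorted_wrt_mono_rel[rotated])
    moreover have "Re (\<phi>' a) < -4" if "a \<in> set as" for a using d(5) ac that by auto
    moreover have "4 < Re (\<phi>' a)" if "a \<in> set cs" for a using d(6) ac that by auto
    ultimately show "sorted_wrt (\<lambda>a b. Re (\<phi>' a) < Re (\<phi>' b)) (as @ bs' @ cs)"
      using G[THEN conjunct2, THEN conjunct2] by (fastforce simp: sorted_wrt_append)
  qed
  then show ?thesis unfolding axis_drawable_def by blast
qed

text \<open>
  The path \<open>N\<close> is drawn on the axis between \<open>u\<close> and \<open>w\<close>, and the vertex \<open>p\<close> at the bottom of the bowl is
  joined to both ends of it.
\<close>

lemma axis_drawable_one_tangency:
  assumes ax: "axis_drawable V E (as @ [u, p, w] @ cs)" and E: "E \<subseteq> V \<times> V"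
    and N: "2 \<le> length N" "distinct N" "set N \<inter> V = {}"
  shows "axis_drawable (V \<union> set N) (E \<union> (path_arcs N \<union> tangency_arcs u p w N N)) (as @ (u # N @ [w]) @ cs)"
proof -
  have upw: "u \<in> V" "p \<in> V" "w \<in> V"
    using ax by (auto simp: axis_drawable_def lower_drawing_def)
  obtain \<xi> :: "nat \<Rightarrow> real" where \<xi>: "\<forall>x \<in> set N. -1 < \<xi> x \<and> \<xi> x < 1"
      "sorted_wrt (\<lambda>a b. \<xi> a < \<xi> b) N"
    using spread_out[OF N(2)] by blast
  define c where "c v = Complex (\<xi> v) 0" for v
  define X where "X = path_arcs N \<union> tangency_arcs u p w N N"
  have N0: "N \<noteq> []" using N(1) by auto
  have nN: "u \<notin> set N" "p \<notin> set N" "w \<notin> set N" using upw N(3) by auto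
  have hl: "hd N \<in> set N" "last N \<in> set N" using N0 by auto
  let ?L = "u # N @ [w]" and ?B = "{(p, hd N), (last N, p)}"
  have XT: "X = path_arcs ?L \<union> ?B" using N0 by (auto simp: X_def tangency_arcs_def path_arcs_outer)
  have Xin: "X \<subseteq> (set [u, p, w] \<union> set N) \<times> (set [u, p, w] \<union> set N)"
    using hl path_arcs_subset[of N] unfolding X_def tangency_arcs_def list.set by blast
  have "axis_drawable (V \<union> set N) (E \<union> X) (as @ ?L @ cs)"
  proof (rule fill_valley[OF ax E, of "[-4, 0, 4]" _ c])
    show "V \<inter> set N = {}" using N(3) by blast
    show "inj_on c (set N)" using inj_on_sorted[OF \<xi>(2)] by (auto simp: c_def inj_on_def)
    show "c ` set N \<subseteq> bowl"
    proof
      fix z assume "z \<in> c ` set N"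
      then obtain v where v: "v \<in> set N" "z = c v" by blast
      then have "\<bar>\<xi> v\<bar>\<^sup>2 \<le> 1\<^sup>2" using \<xi>(1) by (intro power_mono) auto
      then show "z \<in> bowl" using v by (simp add: c_def bowl_def)
    qed
    show "fst e \<noteq> snd e" if "e \<in> X" for e
      using that hl nN path_arcs_distinct[OF N(2), of "fst e" "snd e"] by (auto simp: X_def tangency_arcs_def)
    show "fst e \<in> set N \<or> snd e \<in> set N" if "e \<in> X" for e
    proof -
      have "e \<in> set N \<times> set N \<or> fst e \<in> {hd N, last N} \<or> snd e \<in> {hd N, last N}"
        using that path_arcs_subset[of N] unfolding X_def tangency_arcs_def by auto
      then show ?thesis using hl by (cases e) auto
    qed
  next
    fix \<phi> :: "nat \<Rightarrow> complex" and S
    assume "map \<phi> [u, p, w] = map (\<lambda>y. Complex y (y\<^sup>2 - 16)) [-4, 0, 4]"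
    then have at: "\<phi> u = Complex (-4) 0" "\<phi> p = Complex 0 (-16)" "\<phi> w = Complex 4 0" by simp_all
    assume "\<And>v. v \<in> set N \<Longrightarrow> \<phi> v = c v"
    then have atN: "\<phi> v = Complex (\<xi> v) 0" "-1 < \<xi> v" "\<xi> v < 1" if "v \<in> set N" for v
      using that \<xi>(1) by (auto simp: c_def)
    assume S_def: "S = (\<lambda>e. closed_segment (\<phi> (fst e)) (\<phi> (snd e)))"
    have sN: "sorted_wrt (\<lambda>a b. Re (\<phi> a) < Re (\<phi> b)) N"
      using \<xi>(2) by (rule sorted_wrt_mono_rel[rotated]) (auto simp: atN(1))
    have L: "sorted_wrt (\<lambda>a b. Re (\<phi> a) < Re (\<phi> b)) ?L" "\<And>v. v \<in> set ?L \<Longrightarrow> Im (\<phi> v) = 0"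
      using sN at atN(1) by (auto simp: sorted_wrt_append dest: atN(2,3))
    note H = horizontal_path_arcs[OF L(2) L(1)]
    have slant: "Im z < 0 \<and> -16 < Im z \<or> z = \<phi> (fst e) \<or> z = \<phi> (snd e)"
      if el: "e \<in> ?B" "z \<in> S e" for e z
    proof -
      consider "e = (p, hd N)" | "e = (last N, p)" using el(1) by blast
      then show ?thesis
      proof cases
        case 1
        then have "z \<in> closed_segment (\<phi> p) (\<phi> (hd N))" using el(2) by (simp add: S_def)
        from segment_levels[OF this] show ?thesis using 1 at atN(1)[OF hl(1)] by fastforce
      next
        case 2
        then have "z \<in> closed_segment (\<phi> p) (\<phi> (last N))"
          using el(2) by (simp add: S_def closed_segment_commute)
        from segment_levels[OF this] show ?thesis using 2 at atN(1)[OF hl(2)] by fastforce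
      qed
    qed
    have level: "Im z = 0" if "e \<in> path_arcs ?L" "z \<in> S e" for e z
      using H(1)[of "fst e" "snd e" z] that by (simp add: S_def)
    have vees: "z = \<phi> p" if "z \<in> S (p, hd N)" "z \<in> S (last N, p)" for z
    proof -
      have "z \<in> closed_segment (\<phi> p) (\<phi> (hd N))" "z \<in> closed_segment (\<phi> p) (\<phi> (last N))"
        using that by (simp_all add: S_def closed_segment_commute)
      then obtain s t where "Re z = (1 - s) * Re (\<phi> p) + s * Re (\<phi> (hd N))"
        "Im z = (1 - s) * Im (\<phi> p) + s * Im (\<phi> (hd N))"
        "Re z = (1 - t) * Re (\<phi> p) + t * Re (\<phi> (last N))"
        "Im z = (1 - t) * Im (\<phi> p) + t * Im (\<phi> (last N))"
        using closed_segment_coords by metis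
      then have st: "Re z = s * \<xi> (hd N)" "Re z = t * \<xi> (last N)" "Im z = s * 16 - 16" "s = t"
        using at atN(1)[OF hl(1)] atN(1)[OF hl(2)] by auto
      moreover have "\<xi> (hd N) < \<xi> (last N)" using sorted_hd_last(2)[OF \<xi>(2) N0 N(1)] .
      ultimately have "s = 0" by auto
      then show ?thesis using st at by (simp add: complex_eq_iff)
    qed
    have vX: "\<phi> (fst e) \<in> \<phi> ` (set [u, p, w] \<union> set N)" "\<phi> (snd e) \<in> \<phi> ` (set [u, p, w] \<union> set N)"
      if "e \<in> X" for e using Xin that by fastforce+
    show "(\<forall>e \<in> X. S e \<inter> \<phi> ` set N \<subseteq> {\<phi> (fst e), \<phi> (snd e)}) \<and>
        (\<forall>e \<in> X. \<forall>f \<in> X. e \<noteq> f \<longrightarrow> S e \<inter> S f \<subseteq> \<phi> ` (set [u, p, w] \<union> set N)) \<and>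
        (\<forall>b \<in> set ?L. Im (\<phi> b) = 0 \<and> -4 \<le> Re (\<phi> b) \<and> Re (\<phi> b) \<le> 4) \<and>
        sorted_wrt (\<lambda>a b. Re (\<phi> a) < Re (\<phi> b)) ?L"
    proof (intro conjI ballI impI subsetI)
      fix e z assume e: "e \<in> X" and "z \<in> S e \<inter> \<phi> ` set N"
      then obtain v where v: "v \<in> set N" "z = \<phi> v" "z \<in> S e" by blast
      show "z \<in> {\<phi> (fst e), \<phi> (snd e)}"
      proof (cases "e \<in> path_arcs ?L")
        case True
        then show ?thesis using H(2)[of "fst e" "snd e" z v] v by (simp add: S_def)
      next
        case False
        then have "e \<in> ?B" using e XT by blast
        then show ?thesis using slant[OF _ v(3)] v atN(1)[OF v(1)] by auto
      qed
    next
      fix e f z assume ef: "e \<in> X" "f \<in> X" "e \<noteq> f" and z: "z \<in> S e \<inter> S f"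
      consider "e \<in> path_arcs ?L" "f \<in> path_arcs ?L" | "e \<in> ?B" "f \<in> ?B"
        | "e \<in> path_arcs ?L" "f \<in> ?B" | "e \<in> ?B" "f \<in> path_arcs ?L" using ef XT by blast
      then show "z \<in> \<phi> ` (set [u, p, w] \<union> set N)"
      proof cases
        case 1
        then have "z = \<phi> (fst e) \<or> z = \<phi> (snd e)"
          using H(3)[of "fst e" "snd e" z "fst f" "snd f"] ef(3) z by (simp add: S_def)
        then show ?thesis using vX[OF ef(1)] by auto
      next
        case 2
        then have "z = \<phi> p" using vees ef(3) z by blast
        then show ?thesis by simp
      next
        case 3
        then have "z = \<phi> (fst f) \<or> z = \<phi> (snd f)" using level[OF 3(1), of z] slant[of f z] z by auto
        then show ?thesis using vX[OF ef(2)] by auto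
      next
        case 4
        then have "z = \<phi> (fst e) \<or> z = \<phi> (snd e)" using level[OF 4(2), of z] slant[of e z] z by auto
        then show ?thesis using vX[OF ef(1)] by auto
      qed
    next
      fix b assume b: "b \<in> set ?L"
      then show "Im (\<phi> b) = 0" by (rule L(2))
      show "-4 \<le> Re (\<phi> b)" "Re (\<phi> b) \<le> 4" using b at atN[of b] by auto
    qed (use L in blast)
  qed (use Xin in auto)
  then show ?thesis unfolding X_def .
qed

text \<open>
  In the drawing of two tangencies the new arcs are sorted by height: apart from its ends, each arc
  is in one of these five disjoint horizontal strips, and each strip contains only a path or a pair of
  arcs separated by a vertical line.
\<close>

lemma same_strip:
  fixes y :: real
  assumes "(a0 \<and> y = 0) \<or> (a1 \<and> y = -8) \<or> (a2 \<and> -7 < y \<and> y < 0) \<or> (a3 \<and> -8 < y \<and> y < -7) \<or>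
      (a4 \<and> y < -8)"
    and "(b0 \<and> y = 0) \<or> (b1 \<and> y = -8) \<or> (b2 \<and> -7 < y \<and> y < 0) \<or> (b3 \<and> -8 < y \<and> y < -7) \<or>
      (b4 \<and> y < -8)"
  shows "(a0 \<and> b0) \<or> (a1 \<and> b1) \<or> (a2 \<and> b2) \<or> (a3 \<and> b3) \<or> (a4 \<and> b4)"
  using assms by (elim disjE conjE; simp)

text \<open>
  The path \<open>R2\<close> is drawn on the axis from left to right, the path \<open>R1\<close> from right to left at height \<open>-8\<close>,
  which is between the heights \<open>-12\<close> of \<open>w\<close> and \<open>u'\<close> and \<open>-7\<close> of \<open>p\<close> and \<open>q\<close>. The vertices \<open>ms\<close> get
  enclosed.
\<close>

lemma axis_drawable_two_tangencies:
  assumes ax: "axis_drawable V E (as @ [u, p, w] @ ms @ [u', q, w'] @ cs)" and E: "E \<subseteq> V \<times> V"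
    and R: "R1 \<noteq> []" "R2 \<noteq> []" "distinct (R1 @ R2)" "(set R1 \<union> set R2) \<inter> V = {}"
  shows "axis_drawable (V \<union> (set R1 \<union> set R2))
    (E \<union> (path_arcs R1 \<union> path_arcs R2 \<union> tangency_arcs u p w R1 R2 \<union> tangency_arcs u' q w' R2 R1))
    (as @ (u # R2 @ [w']) @ cs)"
proof -
  let ?bs = "[u, p, w, u', q, w']"
  have ax': "axis_drawable V E (as @ ?bs @ cs)"
    using axis_drawable_subset[of V E "as @ [u, p, w]" ms "[u', q, w'] @ cs"] ax by simp
  have old: "set ?bs \<subseteq> V" using ax' by (auto simp: axis_drawable_def lower_drawing_def)
  obtain \<xi>1 :: "nat \<Rightarrow> real" where \<xi>1: "\<forall>x \<in> set R1. -1 < \<xi>1 x \<and> \<xi>1 x < 1"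
      "sorted_wrt (\<lambda>a b. \<xi>1 a < \<xi>1 b) R1"
    using spread_out[of R1] R(3) by auto
  obtain \<xi>2 :: "nat \<Rightarrow> real" where \<xi>2: "\<forall>x \<in> set R2. -1 < \<xi>2 x \<and> \<xi>2 x < 1"
      "sorted_wrt (\<lambda>a b. \<xi>2 a < \<xi>2 b) R2"
    using spread_out[of R2] R(3) by auto
  define c where "c v = (if v \<in> set R2 then Complex (\<xi>2 v) 0 else Complex (- \<xi>1 v) (-8))" for v
  let ?R = "set R1 \<union> set R2"
  define X where "X = path_arcs R1 \<union> path_arcs R2 \<union> tangency_arcs u p w R1 R2 \<union> tangency_arcs u' q w' R2 R1"
  have nR: "v \<notin> set R1" "v \<notin> set R2" if "v \<in> set ?bs" for v using old R(4) that by auto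
  have hl: "hd R1 \<in> set R1" "last R1 \<in> set R1" "hd R2 \<in> set R2" "last R2 \<in> set R2" using R by auto
  have R12: "v \<notin> set R2" if "v \<in> set R1" for v using that R(3) by auto
  let ?L = "u # R2 @ [w']"
  let ?T = "path_arcs ?L" and ?W = "path_arcs R1"
  let ?A1 = "{(p, hd R2), (last R2, q)}" and ?A2 = "{(last R1, p), (q, hd R1)}"
    and ?A4 = "{(last R1, w), (u', hd R1)}"
  have XT: "X = ?T \<union> ?W \<union> ?A1 \<union> ?A2 \<union> ?A4"
    using R(2) by (auto simp: X_def tangency_arcs_def path_arcs_outer)
  have Xin: "X \<subseteq> (set ?bs \<union> ?R) \<times> (set ?bs \<union> ?R)"
    using hl path_arcs_subset[of R1] path_arcs_subset[of R2] unfolding X_def tangency_arcs_def list.set by blast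
  have "axis_drawable (V \<union> ?R) (E \<union> X) (as @ ?L @ cs)"
  proof (rule fill_valley[OF ax' E, of "[-4, -3, -2, 2, 3, 4]" _ c])
    show "V \<inter> ?R = {}" using R(4) by blast
    have "inj_on \<xi>1 (set R1)" "inj_on \<xi>2 (set R2)"
      using inj_on_sorted[OF \<xi>1(2)] inj_on_sorted[OF \<xi>2(2)] by auto
    then show "inj_on c ?R" using R12 by (auto simp: c_def inj_on_def)
    show "c ` ?R \<subseteq> bowl"
    proof
      fix z assume "z \<in> c ` ?R"
      then obtain v where v: "v \<in> ?R" "z = c v" by blast
      have "\<bar>Re z\<bar> \<le> 1" using v \<xi>1(1) \<xi>2(1) by (fastforce simp: c_def)
      then have "\<bar>Re z\<bar>\<^sup>2 \<le> 1\<^sup>2" by (intro power_mono) auto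
      then show "z \<in> bowl" using v by (auto simp: c_def bowl_def)
    qed
    show "fst e \<noteq> snd e" if "e \<in> X" for e
    proof
      assume eq: "fst e = snd e"
      have "distinct R1" "distinct R2" using R(3) by auto
      then have "e \<notin> path_arcs R1" "e \<notin> path_arcs R2"
        using eq path_arcs_distinct[of R1 "fst e" "snd e"] path_arcs_distinct[of R2 "fst e" "snd e"]
        by (metis prod.collapse)+
      then have "fst e \<in> ?R \<and> snd e \<in> set ?bs \<or> fst e \<in> set ?bs \<and> snd e \<in> ?R"
        using that hl unfolding X_def tangency_arcs_def by force
      then show False using eq nR by (metis UnE)
    qed
    show "fst e \<in> ?R \<or> snd e \<in> ?R" if "e \<in> X" for e
    proof -
      have "e \<in> ?R \<times> ?R \<or> fst e \<in> {hd R1, last R1, hd R2, last R2} \<or>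
          snd e \<in> {hd R1, last R1, hd R2, last R2}"
        using that path_arcs_subset[of R1] path_arcs_subset[of R2] unfolding X_def tangency_arcs_def by auto
      then show ?thesis using hl by (cases e) auto
    qed
  next
    fix \<phi> :: "nat \<Rightarrow> complex" and S
    assume "map \<phi> ?bs = map (\<lambda>y. Complex y (y\<^sup>2 - 16)) [-4, -3, -2, 2, 3, 4]"
    then have at: "\<phi> u = Complex (-4) 0" "\<phi> p = Complex (-3) (-7)" "\<phi> w = Complex (-2) (-12)"
      "\<phi> u' = Complex 2 (-12)" "\<phi> q = Complex 3 (-7)" "\<phi> w' = Complex 4 0" by simp_all
    assume c: "\<And>v. v \<in> ?R \<Longrightarrow> \<phi> v = c v"
    have at1: "\<phi> v = Complex (- \<xi>1 v) (-8)" "-1 < \<xi>1 v" "\<xi>1 v < 1" if "v \<in> set R1" for v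
      using that c[of v] R12[OF that] \<xi>1(1) by (auto simp: c_def)
    have at2: "\<phi> v = Complex (\<xi>2 v) 0" "-1 < \<xi>2 v" "\<xi>2 v < 1" if "v \<in> set R2" for v
      using that c[of v] \<xi>2(1) by (auto simp: c_def)
    note at1' = at1[OF hl(1)] at1[OF hl(2)] and at2' = at2[OF hl(3)] at2[OF hl(4)]
    assume S_def: "S = (\<lambda>e. closed_segment (\<phi> (fst e)) (\<phi> (snd e)))"
    have "sorted_wrt (\<lambda>a b. Re (\<phi> a) < Re (\<phi> b)) R2"
      using \<xi>2(2) by (rule sorted_wrt_mono_rel[rotated]) (auto simp: at2(1))
    then have L: "sorted_wrt (\<lambda>a b. Re (\<phi> a) < Re (\<phi> b)) ?L" "\<And>v. v \<in> set ?L \<Longrightarrow> Im (\<phi> v) = 0"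
      using at at2(1) by (auto simp: sorted_wrt_append dest: at2(2,3))
    have L1: "sorted_wrt (\<lambda>a b. Re (\<phi> a) < Re (\<phi> b)) (rev R1)"
      "\<And>v. v \<in> set (rev R1) \<Longrightarrow> Im (\<phi> v) = -8"
      using \<xi>1(2) at1(1) unfolding sorted_wrt_rev by (auto elim!: sorted_wrt_mono_rel[rotated])
    note HT = horizontal_path_arcs[OF L(2) L(1)] and HW = horizontal_path_arcs[OF L1(2) L1(1)]
    have top: "Im z = 0" "v \<in> set R2 \<Longrightarrow> z = \<phi> v \<Longrightarrow> z = \<phi> (fst e) \<or> z = \<phi> (snd e)"
      "f \<in> ?T \<Longrightarrow> e \<noteq> f \<Longrightarrow> z \<in> S f \<Longrightarrow> z = \<phi> (fst e) \<or> z = \<phi> (snd e)"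
      if "e \<in> ?T" "z \<in> S e" for e f z v
      using HT(1)[of "fst e" "snd e" z] HT(2)[of "fst e" "snd e" z v]
        HT(3)[of "fst e" "snd e" z "fst f" "snd f"] that
      by (auto simp: S_def prod_eq_iff)
    have mid: "Im z = -8" "v \<in> set R1 \<Longrightarrow> z = \<phi> v \<Longrightarrow> z = \<phi> (fst e) \<or> z = \<phi> (snd e)"
      "f \<in> ?W \<Longrightarrow> e \<noteq> f \<Longrightarrow> z \<in> S f \<Longrightarrow> z = \<phi> (fst e) \<or> z = \<phi> (snd e)"
      if "e \<in> ?W" "z \<in> S e" for e f z v
      using HW(1)[of "snd e" "fst e" z] HW(2)[of "snd e" "fst e" z v]
        HW(3)[of "snd e" "fst e" z "snd f" "fst f"] that
      by (auto simp: S_def prod_eq_iff path_arcs_rev closed_segment_commute)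
    have lv: "Im a \<le> Im z \<and> Im z \<le> Im b \<and> (Im z = Im a \<longrightarrow> z = a) \<and> (Im z = Im b \<longrightarrow> z = b)"
      if "z \<in> closed_segment a b \<or> z \<in> closed_segment b a" "Im a < Im b" for a b z
      using segment_levels[of z a b] that by (auto simp: closed_segment_commute)
    have l1: "-7 < Im z \<and> Im z < 0 \<or> z = \<phi> (fst e) \<or> z = \<phi> (snd e)" if "e \<in> ?A1" "z \<in> S e" for e z
      using that lv[of z "\<phi> p" "\<phi> (hd R2)"] lv[of z "\<phi> q" "\<phi> (last R2)"] at at2'
      by (auto simp: S_def)
    have l2: "-8 < Im z \<and> Im z < -7 \<or> z = \<phi> (fst e) \<or> z = \<phi> (snd e)" if "e \<in> ?A2" "z \<in> S e" for e z
      using that lv[of z "\<phi> (last R1)" "\<phi> p"] lv[of z "\<phi> (hd R1)" "\<phi> q"] at at1'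
      by (auto simp: S_def)
    have l4: "Im z < -8 \<or> z = \<phi> (fst e) \<or> z = \<phi> (snd e)" if "e \<in> ?A4" "z \<in> S e" for e z
      using that lv[of z "\<phi> w" "\<phi> (last R1)"] lv[of z "\<phi> u'" "\<phi> (hd R1)"] at at1'
      by (auto simp: S_def)
    have cl: "Re a \<le> Re z \<and> Re z \<le> Re b \<and> (Re z = Re a \<longrightarrow> z = a) \<and> (Re z = Re b \<longrightarrow> z = b)"
      if "z \<in> closed_segment a b \<or> z \<in> closed_segment b a" "Re a < Re b" for a b z
      using segment_columns[of z a b] that by (auto simp: closed_segment_commute)
    have lr1: "\<xi>1 (hd R1) \<le> \<xi>1 (last R1)" and lr2: "\<xi>2 (hd R2) \<le> \<xi>2 (last R2)"
      using sorted_hd_last(1)[OF \<xi>1(2) R(1)] sorted_hd_last(1)[OF \<xi>2(2) R(2)] .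
    have s1: "z = \<phi> (hd R2)" if "z \<in> S (p, hd R2)" "z \<in> S (last R2, q)" for z
      using that cl[of z "\<phi> p" "\<phi> (hd R2)"] cl[of z "\<phi> (last R2)" "\<phi> q"] at at2' lr2
      by (auto simp: S_def)
    have s2: "z = \<phi> (hd R1)" if "z \<in> S (last R1, p)" "z \<in> S (q, hd R1)" for z
      using that cl[of z "\<phi> p" "\<phi> (last R1)"] cl[of z "\<phi> (hd R1)" "\<phi> q"] at at1' lr1
      by (auto simp: S_def)
    have s4: "z = \<phi> (hd R1)" if "z \<in> S (last R1, w)" "z \<in> S (u', hd R1)" for z
      using that cl[of z "\<phi> w" "\<phi> (last R1)"] cl[of z "\<phi> (hd R1)" "\<phi> u'"] at at1' lr1
      by (auto simp: S_def)
    let ?P = "\<phi> ` (set ?bs \<union> ?R)"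
    have vX: "\<phi> (fst e) \<in> ?P" "\<phi> (snd e) \<in> ?P" if "e \<in> X" for e using Xin that by fastforce+
    show "(\<forall>e \<in> X. S e \<inter> \<phi> ` ?R \<subseteq> {\<phi> (fst e), \<phi> (snd e)}) \<and>
        (\<forall>e \<in> X. \<forall>f \<in> X. e \<noteq> f \<longrightarrow> S e \<inter> S f \<subseteq> ?P) \<and>
        (\<forall>b \<in> set ?L. Im (\<phi> b) = 0 \<and> -4 \<le> Re (\<phi> b) \<and> Re (\<phi> b) \<le> 4) \<and>
        sorted_wrt (\<lambda>a b. Re (\<phi> a) < Re (\<phi> b)) ?L"
    proof (intro conjI ballI impI subsetI)
      fix e z assume e: "e \<in> X" and "z \<in> S e \<inter> \<phi> ` ?R"
      then obtain v where v: "v \<in> ?R" "z = \<phi> v" "z \<in> S e" by blast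
      have lev: "v \<in> set R1 \<and> Im z = -8 \<or> v \<in> set R2 \<and> Im z = 0" using v at1 at2 by auto
      consider "e \<in> ?T" | "e \<in> ?W" | "e \<in> ?A1" | "e \<in> ?A2" | "e \<in> ?A4" using e XT by blast
      then show "z \<in> {\<phi> (fst e), \<phi> (snd e)}"
      proof cases
        case 1
        then show ?thesis using top(1)[OF 1 v(3)] top(2)[OF 1 v(3) _ v(2)] lev by auto
      next
        case 2
        then show ?thesis using mid(1)[OF 2 v(3)] mid(2)[OF 2 v(3) _ v(2)] lev by auto
      next
        case 3
        then show ?thesis using l1[OF 3 v(3)] lev by auto
      next
        case 4
        then show ?thesis using l2[OF 4 v(3)] lev by auto
      next
        case 5
        then show ?thesis using l4[OF 5 v(3)] lev by auto
      qed
    next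
      fix e f z assume ef: "e \<in> X" "f \<in> X" "e \<noteq> f" and z: "z \<in> S e \<inter> S f"
      define strip where "strip e z \<longleftrightarrow> (e \<in> ?T \<and> Im z = 0) \<or> (e \<in> ?W \<and> Im z = -8) \<or>
        (e \<in> ?A1 \<and> -7 < Im z \<and> Im z < 0) \<or> (e \<in> ?A2 \<and> -8 < Im z \<and> Im z < -7) \<or>
        (e \<in> ?A4 \<and> Im z < -8)" for e z
      have strip: "strip e z \<or> z \<in> ?P" if eX: "e \<in> X" "z \<in> S e" for e
      proof -
        consider "e \<in> ?T" | "e \<in> ?W" | "e \<in> ?A1" | "e \<in> ?A2" | "e \<in> ?A4" using eX(1) XT by blast
        then have "strip e z \<or> z = \<phi> (fst e) \<or> z = \<phi> (snd e)"
        proof cases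
          case 1
          then show ?thesis using top(1)[OF 1 eX(2)] unfolding strip_def by metis
        next
          case 2
          then show ?thesis using mid(1)[OF 2 eX(2)] unfolding strip_def by metis
        next
          case 3
          then show ?thesis using l1[OF 3 eX(2)] unfolding strip_def by metis
        next
          case 4
          then show ?thesis using l2[OF 4 eX(2)] unfolding strip_def by metis
        next
          case 5
          then show ?thesis using l4[OF 5 eX(2)] unfolding strip_def by metis
        qed
        then show ?thesis using vX[OF eX(1)] by metis
      qed
      show "z \<in> ?P"
      proof (cases "strip e z \<and> strip f z")
        case True
        then have "strip e z" "strip f z" by simp_all
        then consider "e \<in> ?T" "f \<in> ?T" | "e \<in> ?W" "f \<in> ?W" | "e \<in> ?A1" "f \<in> ?A1"
          | "e \<in> ?A2" "f \<in> ?A2" | "e \<in> ?A4" "f \<in> ?A4"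
          using same_strip[OF \<open>strip e z\<close>[unfolded strip_def] \<open>strip f z\<close>[unfolded strip_def]]
          by metis
        then show ?thesis
        proof cases
          case 1
          then have "z = \<phi> (fst e) \<or> z = \<phi> (snd e)" using top(3)[of e z f] ef(3) z by simp
          then show ?thesis using vX[OF ef(1)] by metis
        next
          case 2
          then have "z = \<phi> (fst e) \<or> z = \<phi> (snd e)" using mid(3)[of e z f] ef(3) z by simp
          then show ?thesis using vX[OF ef(1)] by metis
        next
          case 3
          then have "z = \<phi> (hd R2)" using s1 ef(3) z by blast
          then show ?thesis using hl by blast
        next
          case 4
          then have "z = \<phi> (hd R1)" using s2 ef(3) z by blast
          then show ?thesis using hl by blast
        next
          case 5
          then have "z = \<phi> (hd R1)" using s4 ef(3) z by blast
          then show ?thesis using hl by blast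
        qed
      next
        case False
        then show ?thesis using strip[OF ef(1)] strip[OF ef(2)] z by blast
      qed
    next
      fix b assume b: "b \<in> set ?L"
      then show "Im (\<phi> b) = 0" by (rule L(2))
      show "-4 \<le> Re (\<phi> b)" "Re (\<phi> b) \<le> 4" using b at at2[of b] by auto
    qed (use L in blast)
  qed (use Xin in auto)
  then show ?thesis unfolding X_def .
qed

section \<open>Stages of the construction\<close>

text \<open>
  The state of the construction: a digraph on \<open>n\<close> vertices whose outer face runs through the threads
  \<open>P\<close> and \<open>Q\<close>, with at least \<open>d\<close> vertices between \<open>P\<close> and \<open>Q\<close>. If exactly \<open>d\<close> vertices of the
  outer face are between \<open>P\<close> and \<open>Q\<close> and none between \<open>Q\<close> and \<open>P\<close>, then \<open>length P + length Q + d\<close> is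
  the length of the outer face.
\<close>

definition stage ::
  "nat \<Rightarrow> nat \<Rightarrow> nat \<Rightarrow> nat rel \<Rightarrow> nat list \<Rightarrow> nat list \<Rightarrow> nat \<Rightarrow> bool" where
  "stage g k n E P Q d \<longleftrightarrow> E \<subseteq> {..<n} \<times> {..<n} \<and> girth_ge E g \<and> transversal_ge E k \<and>
     thread E P \<and> thread E Q \<and> set P \<inter> set Q = {} \<and> gap E (last P) (hd Q) d \<and>
     axis_drawable {..<n} E (P @ Q)"

text \<open>
  A coin that is tangent to the last but one vertex of \<open>P\<close> and the second vertex of \<open>Q\<close>. Its outer path
  gets length \<open>d\<close>, such that the enclosed face consists of its inner path with \<open>g - 2 - d\<close> vertices, of
  \<open>x\<close>, the gap and \<open>y\<close>, and has length \<open>g\<close>. The remaining threads \<open>A\<close> and \<open>B\<close> together must be long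
  enough for dicycles through the outer path.
\<close>

lemma stage_join:
  assumes st: "stage g k n E (A @ [p, x]) ([y, q] @ B) d"
    and A: "A \<noteq> []" and B: "B \<noteq> []"
    and d: "1 \<le> d" "d \<le> 3" and g: "6 \<le> g" "g \<le> length A + length B + d"
  shows "\<exists>E'. E \<subseteq> E' \<and> stage g (k + 1) (n + (g - 2)) E' A B d"
proof -
  let ?V = "{..<n}"
  define R2 where "R2 = [n..<n + d]"
  define R1 where "R1 = [n + d..<n + (g - 2)]"
  have E: "E \<subseteq> ?V \<times> ?V" and gi: "girth_ge E g" and tr: "transversal_ge E k"
    and P: "thread E (A @ [p, x])" and Q: "thread E ([y, q] @ B)"
    and PQ: "set (A @ [p, x]) \<inter> set ([y, q] @ B) = {}" and gp: "gap E x y d"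
    and ax: "axis_drawable ?V E ((A @ [p, x]) @ ([y, q] @ B))"
    using st by (auto simp: stage_def)
  have PV: "set (A @ [p, x]) \<subseteq> ?V" and QV: "set ([y, q] @ B) \<subseteq> ?V"
    using ax unfolding axis_drawable_def lower_drawing_def by auto
  have len: "length R2 = d" "length R1 = g - 2 - d" using d g by (simp_all add: R1_def R2_def)
  have A': "A = butlast A @ [last A]" and B': "B = hd B # tl B" using A B by simp_all
  have upw: "thread E [last A, p, x]"
    using P thread_appendD[of E "butlast A" "[last A, p, x]"] A' by (metis append.assoc append_Cons append_Nil)
  have uqw: "thread E [y, q, hd B]"
    using Q thread_appendD[of E "[y, q, hd B]" "tl B"] B' by (metis append_Cons append_Nil)
  have dP: "distinct (A @ [p, x])" and dQ: "distinct ([y, q] @ B)"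
    using P Q thread_distinct by blast+
  have mem: "last A \<in> set A" "hd B \<in> set B" using A B by simp_all
  have R1R2: "set R1 \<union> set R2 = {n..<n + (g - 2)}" using d g by (auto simp: R1_def R2_def)
  interpret T: two_tangencies ?V E "last A" p x y q "hd B" R1 R2
  proof
    show "{last A, p, x} \<inter> {y, q, hd B} = {}" using PQ mem by auto
    show "R1 \<noteq> []" "R2 \<noteq> []" using len d g by auto
    show "distinct (R1 @ R2)" by (auto simp: R1_def R2_def)
    show "(set R1 \<union> set R2) \<inter> ?V = {}" unfolding R1R2 by auto
  qed (use E upw uqw in auto)
  have tA: "thread E A" and tB: "thread E B"
    using P Q thread_appendD[of E A "[p, x]"] thread_appendD[of E "[y, q]" B] by auto
  have disj: "set B \<inter> set A = {}" using PQ by auto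
  have gi': "girth_ge T.E' g"
  proof (rule T.girth[OF gi])
    show "g = length R1 + length R2 + 2" using len d g by simp
  next
    fix ys assume ys: "walk E ys" "distinct ys" "ys \<noteq> []" "hd ys = x" "last ys = y"
    have "x \<noteq> y" using PQ by auto
    then obtain zs where "ys = x # zs @ [y]"
      using ys(3-5) by (metis append_butlast_last_id last.simps list.collapse)
    then show "length R2 + 2 \<le> length ys" using gp ys len unfolding gap_def by auto
  next
    fix ys assume ys: "walk E ys" "distinct ys" "ys \<noteq> []" "hd ys = hd B" "last ys = last A"
    obtain zs where "ys = B @ zs @ A"
      using walk_between_threads[OF tB B tA A disj ys(1,3,4,5)] .
    then show "length R1 + 2 \<le> length ys" using len d g by simp
  qed
  have tA': "thread T.E' A"
  proof (rule T.old_thread[OF tA])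
    have "last A \<notin> set (butlast A)" using dP A' by (metis distinct_append not_distinct_conv_prefix)
    then show "{last A, p, y, q} \<inter> set (butlast A) = {}"
      using dP PQ by (auto dest: in_set_butlastD)
    show "{p, x, q, hd B} \<inter> set (tl A) = {}" using dP PQ mem by (auto dest!: in_set_tlD)
  qed (use PV in auto)
  have tB': "thread T.E' B"
  proof (rule T.old_thread[OF tB])
    show "{last A, p, y, q} \<inter> set (butlast B) = {}"
      using dQ PQ mem by (auto dest!: in_set_butlastD)
    have "hd B \<notin> set (tl B)" using dQ B' by (cases B) auto
    then show "{p, x, q, hd B} \<inter> set (tl B) = {}" using dQ PQ by (auto dest: in_set_tlD)
  qed (use QV in auto)
  have VR: "?V \<union> (set R1 \<union> set R2) = {..<n + (g - 2)}" unfolding R1R2 by auto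
  have "axis_drawable (?V \<union> (set R1 \<union> set R2))
    (E \<union> (path_arcs R1 \<union> path_arcs R2 \<union> tangency_arcs (last A) p x R1 R2 \<union> tangency_arcs y q (hd B) R2 R1))
    (butlast A @ (last A # R2 @ [hd B]) @ tl B)"
  proof (rule axis_drawable_two_tangencies[where ms = "[]"])
    show "axis_drawable ?V E (butlast A @ [last A, p, x] @ [] @ [y, q, hd B] @ tl B)"
      using ax A' B' by (metis append.assoc append_Cons append_Nil)
  qed (use T.R E in auto)
  then have "axis_drawable {..<n + (g - 2)} T.E' (A @ R2 @ B)"
    unfolding VR T.E'_def using A' B' by (metis Un_assoc append.assoc append_Cons append_Nil)
  then have ax': "axis_drawable {..<n + (g - 2)} T.E' (A @ B)" by (rule axis_drawable_subset)
  have sub: "T.E' \<subseteq> {..<n + (g - 2)} \<times> {..<n + (g - 2)}"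
    using T.E'_sub VR by (simp add: Un_assoc)
  have "gap T.E' (last A) (hd B) d" using T.gap_across[of d] len d by simp
  then have "stage g (k + 1) (n + (g - 2)) T.E' A B d"
    unfolding stage_def using sub gi' T.transversal[OF tr] tA' tB' disj ax' by auto
  then show ?thesis using T.E_E' by blast
qed

text \<open>
  A coin with one tangency at a vertex of \<open>P\<close> makes a bump; a second coin is tangent to the right hand
  side of this bump and to \<open>Q\<close>. The outer face then runs through the outer path of the second coin,
  the rest of \<open>Q\<close>, the start of \<open>P\<close> and the rest of the bump. The first and the last of these become
  the new threads; the vertices between them, of which one from \<open>Q\<close> and those of \<open>P1\<close> are counted, are
  the new gap. The construction therefore winds around, and the drawing has to be rotated.
\<close>

lemma stage_bump_join:
  assumes st: "stage g k n E (P1 @ [p0] @ P2) (Q' @ [q] @ B) d"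
    and ne: "P1 \<noteq> []" "P2 \<noteq> []" "Q' \<noteq> []" "B \<noteq> []" and P1: "length P1 \<le> 2"
    and r: "2 \<le> r" "r + 3 \<le> g" "r + 1 \<le> length P2 + d + length Q'" and g: "6 \<le> g"
  shows "\<exists>E' P' N1. E \<subseteq> E' \<and> (\<exists>xs. dicycle E' xs \<and> length xs = g) \<and> length P' = r \<and>
    length N1 = g - 3 \<and> stage g (k + 2) (n + (2 * g - 3)) E' P' N1 (Suc (length P1))"
proof -
  let ?V = "{..<n}"
  define m where "m = n + (g - 1)"
  \<comment> \<open>The bump is \<open>N\<close>, and the second coin touches it at its last but one vertex \<open>p\<close>.\<close>
  define N1 where "N1 = [n..<n + (g - 3)]"
  define p where "p = n + (g - 3)"
  define y where "y = n + (g - 2)"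
  define N where "N = N1 @ [p, y]"
  have N_upt: "N = [n..<m]"
  proof -
    have "g = (g - 3) + 3" using g by simp
    then obtain h where "g = h + 3" ..
    then show ?thesis by (simp add: N_def N1_def p_def y_def m_def)
  qed
  have E: "E \<subseteq> ?V \<times> ?V" and gi: "girth_ge E g" and tr: "transversal_ge E k"
    and P: "thread E (P1 @ [p0] @ P2)" and Q: "thread E (Q' @ [q] @ B)"
    and PQ: "set (P1 @ [p0] @ P2) \<inter> set (Q' @ [q] @ B) = {}" and gp: "gap E (last P2) (hd Q') d"
    and ax: "axis_drawable ?V E ((P1 @ [p0] @ P2) @ (Q' @ [q] @ B))"
    using st ne by (auto simp: stage_def)
  have PV: "set (P1 @ [p0] @ P2) \<subseteq> ?V" and QV: "set (Q' @ [q] @ B) \<subseteq> ?V"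
    using ax unfolding axis_drawable_def lower_drawing_def by auto
  have dP: "distinct (P1 @ [p0] @ P2)" and dQ: "distinct (Q' @ [q] @ B)"
    using P Q thread_distinct by blast+
  have sP1: "P1 = butlast P1 @ [last P1]" and sP2: "P2 = hd P2 # tl P2"
    and sQ': "Q' = butlast Q' @ [last Q']" and sB: "B = hd B # tl B" using ne by simp_all
  have mem: "last P1 \<in> set P1" "hd P2 \<in> set P2" "last P2 \<in> set P2" "hd Q' \<in> set Q'" "last Q' \<in> set Q'"
    "hd B \<in> set B" using ne by simp_all
  have "thread E ((butlast P1 @ [last P1, p0, hd P2]) @ tl P2)" using P sP1 sP2
    by (metis append.assoc append_Cons append_Nil)
  then have upw: "thread E [last P1, p0, hd P2]" using thread_appendD by blast
  have setN: "set N = {n..<m}" unfolding N_upt by simp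
  interpret O: one_tangency ?V E "last P1" p0 "hd P2" N
    by unfold_locales (use E upw setN in \<open>auto simp: N_upt m_def\<close>, use g in auto)
  have lenN: "length N = g - 1" by (simp add: N_upt m_def)
  have gi1: "girth_ge O.E' g" using O.girth[OF gi] lenN g by simp
  have notbl: "last xs \<notin> set (butlast xs)" if "distinct xs" "xs \<noteq> []" for xs :: "nat list"
    using that by (cases xs rule: rev_cases) auto
  have nottl: "hd xs \<notin> set (tl xs)" if "distinct xs" "xs \<noteq> []" for xs :: "nat list"
    using that by (cases xs) auto
  have tP: "thread E P1" "thread E P2"
    using P thread_appendD[of E P1 "[p0] @ P2"] thread_appendD[of E "P1 @ [p0]" P2] by auto
  have tP1: "thread O.E' P1"
  proof (rule O.old_thread[OF tP(1)])
    show "{last P1, p0} \<inter> set (butlast P1) = {}"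
      using notbl[of P1] dP ne by (auto dest: in_set_butlastD)
    show "{p0, hd P2} \<inter> set (tl P1) = {}" using dP mem by (auto dest!: in_set_tlD)
  qed (use PV in auto)
  have tQ: "thread O.E' (Q' @ [q] @ B)"
  proof (rule O.old_thread[OF Q])
    have "last P1 \<notin> set (Q' @ [q] @ B)" "p0 \<notin> set (Q' @ [q] @ B)" using PQ mem by auto
    then show "{last P1, p0} \<inter> set (butlast (Q' @ [q] @ B)) = {}" using in_set_butlastD by fast
    have "p0 \<notin> set (Q' @ [q] @ B)" "hd P2 \<notin> set (Q' @ [q] @ B)" using PQ mem by auto
    then show "{p0, hd P2} \<inter> set (tl (Q' @ [q] @ B)) = {}" using in_set_tlD by fast
  qed (use QV in auto)
  have tQ': "thread O.E' Q'" and tB: "thread O.E' B"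
    using tQ thread_appendD[of O.E' Q' "[q] @ B"] thread_appendD[of O.E' "Q' @ [q]" B] by auto
  have tN1: "thread O.E' N1" using O.thread_N thread_appendD[of O.E' N1 "[p, y]"] N_def by simp
  have N1: "N1 \<noteq> []" "length N1 = g - 3" "set N1 \<subseteq> {n..<p}" using g by (auto simp: N1_def p_def)
  have sN1: "N1 = butlast N1 @ [last N1]" using N1 by simp
  have lastN: "last N = y" "hd N = hd N1" using N1 by (simp_all add: N_def)
  have "thread O.E' (butlast N1 @ [last N1, p, y])" using O.thread_N N_def sN1
    by (metis append.assoc append_Cons append_Nil)
  then have upw1: "thread O.E' [last N1, p, y]" using thread_appendD by blast
  have "thread O.E' (butlast Q' @ [last Q', q, hd B] @ tl B)" using tQ sQ' sB
    by (metis append.assoc append_Cons append_Nil)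
  then have uqw1: "thread O.E' [last Q', q, hd B]" using thread_appendD by blast
  define R2 where "R2 = [m..<m + r]"
  define R1 where "R1 = [m + r..<m + (g - 2)]"
  have len: "length R2 = r" "length R1 = g - 2 - r" using r by (simp_all add: R1_def R2_def)
  have R1R2: "set R1 \<union> set R2 = {m..<m + (g - 2)}" using r by (auto simp: R1_def R2_def)
  have VN: "?V \<union> set N = {..<m}" using g by (auto simp: setN m_def)
  have newN: "v \<notin> set N" if "v \<in> ?V" for v using that setN by auto
  have npy: "p \<in> set N" "y \<in> set N" "last N1 \<in> set N" using N1 by (auto simp: N_def)
  interpret T: two_tangencies "{..<m}" O.E' "last N1" p y "last Q'" q "hd B" R1 R2
  proof
    show "O.E' \<subseteq> {..<m} \<times> {..<m}" using O.E'_sub VN by simp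
    have "last Q' \<notin> set N" "q \<notin> set N" "hd B \<notin> set N" using newN QV mem by auto
    then show "{last N1, p, y} \<inter> {last Q', q, hd B} = {}" using npy by auto
    show "R1 \<noteq> []" "R2 \<noteq> []" using len r by auto
    show "distinct (R1 @ R2)" by (auto simp: R1_def R2_def)
    show "(set R1 \<union> set R2) \<inter> {..<m} = {}" unfolding R1R2 by auto
  qed (use upw1 uqw1 in auto)
  have gap1: "gap O.E' y (hd Q') (length P2 + d)"
    unfolding lastN(1)[symmetric]
  proof (rule O.gap_from_new[OF tP(2) ne(2) refl])
    show "hd Q' \<in> ?V" using QV mem by auto
    show "hd Q' \<notin> set P2" "p0 \<noteq> hd Q'" using PQ mem by auto
  qed (rule gp)
  have gi2: "girth_ge T.E' g"
  proof (rule T.girth[OF gi1])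
    show "g = length R1 + length R2 + 2" using len r g by simp
  next
    fix ys assume ys: "walk O.E' ys" "distinct ys" "ys \<noteq> []" "hd ys = y" "last ys = last Q'"
    have yQ: "y \<notin> set Q'" using newN[of y] npy QV by auto
    then have "hd ys \<notin> set (tl Q')" using ys(4) by (auto dest: in_set_tlD)
    then obtain zs where zs: "ys = zs @ Q'"
      using walk_entering_thread[OF tQ' ne(3) ys(1,3,5)] by blast
    then have "zs \<noteq> []" using ys(4) yQ ne(3) by auto
    then obtain ws where ws: "zs = y # ws" using zs ys(4) by (cases zs) auto
    obtain x xs where x: "Q' = x # xs" using ne(3) by (cases Q') auto
    have "walk O.E' ((y # ws @ [x]) @ xs)" "distinct ((y # ws @ [x]) @ xs)"
      using ys(1,2) zs ws x by simp_all
    then have "walk O.E' (y # ws @ [x])" "distinct (y # ws @ [x])"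
      unfolding successively_append_iff distinct_append by blast+
    then have "length P2 + d \<le> length ws" using gap1 x unfolding gap_def by auto
    then show "length R2 + 2 \<le> length ys" using zs ws len r by simp
  next
    fix ys assume ys: "walk O.E' ys" "distinct ys" "ys \<noteq> []" "hd ys = hd B" "last ys = last N1"
    have "set B \<inter> set N1 = {}" using newN QV by (auto simp: N_def)
    then obtain zs where "ys = B @ zs @ N1"
      using walk_between_threads[OF tB ne(4) tN1 N1(1) _ ys(1,3,4,5)] by metis
    moreover have "1 \<le> length B" using ne(4) by (cases B) auto
    ultimately show "length R1 + 2 \<le> length ys" using len N1 r by simp
  qed
  have tN1': "thread T.E' N1"
  proof (rule T.old_thread[OF tN1])
    have dN1: "distinct N1" by (simp add: N1_def)
    have "last Q' \<notin> set N1" "q \<notin> set N1" "hd B \<notin> set N1" "p \<notin> set N1" "y \<notin> set N1"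
      using newN QV mem N1(3) by (auto simp: N_def y_def p_def)
    then show "{last N1, p, last Q', q} \<inter> set (butlast N1) = {}"
      "{p, y, q, hd B} \<inter> set (tl N1) = {}"
      using notbl[OF dN1 N1(1)] by (auto dest: in_set_butlastD in_set_tlD)
    show "set N1 \<subseteq> {..<m}" using VN by (auto simp: N_def)
  qed
  have P1m: "set P1 \<subseteq> {..<m}" "p0 \<in> {..<m}" using PV VN by auto
  have P1N: "p \<notin> set P1" "y \<notin> set P1" "p \<noteq> p0" "y \<noteq> p0" using newN npy PV by auto
  have tP1': "thread T.E' P1"
  proof (rule T.old_thread[OF tP1 P1m(1)])
    have "last N1 \<notin> set P1" using newN npy PV by auto
    then show "{last N1, p, last Q', q} \<inter> set (butlast P1) = {}"
      using P1N PQ mem by (auto dest!: in_set_butlastD)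
    show "{p, y, q, hd B} \<inter> set (tl P1) = {}" using P1N PQ mem by (auto dest!: in_set_tlD)
  qed
  have hN: "hd N1 \<in> set N1" using N1(1) by simp
  have hNm: "hd N1 \<in> {..<m}" using hN VN by (auto simp: N_def)
  have hN': "hd N1 \<notin> {p, y, q, hd B}"
  proof -
    have "n \<le> hd N1" "hd N1 < p" using hN N1(3) by auto
    moreover have "q < n" "hd B < n" "p \<le> y" using QV mem by (auto simp: p_def y_def)
    ultimately show ?thesis by auto
  qed
  have gap2: "gap T.E' (last R2) (hd N1) (Suc (length P1))"
  proof (rule gap_to_thread_successor[where q = q and w = "hd B" and p = p0 and y = y])
    show "(last R2, z) \<in> T.E' \<longleftrightarrow> z = q \<or> z = hd B" for z by (rule T.arc_simps'(1))
    show "(z, hd N1) \<in> T.E' \<longleftrightarrow> z = p0 \<or> z = last P1" for z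
      using T.in_unchanged[OF hNm hN'] O.arc_simps(4) lastN(2) by simp
    show "(z, p0) \<in> T.E' \<longleftrightarrow> z = last P1 \<or> z = y" for z
    proof -
      have "p0 \<notin> {p, y, q, hd B}" using P1N PQ mem by auto
      then show ?thesis using T.in_unchanged[OF P1m(2)] O.arc_simps(5) lastN(1) by simp
    qed
    show "last R2 \<notin> set P1" using T.R_ends(8) P1m(1) by blast
    have "q \<notin> set N" "hd B \<notin> set N" using newN QV mem by auto
    then show "{q, hd B} \<inter> (set P1 \<union> {p0, y, hd N1}) = {}"
      using PQ mem npy hN' by auto
  qed (use tP1' ne P1 in auto)
  have "axis_drawable (?V \<union> set N) (E \<union> (path_arcs N \<union> tangency_arcs (last P1) p0 (hd P2) N N))
    (butlast P1 @ (last P1 # N @ [hd P2]) @ (tl P2 @ Q' @ [q] @ B))"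
  proof (rule axis_drawable_one_tangency[OF _ E])
    have "(P1 @ [p0] @ P2) @ Q' @ [q] @ B =
        butlast P1 @ [last P1, p0, hd P2] @ tl P2 @ Q' @ [q] @ B"
      using sP1 sP2 by (metis append.assoc append_Cons append_Nil)
    then show "axis_drawable ?V E (butlast P1 @ [last P1, p0, hd P2] @ tl P2 @ Q' @ [q] @ B)"
      using ax by simp
  qed (use lenN g O.N in auto)
  moreover have "butlast P1 @ (last P1 # N @ [hd P2]) @ (tl P2 @ Q' @ [q] @ B) =
      (P1 @ butlast N1) @ [last N1, p, y] @ (P2 @ butlast Q') @ [last Q', q, hd B] @ tl B"
  proof -
    have "butlast P1 @ (last P1 # N @ [hd P2]) @ (tl P2 @ Q' @ [q] @ B) =
      (butlast P1 @ [last P1]) @ N @ (hd P2 # tl P2) @ Q' @ [q] @ B" by simp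
    also have "\<dots> = P1 @ ((butlast N1 @ [last N1]) @ [p, y]) @ P2 @ (butlast Q' @ [last Q']) @ [q] @ (hd B # tl B)"
      unfolding N_def using ne N1(1) by simp
    finally show ?thesis by simp
  qed
  moreover have "E \<union> (path_arcs N \<union> tangency_arcs (last P1) p0 (hd P2) N N) = O.E'" by (auto simp: O.E'_def)
  ultimately have ax1: "axis_drawable {..<m} O.E'
      ((P1 @ butlast N1) @ [last N1, p, y] @ (P2 @ butlast Q') @ [last Q', q, hd B] @ tl B)"
    using VN by simp
  have Vm: "{..<m} \<union> (set R1 \<union> set R2) = {..<n + (2 * g - 3)}"
    unfolding R1R2 using g by (auto simp: m_def)
  have "axis_drawable ({..<m} \<union> (set R1 \<union> set R2))
    (O.E' \<union> (path_arcs R1 \<union> path_arcs R2 \<union> tangency_arcs (last N1) p y R1 R2 \<union> tangency_arcs (last Q') q (hd B) R2 R1))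
    ((P1 @ butlast N1) @ (last N1 # R2 @ [hd B]) @ tl B)"
    by (rule axis_drawable_two_tangencies[OF ax1 T.E_sub T.R])
  moreover have "O.E' \<union> (path_arcs R1 \<union> path_arcs R2 \<union> tangency_arcs (last N1) p y R1 R2 \<union> tangency_arcs (last Q') q (hd B) R2 R1) = T.E'"
    by (auto simp: T.E'_def)
  moreover have "(P1 @ butlast N1) @ (last N1 # R2 @ [hd B]) @ tl B =
      (P1 @ N1 @ R2) @ B @ []"
  proof -
    have "(P1 @ butlast N1) @ (last N1 # R2 @ [hd B]) @ tl B =
      P1 @ (butlast N1 @ [last N1]) @ R2 @ (hd B # tl B)" by simp
    also have "\<dots> = (P1 @ N1 @ R2) @ B @ []" using N1(1) ne by simp
    finally show ?thesis .
  qed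
  ultimately have "axis_drawable {..<n + (2 * g - 3)} T.E' ((P1 @ N1 @ R2) @ B @ [])"
    unfolding Vm by simp
  then have "axis_drawable {..<n + (2 * g - 3)} T.E' ((P1 @ N1) @ R2)"
    using axis_drawable_subset[of _ _ "P1 @ N1 @ R2" B "[]"] by simp
  then have "axis_drawable {..<n + (2 * g - 3)} T.E' (R2 @ (P1 @ N1))"
    by (rule axis_drawable_rotate)
  then have ax2: "axis_drawable {..<n + (2 * g - 3)} T.E' (R2 @ N1)"
    by (rule axis_drawable_subset)
  have sub: "T.E' \<subseteq> {..<n + (2 * g - 3)} \<times> {..<n + (2 * g - 3)}"
    using T.E'_sub Vm by (simp add: Un_assoc)
  have "set N1 \<subseteq> {..<m}" using VN by (auto simp: N_def)
  then have R2N1: "set R2 \<inter> set N1 = {}" using T.R(4) by blast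
  have tr2: "transversal_ge T.E' (k + 2)" using T.transversal[OF O.transversal[OF tr]] by simp
  have st': "stage g (k + 2) (n + (2 * g - 3)) T.E' R2 N1 (Suc (length P1))"
    unfolding stage_def using sub gi2 tr2 T.thread_R2 tN1' R2N1 gap2 ax2 by simp
  have "dicycle O.E' (N @ [p0])"
    using thread_walk[OF O.thread_N] O.arc_simps(1,3) O.N O.upw_simps
    by (auto simp: dicycle_def circuit_def successively_append_iff)
  then have "dicycle T.E' (N @ [p0])" using dicycle_mono T.E_E' by blast
  moreover have "length (N @ [p0]) = g" using lenN g by simp
  ultimately have cyc: "\<exists>xs. dicycle T.E' xs \<and> length xs = g" by blast
  have "E \<subseteq> T.E'" using O.E_E' T.E_E' by blast
  then show ?thesis using cyc st' len(1) N1(2) by blast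
qed

text \<open>The start is a single dicycle, drawn by filling a valley that has been made below one arc.\<close>

lemma stage_dicycle:
  assumes m: "6 \<le> m" and g: "g \<le> m"
  shows "\<exists>E P Q. length P = 3 \<and> length Q = 3 \<and> stage g 1 m E P Q (m - 6) \<and>
    (\<exists>xs. dicycle E xs \<and> length xs = m)"
proof -
  define N where "N = [2..<m]"
  define L where "L = 0 # N @ [1]"
  define E where "E = {(1, 0)} \<union> path_arcs L"
  have L: "distinct L" "length L = m" "set L = {..<m}" using m by (auto simp: L_def N_def)
  have N0: "N \<noteq> []" using m by (simp add: N_def)
  have outer: "1 \<notin> set (butlast L)" "0 \<notin> set (tl L)" using L(1) by (auto simp: L_def butlast_append)
  have thr: "thread E L"
    by (rule thread_cong[OF thread_path_arcs[OF L(1)]]) (use outer in \<open>auto simp: E_def\<close>)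
  have dc: "dicycle E L"
    using thread_walk[OF thr] L(1) by (auto simp: dicycle_def circuit_def E_def L_def)
  have sub: "E \<subseteq> {..<m} \<times> {..<m}" using path_arcs_subset[of L] L(3) m by (auto simp: E_def)
  have gi: "girth_ge E g"
    unfolding girth_ge_def
  proof (intro allI impI)
    fix xs assume xs: "dicycle E xs"
    then have "set xs \<subseteq> set L" "xs \<noteq> []" using dicycle_subset[OF xs sub] L(3)
      by (auto simp: dicycle_def circuit_def)
    then have "set L \<inter> set xs \<noteq> {}" by (cases xs) auto
    then have "set L \<subseteq> set xs" using thread_subset_dicycle[OF thr xs] by simp
    then have "card (set L) \<le> card (set xs)" by (intro card_mono) auto
    then show "g \<le> length xs" using L card_length[of xs] g by simp
  qed
  have tr: "transversal_ge E 1"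
    unfolding transversal_ge_def
  proof (intro allI impI, elim conjE)
    fix S assume S: "finite S" "hits E S"
    then have "set L \<inter> S \<noteq> {}" using dc by (auto simp: hits_def)
    then have "S \<noteq> {}" by blast
    then show "1 \<le> card S" using S(1) by (simp add: Suc_le_eq card_gt_0_iff)
  qed
  define P where "P = take 3 L"
  define Q where "Q = drop (m - 3) L"
  define M where "M = take (m - 6) (drop 3 L)"
  have LPQ: "L = P @ M @ Q"
  proof -
    have "m - 6 + 3 = m - 3" using m by simp
    then have "drop (m - 6) (drop 3 L) = Q" by (simp add: Q_def)
    then have "drop 3 L = M @ Q" using append_take_drop_id[of "m - 6" "drop 3 L"] by (simp add: M_def)
    then show ?thesis using append_take_drop_id[of 3 L] by (simp add: P_def)
  qed
  have len: "length P = 3" "length Q = 3" "length M = m - 6" using L(2) m by (simp_all add: P_def Q_def M_def)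
  have ne: "P \<noteq> []" "Q \<noteq> []" using len by auto
  have dPQ: "distinct (P @ M @ Q)" using L(1) LPQ by simp
  have thr': "thread E (P @ M @ Q)" using thr LPQ by simp
  have tP: "thread E P" and tQ: "thread E Q"
    using thr' thread_appendD[of E P "M @ Q"] thread_appendD[of E "P @ M" Q] by auto
  have "P @ M @ Q = butlast P @ (last P # M @ [hd Q]) @ tl Q" using ne by simp
  then have tm: "thread E (last P # M @ [hd Q])"
    using thr' thread_appendD by metis
  have gp: "gap E (last P) (hd Q) (m - 6)"
    unfolding gap_def
  proof (intro allI impI, elim conjE)
    fix zs assume zs: "walk E (last P # zs @ [hd Q])" "distinct (last P # zs @ [hd Q])"
    have "hd Q \<notin> set (butlast (last P # M @ [hd Q]))"
      using thread_distinct[OF tm] by (auto simp: butlast_append)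
    then obtain us where "last P # zs @ [hd Q] = (last P # M @ [hd Q]) @ us"
      using walk_leaving_thread[OF tm _ zs(1)] by auto
    then have "length (zs @ [hd Q]) = length (M @ [hd Q] @ us)" by simp
    then show "m - 6 \<le> length zs" using len(3) by simp
  qed
  have base: "axis_drawable {0, 1} {(1, 0)} ([] @ [0, 1] @ [])"
  proof -
    define \<phi> :: "nat \<Rightarrow> complex" where "\<phi> v = of_nat v" for v
    define \<gamma> :: "nat \<times> nat \<Rightarrow> real \<Rightarrow> complex" where "\<gamma> e = linepath (\<phi> (fst e)) (\<phi> (snd e))" for e
    have "lower_drawing {0, 1} {(1, 0)} [0, 1] \<phi> \<gamma>"
      unfolding lower_drawing_def plane_drawing_def
      using segment_same_level[of _ "\<phi> 1" "\<phi> 0" 0]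
      by (auto simp: \<phi>_def \<gamma>_def inj_on_def arc_linepath)
    then show ?thesis by (auto simp: axis_drawable_def)
  qed
  obtain \<xi> :: "nat \<Rightarrow> real" where \<xi>: "\<forall>x \<in> set N. -1 < \<xi> x \<and> \<xi> x < 1"
      "sorted_wrt (\<lambda>a b. \<xi> a < \<xi> b) N"
    using spread_out[of N] by (auto simp: N_def)
  define c where "c v = Complex (\<xi> v) 0" for v
  have setL: "set L = {0, 1} \<union> set N" by (auto simp: L_def)
  have "axis_drawable ({0, 1} \<union> set N) ({(1, 0)} \<union> path_arcs L) ([] @ L @ [])"
  proof (rule fill_valley[OF base, of "[-4, 4]" _ c])
    show "{0, 1} \<inter> set N = {}" by (auto simp: N_def)
    show "inj_on c (set N)" using inj_on_sorted[OF \<xi>(2)] by (auto simp: c_def inj_on_def)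
    show "c ` set N \<subseteq> bowl"
    proof
      fix z assume "z \<in> c ` set N"
      then obtain v where v: "v \<in> set N" "z = c v" by blast
      then have "\<bar>\<xi> v\<bar>\<^sup>2 \<le> 1\<^sup>2" using \<xi>(1) by (intro power_mono) auto
      then show "z \<in> bowl" using v by (simp add: c_def bowl_def)
    qed
    show "path_arcs L \<subseteq> (set [0, 1] \<union> set N) \<times> (set [0, 1] \<union> set N)"
      using path_arcs_subset[of L] unfolding setL by simp
    show "fst e \<noteq> snd e" if "e \<in> path_arcs L" for e
      using path_arcs_distinct[OF L(1), of "fst e" "snd e"] that by simp
    show "fst e \<in> set N \<or> snd e \<in> set N" if "e \<in> path_arcs L" for e
    proof -
      have "path_arcs L = path_arcs N \<union> {(0, hd N), (last N, 1)}"
        unfolding L_def by (rule path_arcs_outer[OF N0])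
      then show ?thesis using that N0 path_arcs_subset[of N] by auto
    qed
    show "set L \<subseteq> set [0, 1] \<union> set N" unfolding setL by simp
  next
    fix \<phi> :: "nat \<Rightarrow> complex" and S
    assume "map \<phi> [0, 1] = map (\<lambda>y. Complex y (y\<^sup>2 - 16)) [-4, 4]"
    then have at: "\<phi> 0 = Complex (-4) 0" "\<phi> 1 = Complex 4 0" by simp_all
    assume "\<And>v. v \<in> set N \<Longrightarrow> \<phi> v = c v"
    then have atN: "\<phi> v = Complex (\<xi> v) 0" "-1 < \<xi> v" "\<xi> v < 1" if "v \<in> set N" for v
      using that \<xi>(1) by (auto simp: c_def)
    assume S_def: "S = (\<lambda>e. closed_segment (\<phi> (fst e)) (\<phi> (snd e)))"
    have sN: "sorted_wrt (\<lambda>a b. Re (\<phi> a) < Re (\<phi> b)) N"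
      using \<xi>(2) by (rule sorted_wrt_mono_rel[rotated]) (auto simp: atN(1))
    have Ls: "sorted_wrt (\<lambda>a b. Re (\<phi> a) < Re (\<phi> b)) L"
    proof -
      have "Re (\<phi> 0) < Re (\<phi> v)" "Re (\<phi> v) < Re (\<phi> 1)" if "v \<in> set N" for v
        using at atN[OF that] by simp_all
      moreover have "Re (\<phi> 0) < Re (\<phi> 1)" using at by simp
      ultimately show ?thesis unfolding L_def using sN by (simp add: sorted_wrt_append)
    qed
    have L0: "Im (\<phi> v) = 0 \<and> -4 \<le> Re (\<phi> v) \<and> Re (\<phi> v) \<le> 4" if v: "v \<in> set L" for v
    proof -
      have "v = 0 \<or> v = 1 \<or> v \<in> set N" using v unfolding setL by auto
      then show ?thesis using at atN[of v] by (elim disjE) simp_all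
    qed
    then have LIm: "\<And>v. v \<in> set L \<Longrightarrow> Im (\<phi> v) = 0" by blast
    note H = horizontal_path_arcs[OF LIm Ls]
    show "(\<forall>e \<in> path_arcs L. S e \<inter> \<phi> ` set N \<subseteq> {\<phi> (fst e), \<phi> (snd e)}) \<and>
        (\<forall>e \<in> path_arcs L. \<forall>f \<in> path_arcs L. e \<noteq> f \<longrightarrow> S e \<inter> S f \<subseteq> \<phi> ` (set [0, 1] \<union> set N)) \<and>
        (\<forall>b \<in> set L. Im (\<phi> b) = 0 \<and> -4 \<le> Re (\<phi> b) \<and> Re (\<phi> b) \<le> 4) \<and>
        sorted_wrt (\<lambda>a b. Re (\<phi> a) < Re (\<phi> b)) L"
    proof (intro conjI ballI impI subsetI)
      fix e z assume e: "e \<in> path_arcs L" and "z \<in> S e \<inter> \<phi> ` set N"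
      then obtain v where "v \<in> set N" "z = \<phi> v" "z \<in> S e" by blast
      then have "v \<in> set L" "z = \<phi> v" "z \<in> S e" unfolding setL by simp_all
      then show "z \<in> {\<phi> (fst e), \<phi> (snd e)}"
        using H(2)[of "fst e" "snd e" z v] e by (simp add: S_def)
    next
      fix e f z assume ef: "e \<in> path_arcs L" "f \<in> path_arcs L" "e \<noteq> f" and z: "z \<in> S e \<inter> S f"
      then have "z = \<phi> (fst e) \<or> z = \<phi> (snd e)"
        using H(3)[of "fst e" "snd e" z "fst f" "snd f"] by (simp add: S_def)
      moreover have "fst e \<in> set L" "snd e \<in> set L" using ef(1) path_arcs_subset[of L] by auto
      ultimately show "z \<in> \<phi> ` (set [0, 1] \<union> set N)" unfolding setL by auto
    qed (use L0 Ls in blast)+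
  qed auto
  moreover have "{0, 1} \<union> set N = {..<m}" using setL L(3) by simp
  ultimately have "axis_drawable {..<m} E (P @ M @ Q)" using LPQ by (simp add: E_def)
  then have ax: "axis_drawable {..<m} E (P @ Q)" by (rule axis_drawable_subset)
  have "stage g 1 m E P Q (m - 6)"
    unfolding stage_def using sub gi tr tP tQ dPQ gp ax by auto
  then show ?thesis using len dc L(2) by blast
qed

section \<open>Growing the family\<close>

lemma two_elements: "length xs = 2 \<Longrightarrow> \<exists>a b. xs = [a, b]"
  by (auto simp: length_Suc_conv numeral_2_eq_2)

lemma stage_joins:
  assumes "stage g k n E P Q d" "2 * j < length P" "2 * j < length Q" "1 \<le> d" "d \<le> 3" "6 \<le> g"
    "g + 4 * j \<le> length P + length Q + d"
  shows "\<exists>E' P' Q'. E \<subseteq> E' \<and> stage g (k + j) (n + j * (g - 2)) E' P' Q' d \<and>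
    length P' = length P - 2 * j \<and> length Q' = length Q - 2 * j"
  using assms
proof (induction j)
  case (Suc j)
  then obtain E1 P1 Q1 where 1: "E \<subseteq> E1" "stage g (k + j) (n + j * (g - 2)) E1 P1 Q1 d"
    "length P1 = length P - 2 * j" "length Q1 = length Q - 2 * j" by auto
  have len: "3 \<le> length P1" "3 \<le> length Q1" using 1(3,4) Suc.prems(2,3) by auto
  define A where "A = take (length P1 - 2) P1"
  define B where "B = drop 2 Q1"
  have "length (drop (length P1 - 2) P1) = 2" using len by simp
  then obtain p x where "drop (length P1 - 2) P1 = [p, x]" using two_elements by blast
  then have P1: "P1 = A @ [p, x]" using append_take_drop_id[of "length P1 - 2" P1] by (simp add: A_def)
  have "length (take 2 Q1) = 2" using len by simp
  then obtain y q where "take 2 Q1 = [y, q]" using two_elements by blast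
  then have Q1: "Q1 = [y, q] @ B" using append_take_drop_id[of 2 Q1] by (simp add: B_def)
  have lA: "length A = length P - 2 * Suc j" "length B = length Q - 2 * Suc j"
    using 1(3,4) P1 Q1 by simp_all
  have "A \<noteq> []" "B \<noteq> []" "g \<le> length A + length B + d" using lA Suc.prems by auto
  then obtain E2 where "E1 \<subseteq> E2" "stage g (k + j + 1) (n + j * (g - 2) + (g - 2)) E2 A B d"
    using stage_join[OF 1(2)[unfolded P1 Q1]] Suc.prems by blast
  moreover have "k + j + 1 = k + Suc j" "n + j * (g - 2) + (g - 2) = n + Suc j * (g - 2)" by simp_all
  ultimately have "E \<subseteq> E2 \<and> stage g (k + Suc j) (n + Suc j * (g - 2)) E2 A B d" using 1(1) by auto
  then show ?case using lA by blast
qed (use assms in auto)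

text \<open>
  A stage in which no vertex is wasted: \<open>g + r\<close> is the length of the outer face, and the last equation
  is the invariant that relates it to the numbers of vertices and cycles. The number \<open>max 1 (r - 1)\<close>
  is the place of the next bump on \<open>P\<close>: the later it comes, the longer is the next gap, and the
  shorter is the outer path of the second coin, which may have at most \<open>g - 3\<close> vertices.
\<close>

definition tight_stage :: "nat \<Rightarrow> nat \<Rightarrow> nat \<Rightarrow> nat rel \<Rightarrow> bool" where
  "tight_stage g k n E \<longleftrightarrow> (\<exists>P Q d r. stage g k n E P Q d \<and> length P + length Q + d = g + r \<and> r \<le> 3 \<and>
     max 1 (r - 1) + 2 \<le> length P \<and> 3 \<le> length Q \<and> (g + 2) * n = g\<^sup>2 * k + (g + r) + g)"

text \<open>
  After \<open>stage_bump_join\<close> the outer face has length \<open>2 * g + r - 6\<close>, and each further coin with two tangencies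
  shortens it by \<open>4\<close>. So \<open>(g + r - 6) div 4\<close> further coins bring it back to a length between \<open>g\<close> and
  \<open>g + 3\<close>.
\<close>

lemma tight_stage_step:
  assumes ts: "tight_stage g k n E" and g: "8 \<le> g"
  shows "\<exists>k' n' E'. k < k' \<and> tight_stage g k' n' E' \<and> (\<exists>xs. dicycle E' xs \<and> length xs = g)"
proof -
  obtain P Q d r where st: "stage g k n E P Q d" and L: "length P + length Q + d = g + r" "r \<le> 3"
    and P: "max 1 (r - 1) + 2 \<le> length P" and Q: "3 \<le> length Q"
    and count: "(g + 2) * n = g\<^sup>2 * k + (g + r) + g"
    using ts by (auto simp: tight_stage_def)
  define t where "t = max 1 (r - 1)"
  have t: "1 \<le> t" "t \<le> 2" "t + 2 \<le> length P" using P L(2) by (auto simp: t_def)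
  have t_cases: "(r = 0 \<and> t = 1) \<or> (r = 1 \<and> t = 1) \<or> (r = 2 \<and> t = 1) \<or> (r = 3 \<and> t = 2)"
    using L(2) by (auto simp: t_def)
  define P1 where "P1 = take t P"
  define p0 where "p0 = P ! t"
  define P2 where "P2 = drop (Suc t) P"
  define Q' where "Q' = take (length Q - 2) Q"
  have P_eq: "P = P1 @ [p0] @ P2"
    using t id_take_nth_drop[of t P] by (simp add: P1_def p0_def P2_def)
  have "length (drop (length Q - 2) Q) = 2" using Q by simp
  then obtain q b where "drop (length Q - 2) Q = [q, b]" using two_elements by blast
  then have Q_eq: "Q = Q' @ [q] @ [b]"
    using append_take_drop_id[of "length Q - 2" Q] by (simp add: Q'_def)
  have len: "length P1 = t" "length P2 = length P - Suc t" "length Q' = length Q - 2"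
    using t by (simp_all add: P1_def P2_def Q'_def)
  define s where "s = g + r - t - 4"
  have s: "2 \<le> s" "s + 3 \<le> g" "s + 1 \<le> length P2 + d + length Q'"
    using len t Q L g t_cases by (auto simp: s_def)
  have "P1 \<noteq> []" "P2 \<noteq> []" "Q' \<noteq> []" "length P1 \<le> 2" "6 \<le> g" using len t Q g by auto
  then obtain E1 R N where E1: "\<exists>xs. dicycle E1 xs \<and> length xs = g" "length R = s" "length N = g - 3"
    "stage g (k + 2) (n + (2 * g - 3)) E1 R N (Suc t)"
    using stage_bump_join[OF st[unfolded P_eq Q_eq] _ _ _ _ _ s] len(1) by auto
  define j where "j = (g + r - 6) div 4"
  define r' where "r' = (g + r - 6) mod 4"
  have jr: "g + r - 6 = 4 * j + r'" "r' \<le> 3" by (simp_all add: j_def r'_def)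
  define t' where "t' = max 1 (r' - 1)"
  have t'_cases: "(r' = 0 \<and> t' = 1) \<or> (r' = 1 \<and> t' = 1) \<or> (r' = 2 \<and> t' = 1) \<or> (r' = 3 \<and> t' = 2)"
    using jr(2) by (auto simp: t'_def)
  have sj: "s = 4 * j + r' + 2 - t" "g - 3 = 4 * j + r' + 3 - r" "t + t' \<le> 2 * j + r'" "r \<le> 2 * j + r'"
  proof -
    have "j = 0 \<or> 1 \<le> j" by linarith
    then show "s = 4 * j + r' + 2 - t" "g - 3 = 4 * j + r' + 3 - r" "t + t' \<le> 2 * j + r'" "r \<le> 2 * j + r'"
      using jr g t_cases t'_cases by (auto simp: s_def)
  qed
  have j: "2 * j < s" "2 * j < g - 3" using sj t_cases t'_cases by auto
  obtain E2 P' Q'' where E2: "E1 \<subseteq> E2"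
    "stage g (k + 2 + j) (n + (2 * g - 3) + j * (g - 2)) E2 P' Q'' (Suc t)"
    "length P' = s - 2 * j" "length Q'' = g - 3 - 2 * j"
  proof -
    have "g + 4 * j \<le> length R + length N + Suc t" using E1(2,3) sj jr t_cases g by auto
    then show ?thesis using stage_joins[OF E1(4), of j] j E1(2,3) t g that by auto
  qed
  have "length P' + length Q'' + Suc t = g + r'" using E2(3,4) sj jr t_cases t'_cases g by auto
  moreover have "t' + 2 \<le> length P'" "3 \<le> length Q''" using E2(3,4) sj t_cases t'_cases by auto
  moreover have "(g + 2) * (n + (2 * g - 3) + j * (g - 2)) = g\<^sup>2 * (k + 2 + j) + (g + r') + g"
  proof -
    obtain h where h: "g = h + 8" using g by (metis add.commute le_Suc_ex)
    have n: "(h + 10) * n = (h + 8)\<^sup>2 * k + (h + 8 + r) + (h + 8)"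
      using count by (simp add: h add.commute)
    have r: "h + 2 + r = 4 * j + r'" using jr(1) by (simp add: h)
    have "(h + 10) * (n + (2 * h + 13) + j * (h + 6)) =
        (h + 8)\<^sup>2 * k + (h + 8 + r) + (h + 8) + (h + 10) * (2 * h + 13) + j * ((h + 10) * (h + 6))"
      using n by (simp add: algebra_simps)
    also have "\<dots> = (h + 8)\<^sup>2 * (k + 2 + j) + (h + 8 + r') + (h + 8)"
    proof -
      have "(h + 10) * (2 * h + 13) + (h + 8 + r) = 2 * (h + 8)\<^sup>2 + (h + 2 + r) + (h + 8)"
        by (simp add: power2_eq_square algebra_simps)
      moreover have "j * ((h + 10) * (h + 6)) + 4 * j = j * (h + 8)\<^sup>2"
        by (simp add: power2_eq_square algebra_simps)
      ultimately show ?thesis using r by (simp add: algebra_simps)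
    qed
    finally show ?thesis by (simp add: h add.commute)
  qed
  ultimately have "tight_stage g (k + 2 + j) (n + (2 * g - 3) + j * (g - 2)) E2"
    using E2(2) jr(2) unfolding tight_stage_def t'_def by blast
  moreover have "\<exists>xs. dicycle E2 xs \<and> length xs = g" using E1(1) dicycle_mono[OF _ E2(1)] by blast
  moreover have "k < k + 2 + j" by simp
  ultimately show ?thesis by blast
qed

lemma tight_stages:
  assumes g: "8 \<le> g"
  shows "\<exists>k n E. m \<le> k \<and> tight_stage g k n E \<and> (\<exists>xs. dicycle E xs \<and> length xs = g)"
proof (induction m)
  case 0
  obtain E P Q where E: "length P = 3" "length Q = 3" "stage g 1 g E P Q (g - 6)"
    "\<exists>xs. dicycle E xs \<and> length xs = g"
    using stage_dicycle[of g g] g by auto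
  have "(g + 2) * g = g\<^sup>2 * 1 + (g + 0) + g" by (simp add: power2_eq_square)
  then have "tight_stage g 1 g E"
    using E(1-3) g unfolding tight_stage_def
    by (intro exI[of _ P] exI[of _ Q] exI[of _ "g - 6"] exI[of _ 0]) simp
  then show ?case using E(4) by blast
next
  case (Suc m)
  then obtain k n E where "m \<le> k" "tight_stage g k n E" by blast
  then show ?case using tight_stage_step[OF _ g] by (meson Suc_leI le_less_trans)
qed

text \<open>
  For small \<open>g\<close> the outer face is only slightly longer than \<open>g\<close> and cannot be shortened by joins.
  Repeating the bump with an outer path of length \<open>3\<close> reproduces threads of length at least \<open>3\<close>, and
  the gap of \<open>2\<close>. The initial dicycle has length \<open>8\<close>, so that there is room for this pattern.
\<close>

lemma short_stages:
  assumes g: "6 \<le> g" "g \<le> 8"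
  shows "\<exists>E P Q d. stage g (2 * i + 1) (8 + i * (2 * g - 3)) E P Q d \<and> length P = 3 \<and> 3 \<le> length Q \<and>
    2 \<le> d \<and> (0 < i \<longrightarrow> (\<exists>xs. dicycle E xs \<and> length xs = g))"
proof (induction i)
  case 0
  obtain E P Q where "length P = 3" "length Q = 3" "stage g 1 8 E P Q (8 - 6)"
    using stage_dicycle[of 8 g] g by auto
  then show ?case by (intro exI[of _ E] exI[of _ P] exI[of _ Q] exI[of _ 2]) simp
next
  case (Suc i)
  then obtain E P Q d where st: "stage g (2 * i + 1) (8 + i * (2 * g - 3)) E P Q d"
    and len: "length P = 3" "3 \<le> length Q" "2 \<le> d" by blast
  obtain u p w where P: "P = [u] @ [p] @ [w]" using len(1) by (auto simp: length_Suc_conv numeral_3_eq_3)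
  obtain a q b B where Q: "Q = [a] @ [q] @ (b # B)" using len(2)
    by (metis Suc_le_length_iff append_Cons append_Nil numeral_3_eq_3)
  have ex: "\<exists>E' P' N1. E \<subseteq> E' \<and> (\<exists>xs. dicycle E' xs \<and> length xs = g) \<and> length P' = 3 \<and>
    length N1 = g - 3 \<and> stage g (2 * i + 1 + 2) (8 + i * (2 * g - 3) + (2 * g - 3)) E' P' N1 (Suc (length [u]))"
    by (rule stage_bump_join[OF st[unfolded P Q]]) (use len g in auto)
  then obtain E' P' N1 where "\<exists>xs. dicycle E' xs \<and> length xs = g" "length P' = 3"
    "length N1 = g - 3" "stage g (2 * Suc i + 1) (8 + Suc i * (2 * g - 3)) E' P' N1 2"
  proof -
    have "2 * i + 1 + 2 = 2 * Suc i + 1" "8 + i * (2 * g - 3) + (2 * g - 3) = 8 + Suc i * (2 * g - 3)"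
      "Suc (length [u]) = 2" by simp_all
    then show ?thesis using ex that by metis
  qed
  moreover have "3 \<le> length N1" using \<open>length N1 = g - 3\<close> g by simp
  ultimately show ?case by (metis order_refl)
qed

section \<open>Feedback vertex number and digirth\<close>

lemma pcas_walk:
  assumes "pcas u p v" "p \<noteq> []" "set p \<subseteq> E"
  shows "walk E (map fst p @ [v])" "hd (map fst p) = u" "pawalk_verts u p = map fst p @ [v]"
proof -
  have "walk E (map fst p @ [v]) \<and> hd (map fst p) = u \<and> pawalk_verts u p = map fst p @ [v]"
    using assms
  proof (induction p arbitrary: u)
    case (Cons e p)
    then show ?case by (cases p) (auto simp: successively_Cons)
  qed simp
  then show "walk E (map fst p @ [v])" "hd (map fst p) = u" "pawalk_verts u p = map fst p @ [v]" by auto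
qed

lemma walk_pcas:
  assumes "walk E (xs @ [v])" "xs \<noteq> []"
  shows "\<exists>p. pcas (hd xs) p v \<and> map fst p = xs \<and> set p \<subseteq> E"
  using assms
proof (induction xs)
  case (Cons x xs)
  show ?case
  proof (cases xs)
    case Nil
    then show ?thesis using Cons.prems by (intro exI[of _ "[(x, v)]"]) auto
  next
    case (Cons y ys)
    have "walk E (xs @ [v])" "xs \<noteq> []" using Cons.prems Cons by auto
    then obtain p where "pcas y p v" "map fst p = xs" "set p \<subseteq> E"
      using Cons.IH Cons by (metis list.sel(1))
    then show ?thesis using Cons.prems Cons by (intro exI[of _ "(x, y) # p"]) auto
  qed
qed simp

lemma cycle_dgraph:
  "pre_digraph.cycle (dgraph V E) p \<longleftrightarrow>
    (\<exists>u \<in> V. set p \<subseteq> E \<and> pcas u p u \<and> distinct (tl (pawalk_verts u p)) \<and> p \<noteq> [])"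
  by (auto simp: pre_digraph.cycle_def pre_digraph.awalk_def cas_with_proj_eq awalk_verts_with_proj_eq)

lemma cycle_dicycle:
  assumes "pre_digraph.cycle (dgraph V E) p"
  shows "dicycle E (map fst p)"
proof -
  obtain u where u: "set p \<subseteq> E" "pcas u p u" "distinct (tl (pawalk_verts u p))" "p \<noteq> []"
    using assms cycle_dgraph by blast
  note w = pcas_walk[OF u(2,4,1)]
  obtain e q where p: "p = e # q" using u(4) by (cases p) auto
  have "distinct (tl (map fst p @ [u]))" using u(3) w(3) by simp
  then have "distinct (map fst p)" using w(2) p by auto
  then show ?thesis
    using w(1,2) u(4) by (auto simp: dicycle_def circuit_def successively_append_iff)
qed

lemma dicycle_cycle:
  assumes "dicycle E xs" "set xs \<subseteq> V"
  shows "\<exists>p. pre_digraph.cycle (dgraph V E) p \<and> map fst p = xs"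
proof -
  have xs: "xs \<noteq> []" "walk E (xs @ [hd xs])" "distinct xs"
    using assms(1) by (auto simp: dicycle_def circuit_def successively_append_iff)
  obtain p where p: "pcas (hd xs) p (hd xs)" "map fst p = xs" "set p \<subseteq> E"
    using walk_pcas[OF xs(2,1)] by blast
  have ne: "p \<noteq> []" using p(2) xs(1) by auto
  have "pawalk_verts (hd xs) p = xs @ [hd xs]" using pcas_walk(3)[OF p(1) ne p(3)] p(2) by simp
  moreover have "distinct (tl (xs @ [hd xs]))" using xs by (cases xs) auto
  moreover have "hd xs \<in> V" using xs(1) assms(2) by auto
  ultimately have "pre_digraph.cycle (dgraph V E) p" using p ne unfolding cycle_dgraph by metis
  then show ?thesis using p(2) by blast
qed

lemma induced_dgraph: "dgraph V E \<restriction> W = dgraph W (E \<inter> W \<times> W)"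
  by (auto simp: induce_subgraph_def with_proj_def)

lemma fv_ge_transversal:
  assumes "transversal_ge E k" "finite V" "E \<subseteq> V \<times> V"
  shows "k \<le> fv (dgraph V E)"
proof -
  let ?size = "\<lambda>k. \<exists>S. feedback_vertex_set (dgraph V E) S \<and> card S = k"
  have "\<exists>k. ?size k" using feedback_vertex_set_verts by blast
  then have "?size (fv (dgraph V E))" unfolding fv_def by (rule LeastI_ex)
  then obtain S where S: "feedback_vertex_set (dgraph V E) S" "card S = fv (dgraph V E)" by blast
  have SV: "S \<subseteq> V" and no: "\<And>p. \<not> pre_digraph.cycle (dgraph (V - S) (E \<inter> (V - S) \<times> (V - S))) p"
    using S(1) unfolding feedback_vertex_set_def induced_dgraph with_proj_simps by simp_all
  have "hits E S"
    unfolding hits_def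
  proof (intro allI impI notI)
    fix xs assume xs: "dicycle E xs" "set xs \<inter> S = {}"
    then have sub: "set xs \<subseteq> V - S" using dicycle_subset[OF xs(1) assms(3)] by blast
    have "dicycle (E \<inter> (V - S) \<times> (V - S)) xs" using dicycle_restrict[OF xs(1) sub] by simp
    then show False using dicycle_cycle[OF _ sub] no by blast
  qed
  then show ?thesis using assms(1,2) SV S(2) finite_subset unfolding transversal_ge_def by metis
qed

lemma stage_ratio_le_tau:
  assumes st: "stage g k n E P Q d" and cyc: "\<exists>xs. dicycle E xs \<and> length xs = g" and g: "3 \<le> g"
  shows "real k \<le> tau g * real n"
proof -
  let ?V = "{..<n}" and ?D = "\<lparr>pverts = {..<n}, parcs = E\<rparr> :: nat pair_pre_digraph"
  have E: "E \<subseteq> ?V \<times> ?V" and gi: "girth_ge E g" and tr: "transversal_ge E k"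
    and ax: "axis_drawable ?V E (P @ Q)" using st by (auto simp: stage_def)
  have n: "0 < n" using cyc E dicycle_subset[of E _ ?V] by (fastforce simp: dicycle_def circuit_def)
  have noloop: "(x, x) \<notin> E" for x
  proof
    assume "(x, x) \<in> E"
    then have "dicycle E [x]" by (simp add: dicycle_def circuit_def)
    then show False using gi g by (auto simp: girth_ge_def)
  qed
  have "finite E" using E finite_subset by blast
  then interpret D: pair_digraph ?D
    by unfold_locales (use E noloop in auto)
  have digirth: "digirth (with_proj ?D) = enat g"
  proof (rule antisym)
    obtain xs where xs: "dicycle E xs" "length xs = g" using cyc by blast
    then obtain p where "pre_digraph.cycle (dgraph ?V E) p" "map fst p = xs"
      using dicycle_cycle dicycle_subset[OF xs(1) E] by blast
    then show "digirth (with_proj ?D) \<le> enat g"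
      unfolding digirth_def using xs(2) by (intro INF_lower2[of p]) auto
    show "enat g \<le> digirth (with_proj ?D)"
      unfolding digirth_def
    proof (rule INF_greatest)
      fix p assume "p \<in> {p. pre_digraph.cycle (dgraph ?V E) p}"
      then have "dicycle E (map fst p)" using cycle_dicycle by blast
      then show "enat g \<le> enat (length p)" using gi by (auto simp: girth_ge_def)
    qed
  qed
  have "digraph (with_proj ?D)" by unfold_locales
  moreover have "(3 :: enat) \<le> enat g" using g by (simp add: numeral_eq_enat)
  ultimately have "oriented_graph (with_proj ?D)"
    unfolding oriented_graph_def digirth by simp
  moreover have "planar (with_proj ?D)"
    using ax by (auto simp: axis_drawable_def lower_drawing_def planar_def)
  ultimately have "real (fv ?D) / real (card (verts (with_proj ?D))) \<in> fv_ratios g"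
    unfolding fv_ratios_def using digirth by blast
  then have "real (fv ?D) / real n \<le> tau g"
    unfolding tau_def using cSup_upper[OF _ bdd_above_fv_ratios] by fastforce
  moreover have "real k \<le> real (fv ?D)" using fv_ge_transversal[OF tr _ E] by simp
  ultimately show ?thesis using n by (simp add: field_simps)
qed

section \<open>The lower bounds\<close>

text \<open>
  For feedback vertex number at least \<open>k\<close> on at most \<open>(b * k + c) / a\<close> vertices, with \<open>k\<close> unbounded, the
  constant \<open>c\<close> disappears in the limit.
\<close>

lemma slope_le:
  fixes a b c t :: real
  assumes b: "0 < b" and "\<And>m::nat. \<exists>k\<ge>m. a * real k \<le> t * (b * real k + c)"
  shows "a / b \<le> t"
proof (rule ccontr)
  assume "\<not> a / b \<le> t"
  then have pos: "0 < a - t * b" using b by (simp add: field_simps)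
  obtain m :: nat where m: "t * c / (a - t * b) < real m" using reals_Archimedean2 by blast
  obtain k where k: "m \<le> k" "a * real k \<le> t * (b * real k + c)" using assms(2) by blast
  have "(a - t * b) * real k \<le> t * c" using k(2) by (simp add: algebra_simps)
  then have "real k \<le> t * c / (a - t * b)" using pos by (simp add: field_simps)
  then show False using m k(1) by linarith
qed

lemma tau_nonneg_of_stage: "real k \<le> t * real n \<Longrightarrow> 0 < k \<Longrightarrow> 0 \<le> t"
  by (metis mult_nonpos_nonneg not_le of_nat_0_le_iff of_nat_0_less_iff order_less_le_trans less_eq_real_def)

lemma tau_ge_long:
  assumes g: "8 \<le> g"
  shows "(real g + 2) / (real g)\<^sup>2 \<le> tau g"
proof (rule slope_le[where c = "2 * real g + 3"])
  show "0 < (real g)\<^sup>2" using g by simp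
  fix m :: nat
  obtain k n E where k: "Suc m \<le> k" "tight_stage g k n E" "\<exists>xs. dicycle E xs \<and> length xs = g"
    using tight_stages[OF g] by blast
  then obtain P Q d r where st: "stage g k n E P Q d" and r: "r \<le> 3"
    and count: "(g + 2) * n = g\<^sup>2 * k + (g + r) + g"
    by (auto simp: tight_stage_def)
  have kn: "real k \<le> tau g * real n" using stage_ratio_le_tau[OF st k(3)] g by simp
  then have t0: "0 \<le> tau g" using tau_nonneg_of_stage k(1) by force
  have "real ((g + 2) * n) \<le> real (g\<^sup>2 * k + 2 * g + 3)" unfolding of_nat_le_iff using count r by simp
  then have n: "(real g + 2) * real n \<le> (real g)\<^sup>2 * real k + (2 * real g + 3)" by (simp add: algebra_simps)
  have "(real g + 2) * real k \<le> (real g + 2) * (tau g * real n)" using kn by (intro mult_left_mono) auto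
  also have "\<dots> = tau g * ((real g + 2) * real n)" by simp
  also have "\<dots> \<le> tau g * ((real g)\<^sup>2 * real k + (2 * real g + 3))" using n t0 by (intro mult_left_mono)
  finally show "\<exists>k\<ge>m. (real g + 2) * real k \<le> tau g * ((real g)\<^sup>2 * real k + (2 * real g + 3))"
    using k(1) by (intro exI[of _ k]) auto
qed

lemma tau_ge_short:
  assumes g: "6 \<le> g" "g \<le> 8"
  shows "2 / (2 * real g - 3) \<le> tau g"
proof (rule slope_le[where c = "19 - 2 * real g"])
  show "0 < 2 * real g - 3" using g by simp
  fix m :: nat
  obtain E P Q d where st: "stage g (2 * Suc m + 1) (8 + Suc m * (2 * g - 3)) E P Q d"
    and cyc: "\<exists>xs. dicycle E xs \<and> length xs = g"
    using short_stages[OF g, of "Suc m"] by blast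
  have "real (2 * Suc m + 1) \<le> tau g * real (8 + Suc m * (2 * g - 3))"
    using stage_ratio_le_tau[OF st cyc] g by simp
  moreover have "2 * real (8 + Suc m * (2 * g - 3)) = (2 * real g - 3) * real (2 * Suc m + 1) + (19 - 2 * real g)"
  proof -
    have "real (2 * g - 3) = 2 * real g - 3" using g by (simp add: of_nat_diff)
    then show ?thesis unfolding of_nat_add of_nat_mult by (simp add: algebra_simps)
  qed
  ultimately have "2 * real (2 * Suc m + 1) \<le> tau g * ((2 * real g - 3) * real (2 * Suc m + 1) + (19 - 2 * real g))"
    by (metis mult.left_commute mult_le_cancel_left_pos zero_less_numeral)
  then show "\<exists>k\<ge>m. 2 * real k \<le> tau g * ((2 * real g - 3) * real k + (19 - 2 * real g))"
    by (intro exI[of _ "2 * Suc m + 1"]) simp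
qed

theorem corollary69:
  fixes g :: nat
  assumes "g \<ge> 6"
  shows "(g \<noteq> 7 \<longrightarrow> tau g \<ge> (real g + 2) / (real g)\<^sup>2) \<and>
         (tau 7 \<ge> 1 / (7 - 3 / 2) \<and> 1 / (7 - 3 / 2) = (2 / 11 :: real))"
proof (intro conjI impI)
  assume "g \<noteq> 7"
  then consider "g = 6" | "8 \<le> g" using assms by linarith
  then show "tau g \<ge> (real g + 2) / (real g)\<^sup>2"
  proof cases
    case 1
    then show ?thesis using tau_ge_short[of 6] by (simp add: power2_eq_square)
  qed (rule tau_ge_long)
next
  show "tau 7 \<ge> 1 / (7 - 3 / 2)" using tau_ge_short[of 7] by simp
  show "1 / (7 - 3 / 2) = (2 / 11 :: real)" by simp
qed

end
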